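(* For every type $A:\mathcal{U}$, the type $\|A\|_{-1}$, defined as the sequential colimit of $$\emptyset\to A\xrightarrow{\mathsf{inr}}A\ast A\xrightarrow{\mathsf{inr}}A\ast(A\ast A)\xrightarrow{\mathsf{inr}}\cdots,$$ is a mere proposition satisfying the universal property of propositional truncation: for every mere proposition $B$, precomposition with the canonical map $A\to\|A\|_{-1}$ is an equivalence $(\|A\|_{-1}\to B)\simeq(A\to B)$.
   Context: Setting: Martin-Löf type theory with function extensionality and a univalent universe $\mathcal{U}$ containing the usual types (including $\mathbb{N}$) and closed under graph quotients (homotopy coequalizers), hence under pushouts and sequential colimits. No propositional truncation is assumed. The join $P\ast Q$ of types is the pushout of the projections $P\leftarrow P\times Q\to Q$, with constructors $\mathsf{inl}:P\to P\ast Q$, $\mathsf{inr}:Q\to P\ast Q$. In the sequence, the $n$-th type is the join power $A^{\ast n}$ with $A^{\ast 0}=\emptyset$ and $A^{\ast(n+1)}=A\ast A^{\ast n}$ (with $A\ast\emptyset$ identified with $A$), and the transition maps are $\mathsf{inr}$. The canonical map $A\to\|A\|_{-1}$ is the inclusion of the stage $A$ of the sequence into the colimit. *)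

theory Defs
  imports Main
begin

text \<open>
  Martin-Loef type theory with function extensionality and one univalent universe that is closed
  under graph quotients (homotopy coequalizers), given by its raw syntax and its derivations.
  Statements of type theory become statements that certain judgements are derivable.

  Terms are in de Bruijn form: the number of variables bound in an argument of a constructor is
  noted next to it. The theory distinguishes types from elements of \<open>U\<close>; a type is a term \<open>A\<close> with
  \<open>\<Gamma> \<turnstile> A \<Colon> Type\<close>. The symbol \<open>Type\<close> is only a sort: it has no type itself and cannot occur in a
  context.
\<close>

datatype tm =
    Var nat
  | Type
  | U
  | Pi tm tm                          \<comment> \<open>\<open>Pi A B\<close>: 1 in \<open>B\<close>\<close>
  | Lam tm tm                         \<comment> \<open>\<open>Lam A b\<close>: 1 in \<open>b\<close>\<close>
  | App tm tm
  | Sig tm tm                         \<comment> \<open>\<open>Sig A B\<close>: 1 in \<open>B\<close>\<close>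
  | Pair tm tm tm tm                  \<comment> \<open>\<open>Pair A B a b\<close>: 1 in \<open>B\<close>\<close>
  | SigInd tm tm tm tm tm             \<comment> \<open>\<open>SigInd A B C g p\<close>: 1 in \<open>B\<close>, \<open>C\<close>; 2 in \<open>g\<close>\<close>
  | Eq tm tm tm
  | Refl tm tm
  | J tm tm tm tm tm tm               \<comment> \<open>\<open>J A a C c b p\<close>: 2 in \<open>C\<close>\<close>
  | Empty
  | EmptyInd tm tm                    \<comment> \<open>\<open>EmptyInd C e\<close>: 1 in \<open>C\<close>\<close>
  | Unit
  | Star
  | UnitInd tm tm tm                  \<comment> \<open>\<open>UnitInd C c e\<close>: 1 in \<open>C\<close>\<close>
  | Sum tm tm
  | InL tm tm tm
  | InR tm tm tm
  | SumInd tm tm tm tm tm tm          \<comment> \<open>\<open>SumInd A B C c d e\<close>: 1 in \<open>C\<close>, \<open>c\<close>, \<open>d\<close>\<close>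
  | Nat
  | Zero
  | Succ tm
  | NatInd tm tm tm tm                \<comment> \<open>\<open>NatInd C z s n\<close>: 1 in \<open>C\<close>; 2 in \<open>s\<close>\<close>
  | Coeq tm tm tm tm
  | CPt tm tm tm tm tm
  | CGlue tm tm tm tm tm
  | CInd tm tm tm tm tm tm tm tm      \<comment> \<open>\<open>CInd E V s t P d g x\<close>: 1 in \<open>P\<close>, \<open>d\<close>, \<open>g\<close>\<close>
  | CBeta tm tm tm tm tm tm tm tm     \<comment> \<open>\<open>CBeta E V s t P d g e\<close>: 1 in \<open>P\<close>, \<open>d\<close>, \<open>g\<close>\<close>
  | FunExt tm tm tm tm                \<comment> \<open>\<open>FunExt A B f g\<close>: 1 in \<open>B\<close>\<close>
  | UA tm tm


section \<open>Renaming and substitution\<close>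

definition upr :: "(nat \<Rightarrow> nat) \<Rightarrow> nat \<Rightarrow> nat" where
  "upr \<xi> = case_nat 0 (\<lambda>i. Suc (\<xi> i))"

primrec ren :: "tm \<Rightarrow> (nat \<Rightarrow> nat) \<Rightarrow> tm" where
  "ren (Var i) \<xi> = Var (\<xi> i)"
| "ren Type \<xi> = Type"
| "ren U \<xi> = U"
| "ren (Pi A B) \<xi> = Pi (ren A \<xi>) (ren B (upr \<xi>))"
| "ren (Lam A b) \<xi> = Lam (ren A \<xi>) (ren b (upr \<xi>))"
| "ren (App f a) \<xi> = App (ren f \<xi>) (ren a \<xi>)"
| "ren (Sig A B) \<xi> = Sig (ren A \<xi>) (ren B (upr \<xi>))"
| "ren (Pair A B a b) \<xi> = Pair (ren A \<xi>) (ren B (upr \<xi>)) (ren a \<xi>) (ren b \<xi>)"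
| "ren (SigInd A B C g p) \<xi> =
     SigInd (ren A \<xi>) (ren B (upr \<xi>)) (ren C (upr \<xi>)) (ren g (upr (upr \<xi>))) (ren p \<xi>)"
| "ren (Eq A a b) \<xi> = Eq (ren A \<xi>) (ren a \<xi>) (ren b \<xi>)"
| "ren (Refl A a) \<xi> = Refl (ren A \<xi>) (ren a \<xi>)"
| "ren (J A a C c b p) \<xi> =
     J (ren A \<xi>) (ren a \<xi>) (ren C (upr (upr \<xi>))) (ren c \<xi>) (ren b \<xi>) (ren p \<xi>)"
| "ren Empty \<xi> = Empty"
| "ren (EmptyInd C e) \<xi> = EmptyInd (ren C (upr \<xi>)) (ren e \<xi>)"
| "ren Unit \<xi> = Unit"
| "ren Star \<xi> = Star"
| "ren (UnitInd C c e) \<xi> = UnitInd (ren C (upr \<xi>)) (ren c \<xi>) (ren e \<xi>)"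
| "ren (Sum A B) \<xi> = Sum (ren A \<xi>) (ren B \<xi>)"
| "ren (InL A B a) \<xi> = InL (ren A \<xi>) (ren B \<xi>) (ren a \<xi>)"
| "ren (InR A B b) \<xi> = InR (ren A \<xi>) (ren B \<xi>) (ren b \<xi>)"
| "ren (SumInd A B C c d e) \<xi> =
     SumInd (ren A \<xi>) (ren B \<xi>) (ren C (upr \<xi>)) (ren c (upr \<xi>)) (ren d (upr \<xi>)) (ren e \<xi>)"
| "ren Nat \<xi> = Nat"
| "ren Zero \<xi> = Zero"
| "ren (Succ n) \<xi> = Succ (ren n \<xi>)"
| "ren (NatInd C z s n) \<xi> = NatInd (ren C (upr \<xi>)) (ren z \<xi>) (ren s (upr (upr \<xi>))) (ren n \<xi>)"
| "ren (Coeq E V s t) \<xi> = Coeq (ren E \<xi>) (ren V \<xi>) (ren s \<xi>) (ren t \<xi>)"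
| "ren (CPt E V s t v) \<xi> = CPt (ren E \<xi>) (ren V \<xi>) (ren s \<xi>) (ren t \<xi>) (ren v \<xi>)"
| "ren (CGlue E V s t e) \<xi> = CGlue (ren E \<xi>) (ren V \<xi>) (ren s \<xi>) (ren t \<xi>) (ren e \<xi>)"
| "ren (CInd E V s t P d g x) \<xi> =
     CInd (ren E \<xi>) (ren V \<xi>) (ren s \<xi>) (ren t \<xi>)
       (ren P (upr \<xi>)) (ren d (upr \<xi>)) (ren g (upr \<xi>)) (ren x \<xi>)"
| "ren (CBeta E V s t P d g e) \<xi> =
     CBeta (ren E \<xi>) (ren V \<xi>) (ren s \<xi>) (ren t \<xi>)
       (ren P (upr \<xi>)) (ren d (upr \<xi>)) (ren g (upr \<xi>)) (ren e \<xi>)"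
| "ren (FunExt A B f g) \<xi> = FunExt (ren A \<xi>) (ren B (upr \<xi>)) (ren f \<xi>) (ren g \<xi>)"
| "ren (UA A B) \<xi> = UA (ren A \<xi>) (ren B \<xi>)"

definition ups :: "(nat \<Rightarrow> tm) \<Rightarrow> nat \<Rightarrow> tm" where
  "ups \<sigma> = case_nat (Var 0) (\<lambda>i. ren (\<sigma> i) Suc)"

primrec subst :: "tm \<Rightarrow> (nat \<Rightarrow> tm) \<Rightarrow> tm" where
  "subst (Var i) \<sigma> = \<sigma> i"
| "subst Type \<sigma> = Type"
| "subst U \<sigma> = U"
| "subst (Pi A B) \<sigma> = Pi (subst A \<sigma>) (subst B (ups \<sigma>))"
| "subst (Lam A b) \<sigma> = Lam (subst A \<sigma>) (subst b (ups \<sigma>))"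
| "subst (App f a) \<sigma> = App (subst f \<sigma>) (subst a \<sigma>)"
| "subst (Sig A B) \<sigma> = Sig (subst A \<sigma>) (subst B (ups \<sigma>))"
| "subst (Pair A B a b) \<sigma> = Pair (subst A \<sigma>) (subst B (ups \<sigma>)) (subst a \<sigma>) (subst b \<sigma>)"
| "subst (SigInd A B C g p) \<sigma> =
     SigInd (subst A \<sigma>) (subst B (ups \<sigma>)) (subst C (ups \<sigma>)) (subst g (ups (ups \<sigma>))) (subst p \<sigma>)"
| "subst (Eq A a b) \<sigma> = Eq (subst A \<sigma>) (subst a \<sigma>) (subst b \<sigma>)"
| "subst (Refl A a) \<sigma> = Refl (subst A \<sigma>) (subst a \<sigma>)"
| "subst (J A a C c b p) \<sigma> =
     J (subst A \<sigma>) (subst a \<sigma>) (subst C (ups (ups \<sigma>))) (subst c \<sigma>) (subst b \<sigma>) (subst p \<sigma>)"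
| "subst Empty \<sigma> = Empty"
| "subst (EmptyInd C e) \<sigma> = EmptyInd (subst C (ups \<sigma>)) (subst e \<sigma>)"
| "subst Unit \<sigma> = Unit"
| "subst Star \<sigma> = Star"
| "subst (UnitInd C c e) \<sigma> = UnitInd (subst C (ups \<sigma>)) (subst c \<sigma>) (subst e \<sigma>)"
| "subst (Sum A B) \<sigma> = Sum (subst A \<sigma>) (subst B \<sigma>)"
| "subst (InL A B a) \<sigma> = InL (subst A \<sigma>) (subst B \<sigma>) (subst a \<sigma>)"
| "subst (InR A B b) \<sigma> = InR (subst A \<sigma>) (subst B \<sigma>) (subst b \<sigma>)"
| "subst (SumInd A B C c d e) \<sigma> =
     SumInd (subst A \<sigma>) (subst B \<sigma>) (subst C (ups \<sigma>)) (subst c (ups \<sigma>)) (subst d (ups \<sigma>))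
       (subst e \<sigma>)"
| "subst Nat \<sigma> = Nat"
| "subst Zero \<sigma> = Zero"
| "subst (Succ n) \<sigma> = Succ (subst n \<sigma>)"
| "subst (NatInd C z s n) \<sigma> =
     NatInd (subst C (ups \<sigma>)) (subst z \<sigma>) (subst s (ups (ups \<sigma>))) (subst n \<sigma>)"
| "subst (Coeq E V s t) \<sigma> = Coeq (subst E \<sigma>) (subst V \<sigma>) (subst s \<sigma>) (subst t \<sigma>)"
| "subst (CPt E V s t v) \<sigma> =
     CPt (subst E \<sigma>) (subst V \<sigma>) (subst s \<sigma>) (subst t \<sigma>) (subst v \<sigma>)"
| "subst (CGlue E V s t e) \<sigma> =
     CGlue (subst E \<sigma>) (subst V \<sigma>) (subst s \<sigma>) (subst t \<sigma>) (subst e \<sigma>)"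
| "subst (CInd E V s t P d g x) \<sigma> =
     CInd (subst E \<sigma>) (subst V \<sigma>) (subst s \<sigma>) (subst t \<sigma>)
       (subst P (ups \<sigma>)) (subst d (ups \<sigma>)) (subst g (ups \<sigma>)) (subst x \<sigma>)"
| "subst (CBeta E V s t P d g e) \<sigma> =
     CBeta (subst E \<sigma>) (subst V \<sigma>) (subst s \<sigma>) (subst t \<sigma>)
       (subst P (ups \<sigma>)) (subst d (ups \<sigma>)) (subst g (ups \<sigma>)) (subst e \<sigma>)"
| "subst (FunExt A B f g) \<sigma> = FunExt (subst A \<sigma>) (subst B (ups \<sigma>)) (subst f \<sigma>) (subst g \<sigma>)"
| "subst (UA A B) \<sigma> = UA (subst A \<sigma>) (subst B \<sigma>)"

text \<open>\<open>shift n k t\<close> weakens \<open>t\<close> by \<open>n\<close> fresh variables placed just outside its \<open>k\<close> innermost ones.\<close>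

definition shift :: "nat \<Rightarrow> nat \<Rightarrow> tm \<Rightarrow> tm" where
  "shift n k t = ren t (\<lambda>i. if i < k then i else i + n)"

definition wk :: "nat \<Rightarrow> tm \<Rightarrow> tm" where
  "wk n t = shift n 0 t"

text \<open>
  \<open>sub a t\<close> is \<open>t[a]\<close> for \<open>t\<close> over \<open>\<Gamma>, x\<close>; \<open>sub2 a b t\<close> is \<open>t[a, b]\<close> for \<open>t\<close> over \<open>\<Gamma>, x, y\<close>.
  In \<open>inst m a t\<close>, the term \<open>a\<close> lives over an extension of \<open>\<Gamma>\<close> by \<open>m\<close> variables, and so does the
  result; thus \<open>inst 0 = sub\<close>.
\<close>

definition sub :: "tm \<Rightarrow> tm \<Rightarrow> tm" where
  "sub a t = subst t (case_nat a Var)"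

definition sub2 :: "tm \<Rightarrow> tm \<Rightarrow> tm \<Rightarrow> tm" where
  "sub2 a b t = subst t (case_nat b (case_nat a Var))"

definition inst :: "nat \<Rightarrow> tm \<Rightarrow> tm \<Rightarrow> tm" where
  "inst m a t = subst t (case_nat a (\<lambda>i. Var (i + m)))"


section \<open>Types and functions occurring in the rules\<close>

definition Arr :: "tm \<Rightarrow> tm \<Rightarrow> tm" where
  "Arr A B = Pi A (wk 1 B)"

definition Prod :: "tm \<Rightarrow> tm \<Rightarrow> tm" where
  "Prod A B = Sig A (wk 1 B)"

text \<open>Being an equivalence means having a right inverse and a left inverse, as pieces of structure.\<close>

definition hasSection :: "tm \<Rightarrow> tm \<Rightarrow> tm \<Rightarrow> tm" where
  "hasSection X Y f =
     Sig (Arr Y X)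
       (Pi (wk 1 Y) (Eq (wk 2 Y) (App (wk 2 f) (App (Var 1) (Var 0))) (Var 0)))"

definition hasRetraction :: "tm \<Rightarrow> tm \<Rightarrow> tm \<Rightarrow> tm" where
  "hasRetraction X Y f =
     Sig (Arr Y X)
       (Pi (wk 1 X) (Eq (wk 2 X) (App (Var 1) (App (wk 2 f) (Var 0))) (Var 0)))"

definition isEquiv :: "tm \<Rightarrow> tm \<Rightarrow> tm \<Rightarrow> tm" where
  "isEquiv X Y f = Prod (hasSection X Y f) (hasRetraction X Y f)"

definition Equiv :: "tm \<Rightarrow> tm \<Rightarrow> tm" where
  "Equiv X Y = Sig (Arr X Y) (isEquiv (wk 1 X) (wk 1 Y) (Var 0))"

definition idfun :: "tm \<Rightarrow> tm" where
  "idfun A = Lam A (Var 0)"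

definition idIsEquiv :: "tm \<Rightarrow> tm" where
  "idIsEquiv A =
     Pair (hasSection A A (idfun A)) (wk 1 (hasRetraction A A (idfun A)))
       (Pair (Arr A A) (Pi (wk 1 A) (Eq (wk 2 A) (App (wk 2 (idfun A)) (App (Var 1) (Var 0))) (Var 0)))
         (idfun A) (Lam A (Refl (wk 1 A) (Var 0))))
       (Pair (Arr A A) (Pi (wk 1 A) (Eq (wk 2 A) (App (Var 1) (App (wk 2 (idfun A)) (Var 0))) (Var 0)))
         (idfun A) (Lam A (Refl (wk 1 A) (Var 0))))"

definition idEquiv :: "tm \<Rightarrow> tm" where
  "idEquiv A = Pair (Arr A A) (isEquiv (wk 1 A) (wk 1 A) (Var 0)) (idfun A) (idIsEquiv A)"

text \<open>The canonical map \<open>A = B \<rightarrow> (A \<simeq> B)\<close> for \<open>A, B : U\<close>.\<close>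

definition idToEquiv :: "tm \<Rightarrow> tm \<Rightarrow> tm" where
  "idToEquiv A B =
     Lam (Eq U A B)
       (J U (wk 1 A) (Equiv (wk 3 A) (Var 1)) (idEquiv (wk 1 A)) (wk 1 B) (Var 0))"

text \<open>The type of homotopies between dependent functions, and the canonical map from \<open>f = g\<close> to it.\<close>

definition Htpy :: "tm \<Rightarrow> tm \<Rightarrow> tm \<Rightarrow> tm \<Rightarrow> tm" where
  "Htpy A B f g = Pi A (Eq B (App (wk 1 f) (Var 0)) (App (wk 1 g) (Var 0)))"

definition happly :: "tm \<Rightarrow> tm \<Rightarrow> tm \<Rightarrow> tm \<Rightarrow> tm" where
  "happly A B f g =
     Lam (Eq (Pi A B) f g)
       (J (wk 1 (Pi A B)) (wk 1 f)
          (Htpy (wk 3 A) (shift 3 1 B) (wk 3 f) (Var 1))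
          (Lam (wk 1 A) (Refl (shift 1 1 B) (App (wk 2 f) (Var 0))))
          (wk 1 g) (Var 0))"

text \<open>
  Transport of \<open>u : P[a]\<close> along \<open>p : a = b\<close>, for a family \<open>P\<close> over \<open>\<Gamma>, x : A\<close>, and the dependent
  action on \<open>p\<close> of a section \<open>f\<close> of \<open>P\<close>, given as a term over \<open>\<Gamma>, x : A\<close>.
\<close>

definition transport :: "tm \<Rightarrow> tm \<Rightarrow> tm \<Rightarrow> tm \<Rightarrow> tm \<Rightarrow> tm \<Rightarrow> tm" where
  "transport A P a b p u = J A a (wk 1 P) u b p"

definition apd :: "tm \<Rightarrow> tm \<Rightarrow> tm \<Rightarrow> tm \<Rightarrow> tm \<Rightarrow> tm \<Rightarrow> tm" where
  "apd A P f a b p =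
     J A a
       (Eq (wk 1 P)
          (transport (wk 2 A) (shift 2 1 P) (wk 2 a) (Var 1) (Var 0) (wk 2 (sub a f)))
          (wk 1 f))
       (Refl (sub a P) (sub a f)) b p"

text \<open>
  The type of the datum that induction into \<open>P\<close> on the coequalizer of \<open>s, t : E \<rightarrow> V\<close>, with point
  case \<open>d\<close>, requires at \<open>e : E\<close>: a path from \<open>d[s e]\<close> to \<open>d[t e]\<close> over the generating path at \<open>e\<close>.
\<close>

definition coeqPathCase :: "tm \<Rightarrow> tm \<Rightarrow> tm \<Rightarrow> tm \<Rightarrow> tm \<Rightarrow> tm \<Rightarrow> tm \<Rightarrow> tm" where
  "coeqPathCase E V s t P d e =
     Eq (sub (CPt E V s t (App t e)) P)
        (transport (Coeq E V s t) P (CPt E V s t (App s e)) (CPt E V s t (App t e))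
           (CGlue E V s t e) (sub (App s e) d))
        (sub (App t e) d)"


section \<open>Derivations\<close>

text \<open>
  Contexts are lists with the most recent variable first. Rules with a sort \<open>S \<in> sorts\<close> state closure
  of the types and closure of \<open>U\<close> at once. Graphs are parallel pairs of maps \<open>s, t : E \<rightarrow> V\<close> in \<open>U\<close>
  (source and target of the edges), and their quotients have a judgemental computation rule for
  points and a propositional one (\<open>CBeta\<close>) for paths. Substitution is simultaneous: taking \<open>\<sigma> i\<close> to
  be variables gives weakening, and taking it to be \<open>case_nat a Var\<close> gives substitution for the last
  variable.
\<close>

abbreviation sorts :: "tm set" where
  "sorts \<equiv> {U, Type}"

inductive ctx :: "tm list \<Rightarrow> bool"
  and has_type :: "tm list \<Rightarrow> tm \<Rightarrow> tm \<Rightarrow> bool"  ("_ \<turnstile> _ \<Colon> _" [51, 51, 51] 50)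
  and jeq :: "tm list \<Rightarrow> tm \<Rightarrow> tm \<Rightarrow> tm \<Rightarrow> bool"  ("_ \<turnstile> _ \<doteq> _ \<Colon> _" [51, 51, 51, 51] 50)
where
  \<comment> \<open>Structural rules\<close>
  ctx_nil: "ctx []"
| ctx_cons: "\<lbrakk>ctx \<Gamma>; \<Gamma> \<turnstile> A \<Colon> Type\<rbrakk> \<Longrightarrow> ctx (A # \<Gamma>)"
| var: "\<lbrakk>ctx \<Gamma>; i < length \<Gamma>\<rbrakk> \<Longrightarrow> \<Gamma> \<turnstile> Var i \<Colon> wk (Suc i) (\<Gamma> ! i)"
| conv: "\<lbrakk>\<Gamma> \<turnstile> a \<Colon> A; \<Gamma> \<turnstile> A \<doteq> B \<Colon> Type\<rbrakk> \<Longrightarrow> \<Gamma> \<turnstile> a \<Colon> B"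
| substitution:
    "\<lbrakk>\<Gamma> \<turnstile> a \<Colon> A; ctx \<Delta>;
      \<And>i. i < length \<Gamma> \<Longrightarrow> \<Delta> \<turnstile> \<sigma> i \<Colon> subst (wk (Suc i) (\<Gamma> ! i)) \<sigma>\<rbrakk>
     \<Longrightarrow> \<Delta> \<turnstile> subst a \<sigma> \<Colon> subst A \<sigma>"
| jeq_refl: "\<Gamma> \<turnstile> a \<Colon> A \<Longrightarrow> \<Gamma> \<turnstile> a \<doteq> a \<Colon> A"
| jeq_sym: "\<Gamma> \<turnstile> a \<doteq> b \<Colon> A \<Longrightarrow> \<Gamma> \<turnstile> b \<doteq> a \<Colon> A"
| jeq_trans: "\<lbrakk>\<Gamma> \<turnstile> a \<doteq> b \<Colon> A; \<Gamma> \<turnstile> b \<doteq> c \<Colon> A\<rbrakk> \<Longrightarrow> \<Gamma> \<turnstile> a \<doteq> c \<Colon> A"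
| jeq_conv: "\<lbrakk>\<Gamma> \<turnstile> a \<doteq> b \<Colon> A; \<Gamma> \<turnstile> A \<doteq> B \<Colon> Type\<rbrakk> \<Longrightarrow> \<Gamma> \<turnstile> a \<doteq> b \<Colon> B"
| jeq_substitution:
    "\<lbrakk>\<Gamma> \<turnstile> a \<doteq> b \<Colon> A; ctx \<Delta>;
      \<And>i. i < length \<Gamma> \<Longrightarrow> \<Delta> \<turnstile> \<sigma> i \<doteq> \<tau> i \<Colon> subst (wk (Suc i) (\<Gamma> ! i)) \<sigma>\<rbrakk>
     \<Longrightarrow> \<Delta> \<turnstile> subst a \<sigma> \<doteq> subst b \<tau> \<Colon> subst A \<sigma>"

  \<comment> \<open>The universe\<close>
| U_form: "ctx \<Gamma> \<Longrightarrow> \<Gamma> \<turnstile> U \<Colon> Type"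
| U_El: "\<Gamma> \<turnstile> A \<Colon> U \<Longrightarrow> \<Gamma> \<turnstile> A \<Colon> Type"
| U_El_cong: "\<Gamma> \<turnstile> A \<doteq> B \<Colon> U \<Longrightarrow> \<Gamma> \<turnstile> A \<doteq> B \<Colon> Type"

  \<comment> \<open>Dependent functions\<close>
| Pi_form: "\<lbrakk>S \<in> sorts; \<Gamma> \<turnstile> A \<Colon> S; A # \<Gamma> \<turnstile> B \<Colon> S\<rbrakk> \<Longrightarrow> \<Gamma> \<turnstile> Pi A B \<Colon> S"
| Pi_cong: "\<lbrakk>S \<in> sorts; \<Gamma> \<turnstile> A \<doteq> A' \<Colon> S; A # \<Gamma> \<turnstile> B \<doteq> B' \<Colon> S\<rbrakk> \<Longrightarrow> \<Gamma> \<turnstile> Pi A B \<doteq> Pi A' B' \<Colon> S"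
| Lam_intro: "\<lbrakk>\<Gamma> \<turnstile> A \<Colon> Type; A # \<Gamma> \<turnstile> B \<Colon> Type; A # \<Gamma> \<turnstile> b \<Colon> B\<rbrakk> \<Longrightarrow> \<Gamma> \<turnstile> Lam A b \<Colon> Pi A B"
| Lam_cong:
    "\<lbrakk>\<Gamma> \<turnstile> A \<doteq> A' \<Colon> Type; A # \<Gamma> \<turnstile> B \<Colon> Type; A # \<Gamma> \<turnstile> b \<doteq> b' \<Colon> B\<rbrakk>
     \<Longrightarrow> \<Gamma> \<turnstile> Lam A b \<doteq> Lam A' b' \<Colon> Pi A B"
| App_elim: "\<lbrakk>\<Gamma> \<turnstile> f \<Colon> Pi A B; \<Gamma> \<turnstile> a \<Colon> A\<rbrakk> \<Longrightarrow> \<Gamma> \<turnstile> App f a \<Colon> sub a B"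
| App_cong:
    "\<lbrakk>\<Gamma> \<turnstile> f \<doteq> f' \<Colon> Pi A B; \<Gamma> \<turnstile> a \<doteq> a' \<Colon> A\<rbrakk> \<Longrightarrow> \<Gamma> \<turnstile> App f a \<doteq> App f' a' \<Colon> sub a B"
| Pi_beta:
    "\<lbrakk>A # \<Gamma> \<turnstile> B \<Colon> Type; A # \<Gamma> \<turnstile> b \<Colon> B; \<Gamma> \<turnstile> a \<Colon> A\<rbrakk>
     \<Longrightarrow> \<Gamma> \<turnstile> App (Lam A b) a \<doteq> sub a b \<Colon> sub a B"
| Pi_eta: "\<Gamma> \<turnstile> f \<Colon> Pi A B \<Longrightarrow> \<Gamma> \<turnstile> Lam A (App (wk 1 f) (Var 0)) \<doteq> f \<Colon> Pi A B"

  \<comment> \<open>Dependent pairs\<close>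
| Sig_form: "\<lbrakk>S \<in> sorts; \<Gamma> \<turnstile> A \<Colon> S; A # \<Gamma> \<turnstile> B \<Colon> S\<rbrakk> \<Longrightarrow> \<Gamma> \<turnstile> Sig A B \<Colon> S"
| Sig_cong:
    "\<lbrakk>S \<in> sorts; \<Gamma> \<turnstile> A \<doteq> A' \<Colon> S; A # \<Gamma> \<turnstile> B \<doteq> B' \<Colon> S\<rbrakk> \<Longrightarrow> \<Gamma> \<turnstile> Sig A B \<doteq> Sig A' B' \<Colon> S"
| Pair_intro:
    "\<lbrakk>\<Gamma> \<turnstile> A \<Colon> Type; A # \<Gamma> \<turnstile> B \<Colon> Type; \<Gamma> \<turnstile> a \<Colon> A; \<Gamma> \<turnstile> b \<Colon> sub a B\<rbrakk>
     \<Longrightarrow> \<Gamma> \<turnstile> Pair A B a b \<Colon> Sig A B"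
| Pair_cong:
    "\<lbrakk>\<Gamma> \<turnstile> A \<doteq> A' \<Colon> Type; A # \<Gamma> \<turnstile> B \<doteq> B' \<Colon> Type; \<Gamma> \<turnstile> a \<doteq> a' \<Colon> A; \<Gamma> \<turnstile> b \<doteq> b' \<Colon> sub a B\<rbrakk>
     \<Longrightarrow> \<Gamma> \<turnstile> Pair A B a b \<doteq> Pair A' B' a' b' \<Colon> Sig A B"
| Sig_elim:
    "\<lbrakk>Sig A B # \<Gamma> \<turnstile> C \<Colon> Type;
      B # A # \<Gamma> \<turnstile> g \<Colon> inst 2 (Pair (wk 2 A) (shift 2 1 B) (Var 1) (Var 0)) C;
      \<Gamma> \<turnstile> p \<Colon> Sig A B\<rbrakk>
     \<Longrightarrow> \<Gamma> \<turnstile> SigInd A B C g p \<Colon> sub p C"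
| SigInd_cong:
    "\<lbrakk>\<Gamma> \<turnstile> A \<doteq> A' \<Colon> Type; A # \<Gamma> \<turnstile> B \<doteq> B' \<Colon> Type; Sig A B # \<Gamma> \<turnstile> C \<doteq> C' \<Colon> Type;
      B # A # \<Gamma> \<turnstile> g \<doteq> g' \<Colon> inst 2 (Pair (wk 2 A) (shift 2 1 B) (Var 1) (Var 0)) C;
      \<Gamma> \<turnstile> p \<doteq> p' \<Colon> Sig A B\<rbrakk>
     \<Longrightarrow> \<Gamma> \<turnstile> SigInd A B C g p \<doteq> SigInd A' B' C' g' p' \<Colon> sub p C"
| Sig_beta:
    "\<lbrakk>Sig A B # \<Gamma> \<turnstile> C \<Colon> Type;
      B # A # \<Gamma> \<turnstile> g \<Colon> inst 2 (Pair (wk 2 A) (shift 2 1 B) (Var 1) (Var 0)) C;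
      \<Gamma> \<turnstile> a \<Colon> A; \<Gamma> \<turnstile> b \<Colon> sub a B\<rbrakk>
     \<Longrightarrow> \<Gamma> \<turnstile> SigInd A B C g (Pair A B a b) \<doteq> sub2 a b g \<Colon> sub (Pair A B a b) C"

  \<comment> \<open>Identity types, with based path induction\<close>
| Eq_form: "\<lbrakk>S \<in> sorts; \<Gamma> \<turnstile> A \<Colon> S; \<Gamma> \<turnstile> a \<Colon> A; \<Gamma> \<turnstile> b \<Colon> A\<rbrakk> \<Longrightarrow> \<Gamma> \<turnstile> Eq A a b \<Colon> S"
| Eq_cong:
    "\<lbrakk>S \<in> sorts; \<Gamma> \<turnstile> A \<doteq> A' \<Colon> S; \<Gamma> \<turnstile> a \<doteq> a' \<Colon> A; \<Gamma> \<turnstile> b \<doteq> b' \<Colon> A\<rbrakk>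
     \<Longrightarrow> \<Gamma> \<turnstile> Eq A a b \<doteq> Eq A' a' b' \<Colon> S"
| Refl_intro: "\<lbrakk>\<Gamma> \<turnstile> A \<Colon> Type; \<Gamma> \<turnstile> a \<Colon> A\<rbrakk> \<Longrightarrow> \<Gamma> \<turnstile> Refl A a \<Colon> Eq A a a"
| Refl_cong:
    "\<lbrakk>\<Gamma> \<turnstile> A \<doteq> A' \<Colon> Type; \<Gamma> \<turnstile> a \<doteq> a' \<Colon> A\<rbrakk> \<Longrightarrow> \<Gamma> \<turnstile> Refl A a \<doteq> Refl A' a' \<Colon> Eq A a a"
| J_elim:
    "\<lbrakk>\<Gamma> \<turnstile> A \<Colon> Type; \<Gamma> \<turnstile> a \<Colon> A;
      Eq (wk 1 A) (wk 1 a) (Var 0) # A # \<Gamma> \<turnstile> C \<Colon> Type;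
      \<Gamma> \<turnstile> c \<Colon> sub2 a (Refl A a) C; \<Gamma> \<turnstile> b \<Colon> A; \<Gamma> \<turnstile> p \<Colon> Eq A a b\<rbrakk>
     \<Longrightarrow> \<Gamma> \<turnstile> J A a C c b p \<Colon> sub2 b p C"
| J_cong:
    "\<lbrakk>\<Gamma> \<turnstile> A \<doteq> A' \<Colon> Type; \<Gamma> \<turnstile> a \<doteq> a' \<Colon> A;
      Eq (wk 1 A) (wk 1 a) (Var 0) # A # \<Gamma> \<turnstile> C \<doteq> C' \<Colon> Type;
      \<Gamma> \<turnstile> c \<doteq> c' \<Colon> sub2 a (Refl A a) C; \<Gamma> \<turnstile> b \<doteq> b' \<Colon> A; \<Gamma> \<turnstile> p \<doteq> p' \<Colon> Eq A a b\<rbrakk>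
     \<Longrightarrow> \<Gamma> \<turnstile> J A a C c b p \<doteq> J A' a' C' c' b' p' \<Colon> sub2 b p C"
| J_beta:
    "\<lbrakk>\<Gamma> \<turnstile> A \<Colon> Type; \<Gamma> \<turnstile> a \<Colon> A;
      Eq (wk 1 A) (wk 1 a) (Var 0) # A # \<Gamma> \<turnstile> C \<Colon> Type;
      \<Gamma> \<turnstile> c \<Colon> sub2 a (Refl A a) C\<rbrakk>
     \<Longrightarrow> \<Gamma> \<turnstile> J A a C c a (Refl A a) \<doteq> c \<Colon> sub2 a (Refl A a) C"

  \<comment> \<open>The empty type\<close>
| Empty_form: "ctx \<Gamma> \<Longrightarrow> \<Gamma> \<turnstile> Empty \<Colon> U"
| Empty_elim: "\<lbrakk>Empty # \<Gamma> \<turnstile> C \<Colon> Type; \<Gamma> \<turnstile> e \<Colon> Empty\<rbrakk> \<Longrightarrow> \<Gamma> \<turnstile> EmptyInd C e \<Colon> sub e C"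
| EmptyInd_cong:
    "\<lbrakk>Empty # \<Gamma> \<turnstile> C \<doteq> C' \<Colon> Type; \<Gamma> \<turnstile> e \<doteq> e' \<Colon> Empty\<rbrakk>
     \<Longrightarrow> \<Gamma> \<turnstile> EmptyInd C e \<doteq> EmptyInd C' e' \<Colon> sub e C"

  \<comment> \<open>The unit type\<close>
| Unit_form: "ctx \<Gamma> \<Longrightarrow> \<Gamma> \<turnstile> Unit \<Colon> U"
| Star_intro: "ctx \<Gamma> \<Longrightarrow> \<Gamma> \<turnstile> Star \<Colon> Unit"
| Unit_elim:
    "\<lbrakk>Unit # \<Gamma> \<turnstile> C \<Colon> Type; \<Gamma> \<turnstile> c \<Colon> sub Star C; \<Gamma> \<turnstile> e \<Colon> Unit\<rbrakk> \<Longrightarrow> \<Gamma> \<turnstile> UnitInd C c e \<Colon> sub e C"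
| UnitInd_cong:
    "\<lbrakk>Unit # \<Gamma> \<turnstile> C \<doteq> C' \<Colon> Type; \<Gamma> \<turnstile> c \<doteq> c' \<Colon> sub Star C; \<Gamma> \<turnstile> e \<doteq> e' \<Colon> Unit\<rbrakk>
     \<Longrightarrow> \<Gamma> \<turnstile> UnitInd C c e \<doteq> UnitInd C' c' e' \<Colon> sub e C"
| Unit_beta:
    "\<lbrakk>Unit # \<Gamma> \<turnstile> C \<Colon> Type; \<Gamma> \<turnstile> c \<Colon> sub Star C\<rbrakk> \<Longrightarrow> \<Gamma> \<turnstile> UnitInd C c Star \<doteq> c \<Colon> sub Star C"

  \<comment> \<open>Coproducts\<close>
| Sum_form: "\<lbrakk>S \<in> sorts; \<Gamma> \<turnstile> A \<Colon> S; \<Gamma> \<turnstile> B \<Colon> S\<rbrakk> \<Longrightarrow> \<Gamma> \<turnstile> Sum A B \<Colon> S"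
| Sum_cong:
    "\<lbrakk>S \<in> sorts; \<Gamma> \<turnstile> A \<doteq> A' \<Colon> S; \<Gamma> \<turnstile> B \<doteq> B' \<Colon> S\<rbrakk> \<Longrightarrow> \<Gamma> \<turnstile> Sum A B \<doteq> Sum A' B' \<Colon> S"
| InL_intro: "\<lbrakk>\<Gamma> \<turnstile> A \<Colon> Type; \<Gamma> \<turnstile> B \<Colon> Type; \<Gamma> \<turnstile> a \<Colon> A\<rbrakk> \<Longrightarrow> \<Gamma> \<turnstile> InL A B a \<Colon> Sum A B"
| InL_cong:
    "\<lbrakk>\<Gamma> \<turnstile> A \<doteq> A' \<Colon> Type; \<Gamma> \<turnstile> B \<doteq> B' \<Colon> Type; \<Gamma> \<turnstile> a \<doteq> a' \<Colon> A\<rbrakk>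
     \<Longrightarrow> \<Gamma> \<turnstile> InL A B a \<doteq> InL A' B' a' \<Colon> Sum A B"
| InR_intro: "\<lbrakk>\<Gamma> \<turnstile> A \<Colon> Type; \<Gamma> \<turnstile> B \<Colon> Type; \<Gamma> \<turnstile> b \<Colon> B\<rbrakk> \<Longrightarrow> \<Gamma> \<turnstile> InR A B b \<Colon> Sum A B"
| InR_cong:
    "\<lbrakk>\<Gamma> \<turnstile> A \<doteq> A' \<Colon> Type; \<Gamma> \<turnstile> B \<doteq> B' \<Colon> Type; \<Gamma> \<turnstile> b \<doteq> b' \<Colon> B\<rbrakk>
     \<Longrightarrow> \<Gamma> \<turnstile> InR A B b \<doteq> InR A' B' b' \<Colon> Sum A B"
| Sum_elim:
    "\<lbrakk>Sum A B # \<Gamma> \<turnstile> C \<Colon> Type;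
      A # \<Gamma> \<turnstile> c \<Colon> inst 1 (InL (wk 1 A) (wk 1 B) (Var 0)) C;
      B # \<Gamma> \<turnstile> d \<Colon> inst 1 (InR (wk 1 A) (wk 1 B) (Var 0)) C;
      \<Gamma> \<turnstile> e \<Colon> Sum A B\<rbrakk>
     \<Longrightarrow> \<Gamma> \<turnstile> SumInd A B C c d e \<Colon> sub e C"
| SumInd_cong:
    "\<lbrakk>\<Gamma> \<turnstile> A \<doteq> A' \<Colon> Type; \<Gamma> \<turnstile> B \<doteq> B' \<Colon> Type; Sum A B # \<Gamma> \<turnstile> C \<doteq> C' \<Colon> Type;
      A # \<Gamma> \<turnstile> c \<doteq> c' \<Colon> inst 1 (InL (wk 1 A) (wk 1 B) (Var 0)) C;
      B # \<Gamma> \<turnstile> d \<doteq> d' \<Colon> inst 1 (InR (wk 1 A) (wk 1 B) (Var 0)) C;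
      \<Gamma> \<turnstile> e \<doteq> e' \<Colon> Sum A B\<rbrakk>
     \<Longrightarrow> \<Gamma> \<turnstile> SumInd A B C c d e \<doteq> SumInd A' B' C' c' d' e' \<Colon> sub e C"
| Sum_beta_L:
    "\<lbrakk>Sum A B # \<Gamma> \<turnstile> C \<Colon> Type;
      A # \<Gamma> \<turnstile> c \<Colon> inst 1 (InL (wk 1 A) (wk 1 B) (Var 0)) C;
      B # \<Gamma> \<turnstile> d \<Colon> inst 1 (InR (wk 1 A) (wk 1 B) (Var 0)) C;
      \<Gamma> \<turnstile> a \<Colon> A\<rbrakk>
     \<Longrightarrow> \<Gamma> \<turnstile> SumInd A B C c d (InL A B a) \<doteq> sub a c \<Colon> sub (InL A B a) C"
| Sum_beta_R:
    "\<lbrakk>Sum A B # \<Gamma> \<turnstile> C \<Colon> Type;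
      A # \<Gamma> \<turnstile> c \<Colon> inst 1 (InL (wk 1 A) (wk 1 B) (Var 0)) C;
      B # \<Gamma> \<turnstile> d \<Colon> inst 1 (InR (wk 1 A) (wk 1 B) (Var 0)) C;
      \<Gamma> \<turnstile> b \<Colon> B\<rbrakk>
     \<Longrightarrow> \<Gamma> \<turnstile> SumInd A B C c d (InR A B b) \<doteq> sub b d \<Colon> sub (InR A B b) C"

  \<comment> \<open>Natural numbers\<close>
| Nat_form: "ctx \<Gamma> \<Longrightarrow> \<Gamma> \<turnstile> Nat \<Colon> U"
| Zero_intro: "ctx \<Gamma> \<Longrightarrow> \<Gamma> \<turnstile> Zero \<Colon> Nat"
| Succ_intro: "\<Gamma> \<turnstile> n \<Colon> Nat \<Longrightarrow> \<Gamma> \<turnstile> Succ n \<Colon> Nat"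
| Succ_cong: "\<Gamma> \<turnstile> n \<doteq> n' \<Colon> Nat \<Longrightarrow> \<Gamma> \<turnstile> Succ n \<doteq> Succ n' \<Colon> Nat"
| Nat_elim:
    "\<lbrakk>Nat # \<Gamma> \<turnstile> C \<Colon> Type; \<Gamma> \<turnstile> z \<Colon> sub Zero C;
      C # Nat # \<Gamma> \<turnstile> s \<Colon> inst 2 (Succ (Var 1)) C; \<Gamma> \<turnstile> n \<Colon> Nat\<rbrakk>
     \<Longrightarrow> \<Gamma> \<turnstile> NatInd C z s n \<Colon> sub n C"
| NatInd_cong:
    "\<lbrakk>Nat # \<Gamma> \<turnstile> C \<doteq> C' \<Colon> Type; \<Gamma> \<turnstile> z \<doteq> z' \<Colon> sub Zero C;
      C # Nat # \<Gamma> \<turnstile> s \<doteq> s' \<Colon> inst 2 (Succ (Var 1)) C; \<Gamma> \<turnstile> n \<doteq> n' \<Colon> Nat\<rbrakk>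
     \<Longrightarrow> \<Gamma> \<turnstile> NatInd C z s n \<doteq> NatInd C' z' s' n' \<Colon> sub n C"
| Nat_beta_Zero:
    "\<lbrakk>Nat # \<Gamma> \<turnstile> C \<Colon> Type; \<Gamma> \<turnstile> z \<Colon> sub Zero C;
      C # Nat # \<Gamma> \<turnstile> s \<Colon> inst 2 (Succ (Var 1)) C\<rbrakk>
     \<Longrightarrow> \<Gamma> \<turnstile> NatInd C z s Zero \<doteq> z \<Colon> sub Zero C"
| Nat_beta_Succ:
    "\<lbrakk>Nat # \<Gamma> \<turnstile> C \<Colon> Type; \<Gamma> \<turnstile> z \<Colon> sub Zero C;
      C # Nat # \<Gamma> \<turnstile> s \<Colon> inst 2 (Succ (Var 1)) C; \<Gamma> \<turnstile> n \<Colon> Nat\<rbrakk>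
     \<Longrightarrow> \<Gamma> \<turnstile> NatInd C z s (Succ n) \<doteq> sub2 n (NatInd C z s n) s \<Colon> sub (Succ n) C"

  \<comment> \<open>Graph quotients (homotopy coequalizers)\<close>
| Coeq_form:
    "\<lbrakk>\<Gamma> \<turnstile> E \<Colon> U; \<Gamma> \<turnstile> V \<Colon> U; \<Gamma> \<turnstile> s \<Colon> Arr E V; \<Gamma> \<turnstile> t \<Colon> Arr E V\<rbrakk> \<Longrightarrow> \<Gamma> \<turnstile> Coeq E V s t \<Colon> U"
| Coeq_cong:
    "\<lbrakk>\<Gamma> \<turnstile> E \<doteq> E' \<Colon> U; \<Gamma> \<turnstile> V \<doteq> V' \<Colon> U; \<Gamma> \<turnstile> s \<doteq> s' \<Colon> Arr E V; \<Gamma> \<turnstile> t \<doteq> t' \<Colon> Arr E V\<rbrakk>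
     \<Longrightarrow> \<Gamma> \<turnstile> Coeq E V s t \<doteq> Coeq E' V' s' t' \<Colon> U"
| CPt_intro:
    "\<lbrakk>\<Gamma> \<turnstile> Coeq E V s t \<Colon> U; \<Gamma> \<turnstile> v \<Colon> V\<rbrakk> \<Longrightarrow> \<Gamma> \<turnstile> CPt E V s t v \<Colon> Coeq E V s t"
| CPt_cong:
    "\<lbrakk>\<Gamma> \<turnstile> E \<doteq> E' \<Colon> U; \<Gamma> \<turnstile> V \<doteq> V' \<Colon> U; \<Gamma> \<turnstile> s \<doteq> s' \<Colon> Arr E V; \<Gamma> \<turnstile> t \<doteq> t' \<Colon> Arr E V;
      \<Gamma> \<turnstile> v \<doteq> v' \<Colon> V\<rbrakk>
     \<Longrightarrow> \<Gamma> \<turnstile> CPt E V s t v \<doteq> CPt E' V' s' t' v' \<Colon> Coeq E V s t"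
| CGlue_intro:
    "\<lbrakk>\<Gamma> \<turnstile> Coeq E V s t \<Colon> U; \<Gamma> \<turnstile> e \<Colon> E\<rbrakk>
     \<Longrightarrow> \<Gamma> \<turnstile> CGlue E V s t e
          \<Colon> Eq (Coeq E V s t) (CPt E V s t (App s e)) (CPt E V s t (App t e))"
| CGlue_cong:
    "\<lbrakk>\<Gamma> \<turnstile> E \<doteq> E' \<Colon> U; \<Gamma> \<turnstile> V \<doteq> V' \<Colon> U; \<Gamma> \<turnstile> s \<doteq> s' \<Colon> Arr E V; \<Gamma> \<turnstile> t \<doteq> t' \<Colon> Arr E V;
      \<Gamma> \<turnstile> e \<doteq> e' \<Colon> E\<rbrakk>
     \<Longrightarrow> \<Gamma> \<turnstile> CGlue E V s t e \<doteq> CGlue E' V' s' t' e'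
          \<Colon> Eq (Coeq E V s t) (CPt E V s t (App s e)) (CPt E V s t (App t e))"
| Coeq_elim:
    "\<lbrakk>Coeq E V s t # \<Gamma> \<turnstile> P \<Colon> Type;
      V # \<Gamma> \<turnstile> d \<Colon> inst 1 (CPt (wk 1 E) (wk 1 V) (wk 1 s) (wk 1 t) (Var 0)) P;
      E # \<Gamma> \<turnstile> g \<Colon> coeqPathCase (wk 1 E) (wk 1 V) (wk 1 s) (wk 1 t) (shift 1 1 P) (shift 1 1 d) (Var 0);
      \<Gamma> \<turnstile> x \<Colon> Coeq E V s t\<rbrakk>
     \<Longrightarrow> \<Gamma> \<turnstile> CInd E V s t P d g x \<Colon> sub x P"
| CInd_cong:
    "\<lbrakk>\<Gamma> \<turnstile> E \<doteq> E' \<Colon> U; \<Gamma> \<turnstile> V \<doteq> V' \<Colon> U; \<Gamma> \<turnstile> s \<doteq> s' \<Colon> Arr E V; \<Gamma> \<turnstile> t \<doteq> t' \<Colon> Arr E V;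
      Coeq E V s t # \<Gamma> \<turnstile> P \<doteq> P' \<Colon> Type;
      V # \<Gamma> \<turnstile> d \<doteq> d' \<Colon> inst 1 (CPt (wk 1 E) (wk 1 V) (wk 1 s) (wk 1 t) (Var 0)) P;
      E # \<Gamma> \<turnstile> g \<doteq> g'
        \<Colon> coeqPathCase (wk 1 E) (wk 1 V) (wk 1 s) (wk 1 t) (shift 1 1 P) (shift 1 1 d) (Var 0);
      \<Gamma> \<turnstile> x \<doteq> x' \<Colon> Coeq E V s t\<rbrakk>
     \<Longrightarrow> \<Gamma> \<turnstile> CInd E V s t P d g x \<doteq> CInd E' V' s' t' P' d' g' x' \<Colon> sub x P"
| Coeq_beta_pt:
    "\<lbrakk>Coeq E V s t # \<Gamma> \<turnstile> P \<Colon> Type;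
      V # \<Gamma> \<turnstile> d \<Colon> inst 1 (CPt (wk 1 E) (wk 1 V) (wk 1 s) (wk 1 t) (Var 0)) P;
      E # \<Gamma> \<turnstile> g \<Colon> coeqPathCase (wk 1 E) (wk 1 V) (wk 1 s) (wk 1 t) (shift 1 1 P) (shift 1 1 d) (Var 0);
      \<Gamma> \<turnstile> v \<Colon> V\<rbrakk>
     \<Longrightarrow> \<Gamma> \<turnstile> CInd E V s t P d g (CPt E V s t v) \<doteq> sub v d \<Colon> sub (CPt E V s t v) P"
| Coeq_beta_path:
    "\<lbrakk>Coeq E V s t # \<Gamma> \<turnstile> P \<Colon> Type;
      V # \<Gamma> \<turnstile> d \<Colon> inst 1 (CPt (wk 1 E) (wk 1 V) (wk 1 s) (wk 1 t) (Var 0)) P;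
      E # \<Gamma> \<turnstile> g \<Colon> coeqPathCase (wk 1 E) (wk 1 V) (wk 1 s) (wk 1 t) (shift 1 1 P) (shift 1 1 d) (Var 0);
      \<Gamma> \<turnstile> e \<Colon> E\<rbrakk>
     \<Longrightarrow> \<Gamma> \<turnstile> CBeta E V s t P d g e
          \<Colon> Eq (coeqPathCase E V s t P d e)
              (apd (Coeq E V s t) P
                 (CInd (wk 1 E) (wk 1 V) (wk 1 s) (wk 1 t)
                    (shift 1 1 P) (shift 1 1 d) (shift 1 1 g) (Var 0))
                 (CPt E V s t (App s e)) (CPt E V s t (App t e)) (CGlue E V s t e))
              (sub e g)"
| CBeta_cong:
    "\<lbrakk>\<Gamma> \<turnstile> E \<doteq> E' \<Colon> U; \<Gamma> \<turnstile> V \<doteq> V' \<Colon> U; \<Gamma> \<turnstile> s \<doteq> s' \<Colon> Arr E V; \<Gamma> \<turnstile> t \<doteq> t' \<Colon> Arr E V;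
      Coeq E V s t # \<Gamma> \<turnstile> P \<doteq> P' \<Colon> Type;
      V # \<Gamma> \<turnstile> d \<doteq> d' \<Colon> inst 1 (CPt (wk 1 E) (wk 1 V) (wk 1 s) (wk 1 t) (Var 0)) P;
      E # \<Gamma> \<turnstile> g \<doteq> g'
        \<Colon> coeqPathCase (wk 1 E) (wk 1 V) (wk 1 s) (wk 1 t) (shift 1 1 P) (shift 1 1 d) (Var 0);
      \<Gamma> \<turnstile> e \<doteq> e' \<Colon> E\<rbrakk>
     \<Longrightarrow> \<Gamma> \<turnstile> CBeta E V s t P d g e \<doteq> CBeta E' V' s' t' P' d' g' e'
          \<Colon> Eq (coeqPathCase E V s t P d e)
              (apd (Coeq E V s t) P
                 (CInd (wk 1 E) (wk 1 V) (wk 1 s) (wk 1 t)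
                    (shift 1 1 P) (shift 1 1 d) (shift 1 1 g) (Var 0))
                 (CPt E V s t (App s e)) (CPt E V s t (App t e)) (CGlue E V s t e))
              (sub e g)"

  \<comment> \<open>Function extensionality and univalence\<close>
| FunExt_intro:
    "\<lbrakk>\<Gamma> \<turnstile> A \<Colon> Type; A # \<Gamma> \<turnstile> B \<Colon> Type; \<Gamma> \<turnstile> f \<Colon> Pi A B; \<Gamma> \<turnstile> g \<Colon> Pi A B\<rbrakk>
     \<Longrightarrow> \<Gamma> \<turnstile> FunExt A B f g \<Colon> isEquiv (Eq (Pi A B) f g) (Htpy A B f g) (happly A B f g)"
| FunExt_cong:
    "\<lbrakk>\<Gamma> \<turnstile> A \<doteq> A' \<Colon> Type; A # \<Gamma> \<turnstile> B \<doteq> B' \<Colon> Type; \<Gamma> \<turnstile> f \<doteq> f' \<Colon> Pi A B; \<Gamma> \<turnstile> g \<doteq> g' \<Colon> Pi A B\<rbrakk>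
     \<Longrightarrow> \<Gamma> \<turnstile> FunExt A B f g \<doteq> FunExt A' B' f' g'
          \<Colon> isEquiv (Eq (Pi A B) f g) (Htpy A B f g) (happly A B f g)"
| UA_intro:
    "\<lbrakk>\<Gamma> \<turnstile> A \<Colon> U; \<Gamma> \<turnstile> B \<Colon> U\<rbrakk>
     \<Longrightarrow> \<Gamma> \<turnstile> UA A B \<Colon> isEquiv (Eq U A B) (Equiv A B) (idToEquiv A B)"
| UA_cong:
    "\<lbrakk>\<Gamma> \<turnstile> A \<doteq> A' \<Colon> U; \<Gamma> \<turnstile> B \<doteq> B' \<Colon> U\<rbrakk>
     \<Longrightarrow> \<Gamma> \<turnstile> UA A B \<doteq> UA A' B' \<Colon> isEquiv (Eq U A B) (Equiv A B) (idToEquiv A B)"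


section \<open>Joins, sequential colimits and the propositional truncation\<close>

definition isProp :: "tm \<Rightarrow> tm" where
  "isProp A = Pi A (Pi (wk 1 A) (Eq (wk 2 A) (Var 1) (Var 0)))"

definition fstMap :: "tm \<Rightarrow> tm \<Rightarrow> tm" where
  "fstMap P Q = Lam (Prod P Q) (SigInd (wk 1 P) (wk 2 Q) (wk 2 P) (Var 1) (Var 0))"

definition sndMap :: "tm \<Rightarrow> tm \<Rightarrow> tm" where
  "sndMap P Q = Lam (Prod P Q) (SigInd (wk 1 P) (wk 2 Q) (wk 2 Q) (Var 0) (Var 0))"

text \<open>
  The pushout of \<open>f : S \<rightarrow> P\<close> and \<open>g : S \<rightarrow> Q\<close> is the coequalizer of \<open>inl \<circ> f, inr \<circ> g : S \<rightarrow> P + Q\<close>.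
\<close>

definition pushSrc :: "tm \<Rightarrow> tm \<Rightarrow> tm \<Rightarrow> tm \<Rightarrow> tm" where
  "pushSrc S P Q f = Lam S (InL (wk 1 P) (wk 1 Q) (App (wk 1 f) (Var 0)))"

definition pushTgt :: "tm \<Rightarrow> tm \<Rightarrow> tm \<Rightarrow> tm \<Rightarrow> tm" where
  "pushTgt S P Q g = Lam S (InR (wk 1 P) (wk 1 Q) (App (wk 1 g) (Var 0)))"

definition Pushout :: "tm \<Rightarrow> tm \<Rightarrow> tm \<Rightarrow> tm \<Rightarrow> tm \<Rightarrow> tm" where
  "Pushout S P Q f g = Coeq S (Sum P Q) (pushSrc S P Q f) (pushTgt S P Q g)"

definition pushInr :: "tm \<Rightarrow> tm \<Rightarrow> tm \<Rightarrow> tm \<Rightarrow> tm \<Rightarrow> tm" where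
  "pushInr S P Q f g =
     Lam Q
       (CPt (wk 1 S) (wk 1 (Sum P Q)) (wk 1 (pushSrc S P Q f)) (wk 1 (pushTgt S P Q g))
          (InR (wk 1 P) (wk 1 Q) (Var 0)))"

definition Join :: "tm \<Rightarrow> tm \<Rightarrow> tm" where
  "Join P Q = Pushout (Prod P Q) P Q (fstMap P Q) (sndMap P Q)"

definition joinInr :: "tm \<Rightarrow> tm \<Rightarrow> tm" where
  "joinInr P Q = pushInr (Prod P Q) P Q (fstMap P Q) (sndMap P Q)"

text \<open>
  The sequential colimit of types \<open>X\<close> and maps \<open>f : X[n] \<rightarrow> X[n + 1]\<close>, both given over \<open>\<Gamma>, n : Nat\<close>,
  is the coequalizer of the identity and \<open>(n, x) \<mapsto> (n + 1, f x)\<close> on the total space of \<open>X\<close>.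
  \<open>seqIn X f n\<close> is the inclusion of stage \<open>n\<close>.
\<close>

definition seqNext :: "tm \<Rightarrow> tm \<Rightarrow> tm" where
  "seqNext X f =
     Lam (Sig Nat X)
       (SigInd Nat (shift 1 1 X) (wk 2 (Sig Nat X))
          (Pair Nat (shift 3 1 X) (Succ (Var 1)) (App (inst 3 (Var 1) f) (Var 0)))
          (Var 0))"

definition SeqColim :: "tm \<Rightarrow> tm \<Rightarrow> tm" where
  "SeqColim X f = Coeq (Sig Nat X) (Sig Nat X) (idfun (Sig Nat X)) (seqNext X f)"

definition seqIn :: "tm \<Rightarrow> tm \<Rightarrow> tm \<Rightarrow> tm" where
  "seqIn X f n =
     Lam (sub n X)
       (CPt (wk 1 (Sig Nat X)) (wk 1 (Sig Nat X)) (wk 1 (idfun (Sig Nat X))) (wk 1 (seqNext X f))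
          (Pair Nat (shift 1 1 X) (wk 1 n) (Var 0)))"

text \<open>
  \<open>joinPow1 A n\<close> is the join power of \<open>A\<close> with exponent \<open>n + 1\<close>; its value at \<open>Zero\<close> is \<open>A\<close> itself,
  in accordance with the identification of \<open>A * \<emptyset>\<close> with \<open>A\<close>. Thus \<open>stage A\<close> takes, judgementally, the
  values \<open>\<emptyset>\<close>, \<open>A\<close>, \<open>A * A\<close>, \<open>A * (A * A)\<close>, and so on.
\<close>

definition joinPow1 :: "tm \<Rightarrow> tm \<Rightarrow> tm" where
  "joinPow1 A n = NatInd U A (Join (wk 2 A) (Var 0)) n"

definition stage :: "tm \<Rightarrow> tm \<Rightarrow> tm" where
  "stage A n = NatInd U Empty (joinPow1 (wk 2 A) (Var 1)) n"

definition stageMap :: "tm \<Rightarrow> tm \<Rightarrow> tm" where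
  "stageMap A n =
     NatInd (Arr (stage (wk 1 A) (Var 0)) (stage (wk 1 A) (Succ (Var 0))))
       (Lam Empty (EmptyInd (wk 2 A) (Var 0)))
       (joinInr (wk 2 A) (joinPow1 (wk 2 A) (Var 1)))
       n"

definition Trunc :: "tm \<Rightarrow> tm" where
  "Trunc A = SeqColim (stage (wk 1 A) (Var 0)) (stageMap (wk 1 A) (Var 0))"

definition truncIn :: "tm \<Rightarrow> tm" where
  "truncIn A = seqIn (stage (wk 1 A) (Var 0)) (stageMap (wk 1 A) (Var 0)) (Succ Zero)"

text \<open>Precomposition with \<open>h : X \<rightarrow> Y\<close>, as a map \<open>(Y \<rightarrow> B) \<rightarrow> (X \<rightarrow> B)\<close>.\<close>

definition precomp :: "tm \<Rightarrow> tm \<Rightarrow> tm \<Rightarrow> tm \<Rightarrow> tm" where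
  "precomp X Y B h = Lam (Arr Y B) (Lam (wk 1 X) (App (Var 1) (App (wk 2 h) (Var 0))))"

end

theory Submission
  imports Defs
begin

text \<open>
  Given \<open>a : A\<close>, each transition map \<open>inr\<close> is null-homotopic: it is homotopic to the constant map
  at \<open>inl a\<close>. Let \<open>b n\<close> be the image of this constant in the colimit. The null-homotopy followed by
  the inverse of the colimit glue is a path \<open>q n x : b n = in n x\<close>. The paths
  \<open>q (n + 1) (inl a)\<close> from \<open>b (n + 1)\<close> to \<open>b n\<close> compose, inverted, to \<open>k n : b 0 = b n\<close>, and the
  paths \<open>k n . q n x\<close> are
  compatible with the glue because \<open>q (n + 1)\<close> is natural along the null-homotopy. So \<open>A\<close> implies
  that the colimit is contractible, in particular a proposition. As the colimit has the recursion
  principle for maps from \<open>A\<close> into propositions (by induction on the stage), and being a proposition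
  is a proposition, the colimit itself implies that it is a proposition, hence it is one. By
  function extensionality both sides of the universal property are propositions, so the recursion
  principle makes precomposition an equivalence.
\<close>

section \<open>The calculus of substitutions\<close>

text \<open>Without a truncation at hand, a point of the colimit does not give back a point of
  \<open>A\<close>. A proof that a type is a proposition starts from two of its points, though, and
  eliminating one of them into the statement that the colimit is a proposition brings some
  \<open>a : A\<close> into the context. This is why the contraction may depend on \<open>a\<close>.
  The obstacle is that \<open>q n x\<close> starts at \<open>b n\<close>, which moves with the
  stage, while a contraction needs one centre. The choice of \<open>k n\<close> is dictated by the
  glue from \<open>in n x\<close> to \<open>in (n + 1) (f x)\<close>, where \<open>f\<close> is the
  transition map: after the glue cancels, \<open>k n\<close> followed by the image of the
  null-homotopy must equal \<open>k (n + 1) . q (n + 1) (f x)\<close>. Naturality writes this image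
  as the inverse of \<open>q (n + 1)\<close> at the base point, followed by
  \<open>q (n + 1) (f x)\<close>. So \<open>k (n + 1)\<close> has to be \<open>k n\<close> followed
  by that inverse. Base points live one stage above their index: stage 0 is empty, and stage 1 is
  \<open>A\<close>, where the base point is \<open>a\<close> itself and not yet of the form
  \<open>inl a\<close>.\<close>

definition sh :: "nat \<Rightarrow> nat \<Rightarrow> tm" where
  "sh k = (\<lambda>i. Var (i + k))"

definition scons :: "tm \<Rightarrow> (nat \<Rightarrow> tm) \<Rightarrow> nat \<Rightarrow> tm"  (infixr ".:" 60) where
  "scons = case_nat"

definition scomp :: "(nat \<Rightarrow> tm) \<Rightarrow> (nat \<Rightarrow> tm) \<Rightarrow> nat \<Rightarrow> tm"  (infixl "\<circ>\<circ>" 65) where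
  "scomp \<sigma> \<tau> = (\<lambda>i. subst (\<sigma> i) \<tau>)"

lemma upr_upr: "upr \<xi> (upr \<zeta> i) = upr (\<lambda>i. \<xi> (\<zeta> i)) i"
  by (simp add: upr_def split: nat.split)

lemma ren_ren: "ren (ren t \<xi>) \<zeta> = ren t (\<lambda>i. \<zeta> (\<xi> i))"
  by (induction t arbitrary: \<xi> \<zeta>) (simp_all add: upr_upr)

lemma ups_Var: "ups (\<lambda>i. Var (\<xi> i)) = (\<lambda>i. Var (upr \<xi> i))"
  by (rule ext) (simp add: ups_def upr_def split: nat.split)

lemma ren_eq_subst: "ren t \<xi> = subst t (\<lambda>i. Var (\<xi> i))"
  by (induction t arbitrary: \<xi>) (simp_all add: ups_Var)

lemma ups_upr: "(\<lambda>i. ups \<tau> (upr \<xi> i)) = ups (\<lambda>i. \<tau> (\<xi> i))"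
  by (rule ext) (simp add: ups_def upr_def split: nat.split)

lemma subst_ren: "subst (ren t \<xi>) \<tau> = subst t (\<lambda>i. \<tau> (\<xi> i))"
  by (induction t arbitrary: \<xi> \<tau>) (simp_all add: ups_upr)

lemma ren_ups: "(\<lambda>i. ren (ups \<sigma> i) (upr \<xi>)) = ups (\<lambda>i. ren (\<sigma> i) \<xi>)"
  by (rule ext) (simp add: ups_def upr_def ren_ren split: nat.split)

lemma ren_subst: "ren (subst t \<sigma>) \<xi> = subst t (\<lambda>i. ren (\<sigma> i) \<xi>)"
  by (induction t arbitrary: \<sigma> \<xi>) (simp_all add: ren_ups)

text \<open>Composing substitutions under a binder means commuting a substitution with a weakening.
  The laws \<open>subst_ren\<close> and \<open>ren_subst\<close> are proved first for this
  step.\<close>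

lemma ups_ups: "(\<lambda>i. subst (ups \<sigma> i) (ups \<tau>)) = ups (\<lambda>i. subst (\<sigma> i) \<tau>)"
  by (rule ext) (simp add: ups_def subst_ren ren_subst split: nat.split)

lemma subst_subst: "subst (subst t \<sigma>) \<tau> = subst t (\<sigma> \<circ>\<circ> \<tau>)"
  unfolding scomp_def by (induction t arbitrary: \<sigma> \<tau>) (simp_all add: ups_ups)

lemma ups_id: "ups Var = Var"
  by (rule ext) (simp add: ups_def split: nat.split)

lemma subst_id: "subst t Var = t"
  by (induction t) (simp_all add: ups_id)

lemma sh_0: "sh 0 = Var"
  by (simp add: sh_def)

lemma sh_apply: "sh k i = Var (i + k)"
  by (simp add: sh_def)

lemma scons_0: "(a .: \<sigma>) 0 = a"
  by (simp add: scons_def)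

lemma scons_Suc: "(a .: \<sigma>) (Suc i) = \<sigma> i"
  by (simp add: scons_def)

lemma scomp_scons: "(a .: \<sigma>) \<circ>\<circ> \<tau> = subst a \<tau> .: (\<sigma> \<circ>\<circ> \<tau>)"
  by (rule ext) (simp add: scomp_def scons_def split: nat.split)

lemma scomp_sh_scons: "sh (Suc k) \<circ>\<circ> (a .: \<sigma>) = sh k \<circ>\<circ> \<sigma>"
  by (rule ext) (simp add: scomp_def scons_def sh_def)

lemma scomp_sh_sh: "sh k \<circ>\<circ> sh m = sh (k + m)"
  by (rule ext) (simp add: scomp_def sh_def add.assoc)

lemma scomp_Var_left: "Var \<circ>\<circ> \<sigma> = \<sigma>"
  by (simp add: scomp_def)

lemma scomp_Var_right: "\<sigma> \<circ>\<circ> Var = \<sigma>"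
  by (simp add: scomp_def subst_id)

lemma scomp_assoc: "(\<sigma> \<circ>\<circ> \<tau>) \<circ>\<circ> \<rho> = \<sigma> \<circ>\<circ> (\<tau> \<circ>\<circ> \<rho>)"
  by (simp add: scomp_def subst_subst)

lemma scomp_apply: "(\<sigma> \<circ>\<circ> \<tau>) i = subst (\<sigma> i) \<tau>"
  by (simp add: scomp_def)

lemma scons_Var_sh: "Var k .: sh (Suc k) = sh k"
  by (rule ext) (simp add: scons_def sh_def split: nat.split)

lemma ups_eq: "ups \<sigma> = Var 0 .: (\<sigma> \<circ>\<circ> sh (Suc 0))"
  by (simp add: ups_def scons_def scomp_def ren_eq_subst sh_def)

lemma wk_eq: "wk n t = subst t (sh n)"
  by (simp add: wk_def shift_def ren_eq_subst sh_def)

lemma shift_1_eq: "shift n (Suc 0) t = subst t (Var 0 .: sh (Suc n))"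
proof -
  have "(\<lambda>i. Var (if i < Suc 0 then i else i + n)) = Var 0 .: sh (Suc n)"
    by (rule ext) (simp add: scons_def sh_def split: nat.split)
  then show ?thesis
    by (simp add: shift_def ren_eq_subst)
qed

lemma sub_eq: "sub a t = subst t (a .: Var)"
  by (simp add: sub_def scons_def)

lemma sub2_eq: "sub2 a b t = subst t (b .: a .: Var)"
  by (simp add: sub2_def scons_def)

lemma inst_eq: "inst m a t = subst t (a .: sh m)"
  by (simp add: inst_def scons_def sh_def)

lemma scons_Var_sh_0: "Var 0 .: sh (Suc 0) = Var"
  by (simp add: scons_Var_sh sh_0)

text \<open>
  Oriented as below, these equations normalize every substitution instance of a metavariable to
  \<open>subst t\<close> of a list of terms ending in a shift, so that the simplifier decides the side conditions
  of the typing rules.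
\<close>

lemmas sigma = subst_subst subst_id sh_0 sh_apply scons_0 scons_Suc scomp_scons scomp_sh_scons
  scomp_sh_sh scomp_Var_left scomp_Var_right scomp_assoc scomp_apply scons_Var_sh scons_Var_sh_0
    ups_eq
  wk_eq shift_1_eq sub_eq sub2_eq inst_eq

text \<open>Numerals become iterated \<open>Suc\<close> so that \<open>scomp_sh_scons\<close> and
  \<open>scons_Suc\<close> can match. Arrows and products are unfolded as well, so the typing lemmas
  meet them as \<open>Pi\<close> and \<open>Sig\<close> with a weakened second argument.\<close>

declare sigma [simp] numeral_eq_Suc [simp] Arr_def [simp] Prod_def [simp]

section \<open>Structural rules\<close>

text \<open>Each rule either asks for the context to be well-formed or has a premise over the same
  context.\<close>

lemma ctx_if_has_type: "\<Gamma> \<turnstile> a \<Colon> A \<Longrightarrow> ctx \<Gamma>" and ctx_if_jeq: "\<Gamma> \<turnstile> a \<doteq> b \<Colon> A \<Longrightarrow> ctx \<Gamma>"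
proof -
  \<comment> \<open>The three judgements are defined mutually, so the induction rule also wants a
    claim about contexts.\<close>
  have "ctx \<Delta> \<Longrightarrow> True" and "\<Gamma> \<turnstile> a \<Colon> A \<Longrightarrow> ctx \<Gamma>" and "\<Gamma> \<turnstile> a \<doteq> b \<Colon> A \<Longrightarrow> ctx \<Gamma>" for \<Delta>
    by (induction rule: ctx_has_type_jeq.inducts) auto
  then show "\<Gamma> \<turnstile> a \<Colon> A \<Longrightarrow> ctx \<Gamma>" and "\<Gamma> \<turnstile> a \<doteq> b \<Colon> A \<Longrightarrow> ctx \<Gamma>" by blast+
qed

lemma ctx_cons_iff: "ctx (A # \<Gamma>) \<longleftrightarrow> \<Gamma> \<turnstile> A \<Colon> Type"
proof
  assume "ctx (A # \<Gamma>)" then show "\<Gamma> \<turnstile> A \<Colon> Type" by cases auto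
next
  assume "\<Gamma> \<turnstile> A \<Colon> Type" then show "ctx (A # \<Gamma>)" using ctx_cons ctx_if_has_type by blast
qed

text \<open>The type enters through an equation, so the rule applies to a type in any syntactic form
  and leaves the comparison to the normal form of substitutions. The rules
  \<open>wk1_has_type\<close> to \<open>wk3_has_type\<close> follow the same pattern.\<close>

lemma var_type: "\<lbrakk>ctx \<Gamma>; i < length \<Gamma>; A = wk (Suc i) (\<Gamma> ! i)\<rbrakk> \<Longrightarrow> \<Gamma> \<turnstile> Var i \<Colon> A"
  using var by simp

lemma type_sh:
  assumes "\<Gamma> \<turnstile> a \<Colon> A" "ctx (\<Xi> @ \<Gamma>)"
  shows "\<Xi> @ \<Gamma> \<turnstile> subst a (sh (length \<Xi>)) \<Colon> subst A (sh (length \<Xi>))"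
  by (rule substitution[OF assms])
    (auto intro!: var_type[OF assms(2)] simp: nth_append add.commute)

lemma jeq_sh:
  assumes "\<Gamma> \<turnstile> a \<doteq> b \<Colon> A" "ctx (\<Xi> @ \<Gamma>)"
  shows "\<Xi> @ \<Gamma> \<turnstile> subst a (sh (length \<Xi>)) \<doteq> subst b (sh (length \<Xi>)) \<Colon> subst A (sh (length \<Xi>))"
  by (rule jeq_substitution[OF assms])
    (auto intro!: var_type[OF assms(2)] jeq_refl simp: nth_append add.commute)

lemmas type_wk1 = type_sh[where \<Xi> = "[B]" for B, simplified]
lemmas type_wk2 = type_sh[where \<Xi> = "[C, B]" for B C, simplified]
lemmas type_wk3 = type_sh[where \<Xi> = "[D, C, B]" for B C D, simplified]
lemmas jeq_wk1 = jeq_sh[where \<Xi> = "[B]" for B, simplified]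

lemma type_sub:
  assumes t: "B # \<Gamma> \<turnstile> t \<Colon> T" and b: "\<Gamma> \<turnstile> b \<Colon> B"
  shows "\<Gamma> \<turnstile> subst t (b .: Var) \<Colon> subst T (b .: Var)"
proof (rule substitution[OF t])
  show c: "ctx \<Gamma>" using b by (rule ctx_if_has_type)
  fix i assume "i < length (B # \<Gamma>)"
  then show "\<Gamma> \<turnstile> (b .: Var) i \<Colon> subst (wk (Suc i) ((B # \<Gamma>) ! i)) (b .: Var)"
    using b c by (cases i) (auto intro: var_type)
qed

lemma wk1_has_type:
  "\<lbrakk>\<Gamma> \<turnstile> a \<Colon> A; \<Gamma> \<turnstile> B \<Colon> Type; A' = subst A (sh (Suc 0))\<rbrakk> \<Longrightarrow> B # \<Gamma> \<turnstile> subst a (sh (Suc 0)) \<Colon> A'"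
  using type_wk1 by (simp add: ctx_cons_iff)

lemma wk2_has_type:
  "\<lbrakk>\<Gamma> \<turnstile> a \<Colon> A; \<Gamma> \<turnstile> B \<Colon> Type; B # \<Gamma> \<turnstile> C \<Colon> Type; A' = subst A (sh (Suc (Suc 0)))\<rbrakk>
   \<Longrightarrow> C # B # \<Gamma> \<turnstile> subst a (sh (Suc (Suc 0))) \<Colon> A'"
  using type_wk2 by (simp add: ctx_cons_iff)

lemma wk3_has_type:
  "\<lbrakk>\<Gamma> \<turnstile> a \<Colon> A; \<Gamma> \<turnstile> B \<Colon> Type; B # \<Gamma> \<turnstile> C \<Colon> Type; C # B # \<Gamma> \<turnstile> D \<Colon> Type; A' = subst A (sh (Suc (Suc
    (Suc 0))))\<rbrakk>
   \<Longrightarrow> D # C # B # \<Gamma> \<turnstile> subst a (sh (Suc (Suc (Suc 0)))) \<Colon> A'"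
  using type_wk3 by (simp add: ctx_cons_iff)

text \<open>
  In the general rules the type before weakening does not occur in the conclusion; the simplifier
  needs instances in which it can be read off.
\<close>

lemmas wk_has_type =
  wk1_has_type[where A = Type, simplified] wk1_has_type[where A = U, simplified]
  wk1_has_type[where A = Nat, simplified]
  wk1_has_type[OF _ _ refl] wk1_has_type[where A = "Eq A a b" for A a b, OF _ _ refl, simplified]
  wk2_has_type[where A = Type, simplified] wk2_has_type[where A = U, simplified]
  wk2_has_type[where A = Nat, simplified]
  wk2_has_type[OF _ _ _ refl] wk2_has_type[where A = "Eq A a b" for A a b, OF _ _ _ refl,
    simplified]
  wk3_has_type[where A = Type, simplified] wk3_has_type[where A = U, simplified]
  wk3_has_type[where A = Nat, simplified]
  wk3_has_type[OF _ _ _ _ refl] wk3_has_type[where A = "Eq A a b" for A a b, OF _ _ _ _ refl,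
    simplified]

text \<open>Weakening below one binder: the innermost variable stays and the others move past
  \<open>\<Xi>\<close>. Families and open terms need this when they are carried into the contexts of
  path-induction motives.\<close>

lemma lift_has_type:
  assumes t: "A # \<Gamma> \<turnstile> t \<Colon> T" and c: "ctx (subst A (sh (length \<Xi>)) # \<Xi> @ \<Gamma>)"
  shows "subst A (sh (length \<Xi>)) # \<Xi> @ \<Gamma> \<turnstile> subst t (Var 0 .: sh (Suc (length \<Xi>)))
    \<Colon> subst T (Var 0 .: sh (Suc (length \<Xi>)))"
proof (rule substitution[OF t c])
  fix i assume "i < length (A # \<Gamma>)"
  then show "subst A (sh (length \<Xi>)) # \<Xi> @ \<Gamma> \<turnstile> (Var 0 .: sh (Suc (length \<Xi>))) i \<Colon>
    subst (wk (Suc i) ((A # \<Gamma>) ! i)) (Var 0 .: sh (Suc (length \<Xi>)))"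
    by (cases i) (auto intro!: var_type[OF c] simp: nth_append add.commute)
qed

lemma lift1_has_type:
  assumes t: "A # \<Gamma> \<turnstile> t \<Colon> T" and "\<Gamma> \<turnstile> A \<Colon> Type" "\<Gamma> \<turnstile> B \<Colon> Type"
  shows "subst A (sh (Suc 0)) # B # \<Gamma> \<turnstile> subst t (Var 0 .: sh (Suc (Suc 0))) \<Colon> subst T (Var 0 .: sh
    (Suc (Suc 0)))"
  using lift_has_type[OF t, of "[B]"] wk1_has_type[OF assms(2,3) refl] by (simp add: ctx_cons_iff)

lemma lift2_has_type:
  assumes t: "A # \<Gamma> \<turnstile> t \<Colon> T" and "\<Gamma> \<turnstile> A \<Colon> Type" "B # \<Gamma> \<turnstile> C \<Colon> Type"
  shows "subst A (sh (Suc (Suc 0))) # C # B # \<Gamma> \<turnstile> subst t (Var 0 .: sh (Suc (Suc (Suc 0))))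
    \<Colon> subst T (Var 0 .: sh (Suc (Suc (Suc 0))))"
  using lift_has_type[OF t, of "[C, B]"] wk2_has_type[OF assms(2) _ assms(3) refl]
    ctx_if_has_type[OF assms(3)] assms(3)
  by (simp add: ctx_cons_iff)

lemma lift3_has_type:
  assumes t: "A # \<Gamma> \<turnstile> t \<Colon> T" and "\<Gamma> \<turnstile> A \<Colon> Type" "B # \<Gamma> \<turnstile> C \<Colon> Type" "C # B # \<Gamma> \<turnstile> D \<Colon> Type"
  shows "subst A (sh (Suc (Suc (Suc 0)))) # D # C # B # \<Gamma> \<turnstile> subst t (Var 0 .: sh (Suc (Suc (Suc
    (Suc 0)))))
    \<Colon> subst T (Var 0 .: sh (Suc (Suc (Suc (Suc 0)))))"
  using lift_has_type[OF t, of "[D, C, B]"] wk3_has_type[OF assms(2) _ assms(3,4) refl]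
    ctx_if_has_type[OF assms(3)] assms(3,4)
  by (simp add: ctx_cons_iff)

text \<open>
  The rule \<open>U_El\<close> is left out on purpose: with it the simplifier would try every formation rule for
  both sorts at each level, which takes exponential time.
\<close>

lemmas formation = U_form U_El[OF Nat_form] U_El[OF Empty_form]
  Pi_form[where S = U, simplified] Pi_form[where S = Type, simplified]
  Sig_form[where S = U, simplified] Sig_form[where S = Type, simplified]
  Eq_form[where S = U, simplified] Eq_form[where S = Type, simplified]
  Sum_form[where S = U, simplified] Sum_form[where S = Type, simplified]
  Nat_form Empty_form Zero_intro Succ_intro

lemmas ty = formation Lam_intro Pair_intro Refl_intro InL_intro InR_intro
  var_type ctx_cons_iff wk_has_type ctx_if_has_type

lemma App_Arr: "\<lbrakk>\<Gamma> \<turnstile> f \<Colon> Pi A (subst B (sh (Suc 0))); \<Gamma> \<turnstile> a \<Colon> A\<rbrakk> \<Longrightarrow> \<Gamma> \<turnstile> App f a \<Colon> B"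
  using App_elim[of \<Gamma> f A "wk 1 B" a] by simp

section \<open>Paths\<close>

text \<open>
  With this definition of concatenation, transport in the family \<open>x = _\<close>, which occurs in the path
  case of coequalizer induction, is literally concatenation.
\<close>

definition pcat :: "tm \<Rightarrow> tm \<Rightarrow> tm \<Rightarrow> tm \<Rightarrow> tm \<Rightarrow> tm \<Rightarrow> tm" where
  "pcat T x y z p q = transport T (Eq (wk 1 T) (wk 1 x) (Var 0)) y z q p"

lemma subst_transport[simp]: "subst (transport A P a b p u) \<sigma> =
  transport (subst A \<sigma>) (subst P (ups \<sigma>)) (subst a \<sigma>) (subst b \<sigma>) (subst p \<sigma>) (subst u \<sigma>)"
  by (simp add: transport_def)

lemma subst_pcat[simp]: "subst (pcat T x y z p q) \<sigma> =
  pcat (subst T \<sigma>) (subst x \<sigma>) (subst y \<sigma>) (subst z \<sigma>) (subst p \<sigma>) (subst q \<sigma>)"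
  by (simp add: pcat_def)

lemma pcat_type:
  "\<lbrakk>\<Gamma> \<turnstile> T \<Colon> Type; \<Gamma> \<turnstile> x \<Colon> T; \<Gamma> \<turnstile> y \<Colon> T; \<Gamma> \<turnstile> z \<Colon> T; \<Gamma> \<turnstile> p \<Colon> Eq T x y; \<Gamma> \<turnstile> q \<Colon> Eq T y z\<rbrakk>
   \<Longrightarrow> \<Gamma> \<turnstile> pcat T x y z p q \<Colon> Eq T x z"
  unfolding pcat_def transport_def
  using J_elim[of \<Gamma> T y "Eq (wk 2 T) (wk 2 x) (Var 1)" p z q]
  by (simp add: ty)

text \<open>The inner and the right endpoint may vary too: the endpoints of the colimit glue agree
  with the expected points only judgementally. For fixed endpoints there is
  \<open>pcat_paths_cong\<close>.\<close>

lemma pcat_cong: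
  "\<lbrakk>\<Gamma> \<turnstile> T \<Colon> Type; \<Gamma> \<turnstile> x \<Colon> T; \<Gamma> \<turnstile> y \<doteq> y' \<Colon> T; \<Gamma> \<turnstile> y \<Colon> T; \<Gamma> \<turnstile> z \<doteq> z' \<Colon> T;
    \<Gamma> \<turnstile> p \<doteq> p' \<Colon> Eq T x y; \<Gamma> \<turnstile> q \<doteq> q' \<Colon> Eq T y z\<rbrakk>
   \<Longrightarrow> \<Gamma> \<turnstile> pcat T x y z p q \<doteq> pcat T x y' z' p' q' \<Colon> Eq T x z"
  unfolding pcat_def transport_def
  using J_cong[of \<Gamma> T T y y' "Eq (wk 2 T) (wk 2 x) (Var 1)" "Eq (wk 2 T) (wk 2 x) (Var 1)" p p' z
    z' q q']
  by (simp add: ty jeq_refl)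

lemma pcat_paths_cong:
  "\<lbrakk>\<Gamma> \<turnstile> T \<Colon> Type; \<Gamma> \<turnstile> x \<Colon> T; \<Gamma> \<turnstile> y \<Colon> T; \<Gamma> \<turnstile> z \<Colon> T; \<Gamma> \<turnstile> p \<doteq> p' \<Colon> Eq T x y; \<Gamma> \<turnstile> q \<doteq> q' \<Colon> Eq T y z\<rbrakk>
   \<Longrightarrow> \<Gamma> \<turnstile> pcat T x y z p q \<doteq> pcat T x y z p' q' \<Colon> Eq T x z"
  by (intro pcat_cong jeq_refl)

text \<open>Concatenation is path induction on its second argument, so the right unit law is
  judgemental. The path algebra below is arranged to induct on the last path of a chain.\<close>

lemma pcat_Refl:
  "\<lbrakk>\<Gamma> \<turnstile> T \<Colon> Type; \<Gamma> \<turnstile> x \<Colon> T; \<Gamma> \<turnstile> y \<Colon> T; \<Gamma> \<turnstile> p \<Colon> Eq T x y\<rbrakk>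
   \<Longrightarrow> \<Gamma> \<turnstile> pcat T x y y p (Refl T y) \<doteq> p \<Colon> Eq T x y"
  unfolding pcat_def transport_def
  using J_beta[of \<Gamma> T y "Eq (wk 2 T) (wk 2 x) (Var 1)" p]
  by (simp add: ty)

definition pinv :: "tm \<Rightarrow> tm \<Rightarrow> tm \<Rightarrow> tm \<Rightarrow> tm" where
  "pinv T x y p = J T x (Eq (wk 2 T) (Var 1) (wk 2 x)) (Refl T x) y p"

lemma subst_pinv[simp]:
  "subst (pinv T x y p) \<sigma> = pinv (subst T \<sigma>) (subst x \<sigma>) (subst y \<sigma>) (subst p \<sigma>)"
  by (simp add: pinv_def)

lemma pinv_type:
  "\<lbrakk>\<Gamma> \<turnstile> T \<Colon> Type; \<Gamma> \<turnstile> x \<Colon> T; \<Gamma> \<turnstile> y \<Colon> T; \<Gamma> \<turnstile> p \<Colon> Eq T x y\<rbrakk> \<Longrightarrow> \<Gamma> \<turnstile> pinv T x y p \<Colon> Eq T y x"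
  unfolding pinv_def
  using J_elim[of \<Gamma> T x "Eq (wk 2 T) (Var 1) (wk 2 x)" "Refl T x" y p]
  by (simp add: ty)

lemma pinv_Refl:
  "\<lbrakk>\<Gamma> \<turnstile> T \<Colon> Type; \<Gamma> \<turnstile> x \<Colon> T\<rbrakk> \<Longrightarrow> \<Gamma> \<turnstile> pinv T x x (Refl T x) \<doteq> Refl T x \<Colon> Eq T x x"
  unfolding pinv_def
  using J_beta[of \<Gamma> T x "Eq (wk 2 T) (Var 1) (wk 2 x)" "Refl T x"]
  by (simp add: ty)

text \<open>The map is an open term \<open>i\<close> over \<open>Y\<close> rather than an element of
  a function type, so its values are substitution instances and no beta step intervenes.\<close>

definition ap :: "tm \<Rightarrow> tm \<Rightarrow> tm \<Rightarrow> tm \<Rightarrow> tm \<Rightarrow> tm \<Rightarrow> tm" where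
  "ap Y T i x y p = J Y x (Eq (wk 2 T) (wk 2 (sub x i)) (wk 1 i)) (Refl T (sub x i)) y p"

lemma subst_ap[simp]:
  "subst (ap Y T i x y p) \<sigma> = ap (subst Y \<sigma>) (subst T \<sigma>) (subst i (ups \<sigma>)) (subst x \<sigma>) (subst y \<sigma>)
    (subst p \<sigma>)"
  by (simp add: ap_def)

lemma ap_type:
  assumes "\<Gamma> \<turnstile> Y \<Colon> Type" "\<Gamma> \<turnstile> T \<Colon> Type" and i: "Y # \<Gamma> \<turnstile> i \<Colon> wk 1 T" and x: "\<Gamma> \<turnstile> x \<Colon> Y" and "\<Gamma> \<turnstile> y
    \<Colon> Y"
    "\<Gamma> \<turnstile> p \<Colon> Eq Y x y"
  shows "\<Gamma> \<turnstile> ap Y T i x y p \<Colon> Eq T (sub x i) (sub y i)"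
  unfolding ap_def
  using J_elim[of \<Gamma> Y x "Eq (wk 2 T) (wk 2 (sub x i)) (wk 1 i)" "Refl T (sub x i)" y p] assms
    type_sub[OF i x] wk2_has_type[OF type_sub[OF i x], of Y "Eq (wk 1 Y) (wk 1 x) (Var 0)"]
  by (simp add: ty wk1_has_type)

lemma ap_Refl:
  assumes "\<Gamma> \<turnstile> Y \<Colon> Type" "\<Gamma> \<turnstile> T \<Colon> Type" and i: "Y # \<Gamma> \<turnstile> i \<Colon> wk 1 T" and x: "\<Gamma> \<turnstile> x \<Colon> Y"
  shows "\<Gamma> \<turnstile> ap Y T i x x (Refl Y x) \<doteq> Refl T (sub x i) \<Colon> Eq T (sub x i) (sub x i)"
  unfolding ap_def
  using J_beta[of \<Gamma> Y x "Eq (wk 2 T) (wk 2 (sub x i)) (wk 1 i)" "Refl T (sub x i)"] assms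
    type_sub[OF i x] wk2_has_type[OF type_sub[OF i x], of Y "Eq (wk 1 Y) (wk 1 x) (Var 0)"]
  by (simp add: ty wk1_has_type)

text \<open>
  Proofs are irrelevant for most intermediate results, so these are stated as inhabitation of a type
  rather than with explicit terms.
\<close>

definition inh :: "tm list \<Rightarrow> tm \<Rightarrow> bool" where
  "inh \<Gamma> A \<longleftrightarrow> (\<exists>t. \<Gamma> \<turnstile> t \<Colon> A)"

lemma inhI: "\<Gamma> \<turnstile> t \<Colon> A \<Longrightarrow> inh \<Gamma> A"
  by (auto simp: inh_def)

lemma inh_conv: "\<lbrakk>inh \<Gamma> A; \<Gamma> \<turnstile> A \<doteq> B \<Colon> Type\<rbrakk> \<Longrightarrow> inh \<Gamma> B"
  unfolding inh_def by (blast intro: conv)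

lemma inh_J:
  assumes "\<Gamma> \<turnstile> A \<Colon> Type" "\<Gamma> \<turnstile> a \<Colon> A" "Eq (wk 1 A) (wk 1 a) (Var 0) # A # \<Gamma> \<turnstile> C \<Colon> Type"
    "inh \<Gamma> (sub2 a (Refl A a) C)" "\<Gamma> \<turnstile> b \<Colon> A" "\<Gamma> \<turnstile> p \<Colon> Eq A a b"
  shows "inh \<Gamma> (sub2 b p C)"
  using J_elim assms unfolding inh_def by blast

lemma inh_Lam: "\<lbrakk>\<Gamma> \<turnstile> A \<Colon> Type; A # \<Gamma> \<turnstile> B \<Colon> Type; inh (A # \<Gamma>) B\<rbrakk> \<Longrightarrow> inh \<Gamma> (Pi A B)"
  using Lam_intro unfolding inh_def by blast

lemma inh_App: "\<lbrakk>inh \<Gamma> (Pi A B); \<Gamma> \<turnstile> a \<Colon> A\<rbrakk> \<Longrightarrow> inh \<Gamma> (subst B (a .: Var))"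
  using App_elim[of \<Gamma> _ A B a] unfolding inh_def by auto

lemma inh_wk1: "\<lbrakk>inh \<Gamma> A; \<Gamma> \<turnstile> B \<Colon> Type\<rbrakk> \<Longrightarrow> inh (B # \<Gamma>) (subst A (sh (Suc 0)))"
  unfolding inh_def using wk1_has_type by blast

lemma Eq_conv:
  "\<lbrakk>\<Gamma> \<turnstile> A \<Colon> Type; \<Gamma> \<turnstile> p \<Colon> Eq A a b; \<Gamma> \<turnstile> a \<doteq> a' \<Colon> A; \<Gamma> \<turnstile> b \<doteq> b' \<Colon> A\<rbrakk> \<Longrightarrow> \<Gamma> \<turnstile> p \<Colon> Eq A a' b'"
  by (rule conv, assumption, rule Eq_cong) (auto intro: jeq_refl)

lemma inh_Eq_conv:
  "\<lbrakk>\<Gamma> \<turnstile> A \<Colon> Type; inh \<Gamma> (Eq A a b); \<Gamma> \<turnstile> a \<doteq> a' \<Colon> A; \<Gamma> \<turnstile> b \<doteq> b' \<Colon> A\<rbrakk> \<Longrightarrow> inh \<Gamma> (Eq A a' b')"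
  unfolding inh_def using Eq_conv by blast

lemma inh_Eq_if_jeq:
  "\<lbrakk>\<Gamma> \<turnstile> A \<Colon> Type; \<Gamma> \<turnstile> a \<Colon> A; \<Gamma> \<turnstile> a \<doteq> b \<Colon> A\<rbrakk> \<Longrightarrow> inh \<Gamma> (Eq A a b)"
  by (rule inh_Eq_conv[of _ _ a a]) (auto intro: inhI Refl_intro jeq_refl)

lemma inh_Eq_trans:
  "\<lbrakk>\<Gamma> \<turnstile> A \<Colon> Type; \<Gamma> \<turnstile> a \<Colon> A; \<Gamma> \<turnstile> b \<Colon> A; \<Gamma> \<turnstile> c \<Colon> A; inh \<Gamma> (Eq A a b); inh \<Gamma> (Eq A b c)\<rbrakk> \<Longrightarrow> inh \<Gamma> (Eq
    A a c)"
  unfolding inh_def using pcat_type by blast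

lemma inh_Eq_sym:
  "\<lbrakk>\<Gamma> \<turnstile> A \<Colon> Type; \<Gamma> \<turnstile> a \<Colon> A; \<Gamma> \<turnstile> b \<Colon> A; inh \<Gamma> (Eq A a b)\<rbrakk> \<Longrightarrow> inh \<Gamma> (Eq A b a)"
  unfolding inh_def using pinv_type by blast

text \<open>In \<open>contr_coherent\<close> this cancels the inverted glue at the end of
  \<open>fromBase\<close> against the glue that follows it.\<close>

lemma pcat_pinv_cancel_right:
  assumes [simp]: "\<Gamma> \<turnstile> T \<Colon> Type" "\<Gamma> \<turnstile> x \<Colon> T" "\<Gamma> \<turnstile> b \<Colon> T" "\<Gamma> \<turnstile> w \<Colon> T" "\<Gamma> \<turnstile> z \<Colon> T"
    and k[simp]: "\<Gamma> \<turnstile> k \<Colon> Eq T x b" and u: "\<Gamma> \<turnstile> u \<Colon> Eq T b z" and s: "\<Gamma> \<turnstile> s \<Colon> Eq T w z"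
  shows "inh \<Gamma> (Eq (Eq T x z) (pcat T x w z (pcat T x b w k (pcat T b z w u (pinv T w z s))) s)
    (pcat T x b z k u))"
proof -
  \<comment> \<open>Path induction on \<open>s\<close> moves its endpoint \<open>z\<close>, at which
    \<open>u\<close> ends, so the motive quantifies over \<open>u\<close>. At reflexivity both sides
    agree judgementally by \<open>pinv_Refl\<close> and two right unit laws.\<close>
  define C where "C = Pi (Eq (wk 2 T) (wk 2 b) (Var 1))
    (Eq (Eq (wk 3 T) (wk 3 x) (Var 2)) (pcat (wk 3 T) (wk 3 x) (wk 3 w) (Var 2)
        (pcat (wk 3 T) (wk 3 x) (wk 3 b) (wk 3 w) (wk 3 k)
           (pcat (wk 3 T) (wk 3 b) (Var 2) (wk 3 w) (Var 0) (pinv (wk 3 T) (wk 3 w) (Var 2) (Var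
             1)))) (Var 1))
       (pcat (wk 3 T) (wk 3 x) (wk 3 b) (Var 2) (wk 3 k) (Var 0)))"
  note [simp] = ty pcat_type pinv_type u s
  let ?D = "Eq T b w # \<Gamma>"
  have D[simp]: "?D \<turnstile> wk 1 T \<Colon> Type" "?D \<turnstile> wk 1 x \<Colon> wk 1 T" "?D \<turnstile> wk 1 b \<Colon> wk 1 T"
    "?D \<turnstile> wk 1 w \<Colon> wk 1 T" "?D \<turnstile> wk 1 k \<Colon> wk 1 (Eq T x b)" by simp_all
  have j: "?D \<turnstile> pcat (wk 1 T) (wk 1 x) (wk 1 w) (wk 1 w) (pcat (wk 1 T) (wk 1 x) (wk 1 b) (wk 1 w)
    (wk 1 k)
     (pcat (wk 1 T) (wk 1 b) (wk 1 w) (wk 1 w) (Var 0) (pinv (wk 1 T) (wk 1 w) (wk 1 w) (Refl (wk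
       1 T) (wk 1 w)))))
       (Refl (wk 1 T) (wk 1 w))
     \<doteq> pcat (wk 1 T) (wk 1 x) (wk 1 b) (wk 1 w) (wk 1 k) (Var 0) \<Colon> Eq (wk 1 T) (wk 1 x) (wk 1 w)"
    apply (rule jeq_trans, rule pcat_Refl)
       apply simp_all[4]
    apply (rule pcat_paths_cong)
         apply simp_all[4]
    apply (rule jeq_refl, simp)
    apply (rule jeq_trans)
    apply (rule pcat_paths_cong)
         apply simp_all[4]
    apply (rule jeq_refl, simp)
    apply (rule pinv_Refl)
     apply simp_all[2]
    apply (rule pcat_Refl)
       apply simp_all[4]
    done
  have "inh \<Gamma> (sub2 z s C)"
  proof (rule inh_J[where A = T and a = w])
    show "inh \<Gamma> (sub2 w (Refl T w) C)"
      unfolding C_def using j by (auto intro!: inh_Lam inh_Eq_if_jeq)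
  qed (use s in \<open>simp_all add: C_def\<close>)
  from inh_App[OF this[unfolded C_def, simplified] u] show ?thesis
    by simp
qed

text \<open>The base case of \<open>pcat_ap\<close>, with \<open>s\<close> the value of
  \<open>Q\<close> at \<open>c\<close>. Here \<open>k\<close> itself ends at the moving endpoint of
  \<open>s\<close> and is quantified in the motive.\<close>

lemma pcat_pinv_cancel_right':
  assumes [simp]: "\<Gamma> \<turnstile> T \<Colon> Type" "\<Gamma> \<turnstile> x \<Colon> T" "\<Gamma> \<turnstile> b \<Colon> T" "\<Gamma> \<turnstile> w \<Colon> T"
    and k[simp]: "\<Gamma> \<turnstile> k \<Colon> Eq T x b" and s: "\<Gamma> \<turnstile> s \<Colon> Eq T w b"
  shows "inh \<Gamma> (Eq (Eq T x b) k (pcat T x w b (pcat T x b w k (pinv T w b s)) s))"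
proof -
  define C where "C = Pi (Eq (wk 2 T) (wk 2 x) (Var 1))
    (Eq (Eq (wk 3 T) (wk 3 x) (Var 2)) (Var 0) (pcat (wk 3 T) (wk 3 x) (wk 3 w) (Var 2)
        (pcat (wk 3 T) (wk 3 x) (Var 2) (wk 3 w) (Var 0) (pinv (wk 3 T) (wk 3 w) (Var 2) (Var 1)))
          (Var 1)))"
  note [simp] = ty pcat_type pinv_type s
  let ?D = "Eq T x w # \<Gamma>"
  have D[simp]: "?D \<turnstile> wk 1 T \<Colon> Type" "?D \<turnstile> wk 1 x \<Colon> wk 1 T" "?D \<turnstile> wk 1 w \<Colon> wk 1 T" by simp_all
  have j: "?D \<turnstile> Var 0 \<doteq> pcat (wk 1 T) (wk 1 x) (wk 1 w) (wk 1 w) (pcat (wk 1 T) (wk 1 x) (wk 1 w)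
    (wk 1 w) (Var 0)
     (pinv (wk 1 T) (wk 1 w) (wk 1 w) (Refl (wk 1 T) (wk 1 w))))
       (Refl (wk 1 T) (wk 1 w))
      \<Colon> Eq (wk 1 T) (wk 1 x) (wk 1 w)"
    apply (rule jeq_sym)
    apply (rule jeq_trans, rule pcat_Refl)
       apply simp_all[4]
    apply (rule jeq_trans)
    apply (rule pcat_paths_cong)
         apply simp_all[4]
    apply (rule jeq_refl, simp)
    apply (rule pinv_Refl)
     apply simp_all[2]
    apply (rule pcat_Refl)
       apply simp_all[4]
    done
  have "inh \<Gamma> (sub2 b s C)"
  proof (rule inh_J[where A = T and a = w])
    show "inh \<Gamma> (sub2 w (Refl T w) C)"
      unfolding C_def using j by (auto intro!: inh_Lam inh_Eq_if_jeq)
  qed (simp_all add: C_def)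
  from inh_App[OF this[unfolded C_def, simplified] k] show ?thesis
    by simp
qed

lemma pinv_pcat:
  assumes [simp]: "\<Gamma> \<turnstile> T \<Colon> Type" "\<Gamma> \<turnstile> x \<Colon> T" "\<Gamma> \<turnstile> y \<Colon> T" and s[simp]: "\<Gamma> \<turnstile> s \<Colon> Eq T x y"
  shows "inh \<Gamma> (Eq (Eq T y y) (Refl T y) (pcat T y x y (pinv T x y s) s))"
proof -
  note [simp] = ty pcat_type pinv_type s
  define C where "C = Eq (Eq (wk 2 T) (Var 1) (Var 1)) (Refl (wk 2 T) (Var 1))
    (pcat (wk 2 T) (Var 1) (wk 2 x) (Var 1) (pinv (wk 2 T) (wk 2 x) (Var 1) (Var 0)) (Var 0))"
  have j: "\<Gamma> \<turnstile> Refl T x \<doteq> pcat T x x x (pinv T x x (Refl T x)) (Refl T x) \<Colon> Eq T x x"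
    apply (rule jeq_sym)
    apply (rule jeq_trans, rule pcat_Refl)
       apply simp_all[4]
    apply (rule pinv_Refl)
     apply simp_all[2]
    done
  have "inh \<Gamma> (sub2 y s C)"
  proof (rule inh_J[where A = T and a = x])
    show "inh \<Gamma> (sub2 x (Refl T x) C)"
      unfolding C_def using j by (auto intro!: inh_Lam inh_Eq_if_jeq)
  qed (simp_all add: C_def)
  then show ?thesis
    by (simp add: C_def)
qed

text \<open>Naturality of \<open>Q : b = i\<close> along \<open>r\<close>, solved for the action of \<open>i\<close> on \<open>r\<close>.\<close>

lemma pcat_ap:
  assumes [simp]: "\<Gamma> \<turnstile> Y \<Colon> Type" "\<Gamma> \<turnstile> T \<Colon> Type" and i[simp]: "Y # \<Gamma> \<turnstile> i \<Colon> wk 1 T"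
    and [simp]: "\<Gamma> \<turnstile> b \<Colon> T" and Q[simp]: "Y # \<Gamma> \<turnstile> Q \<Colon> Eq (wk 1 T) (wk 1 b) i"
    and c[simp]: "\<Gamma> \<turnstile> c \<Colon> Y" and y[simp]: "\<Gamma> \<turnstile> y \<Colon> Y" and [simp]: "\<Gamma> \<turnstile> r \<Colon> Eq Y c y" "\<Gamma> \<turnstile> x \<Colon> T"
    and k[simp]: "\<Gamma> \<turnstile> k \<Colon> Eq T x (sub c i)"
  shows "inh \<Gamma> (Eq (Eq T x (sub y i)) (pcat T x (sub c i) (sub y i) k (ap Y T i c y r))
    (pcat T x b (sub y i) (pcat T x (sub c i) b k (pinv T b (sub c i) (sub c Q))) (sub y Q)))"
proof -
  note [simp] = ty pcat_type pinv_type
  note kk[simp] = k[simplified] i[simplified] Q[simplified]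
  have ic[simp]: "\<Gamma> \<turnstile> subst i (c .: Var) \<Colon> T" using type_sub[OF i c] by simp
  have Qc[simp]: "\<Gamma> \<turnstile> subst Q (c .: Var) \<Colon> Eq T b (subst i (c .: Var))" using type_sub[OF Q c] by
    simp
  \<comment> \<open>This factor does not depend on \<open>y\<close> and \<open>r\<close>, so it
    stays fixed during path induction on \<open>r\<close>.\<close>
  define k' where "k' = pcat T x (sub c i) b k (pinv T b (sub c i) (sub c Q))"
  have k'[simp]: "\<Gamma> \<turnstile> k' \<Colon> Eq T x b" by (simp add: k'_def)
  \<comment> \<open>As \<open>i\<close> and \<open>Q\<close> live over \<open>Y\<close>, weakening
    them past the path variable alone evaluates them at the moving endpoint.\<close>
  define C where "C = Eq (Eq (wk 2 T) (wk 2 x) (wk 1 i))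
    (pcat (wk 2 T) (wk 2 x) (wk 2 (sub c i)) (wk 1 i) (wk 2 k)
       (ap (wk 2 Y) (wk 2 T) (shift 2 1 i) (wk 2 c) (Var 1) (Var 0)))
    (pcat (wk 2 T) (wk 2 x) (wk 2 b) (wk 1 i) (wk 2 k') (wk 1 Q))"
  let ?E = "Eq (subst Y (sh (Suc 0))) (subst c (sh (Suc 0))) (Var 0)"
  have E[simp]: "Y # \<Gamma> \<turnstile> ?E \<Colon> Type" by simp
  have [simp]: "?E # Y # \<Gamma> \<turnstile> subst i (subst c (sh (Suc (Suc 0))) .: sh (Suc (Suc 0))) \<Colon> subst T
    (sh (Suc (Suc 0)))"
    using wk2_has_type[OF ic _ E refl] by simp
  have i2: "subst Y (sh (Suc (Suc 0))) # ?E # Y # \<Gamma> \<turnstile> subst i (Var 0 .: sh (Suc (Suc (Suc 0)))) \<Colon>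
    subst T (sh (Suc (Suc (Suc 0))))"
    using lift2_has_type[OF i _ E] by simp
  have ap[simp]: "?E # Y # \<Gamma> \<turnstile> ap (wk 2 Y) (wk 2 T) (shift 2 1 i) (wk 2 c) (Var 1) (Var 0)
     \<Colon> Eq (wk 2 T) (wk 2 (sub c i)) (wk 1 i)"
    using ap_type[of "?E # Y # \<Gamma>" "wk 2 Y" "wk 2 T" "shift 2 1 i" "wk 2 c" "Var 1" "Var 0"] i2 by
      simp
  note ap' [simp] = ap[simplified]
  have [simp]: "?E # Y # \<Gamma> \<turnstile> subst Q (sh (Suc 0))
      \<Colon> Eq (subst T (sh (Suc (Suc 0)))) (subst b (sh (Suc (Suc 0)))) (subst i (sh (Suc 0)))"
    using wk1_has_type[OF Q E refl] by simp
  have [simp]: "?E # Y # \<Gamma> \<turnstile> subst i (sh (Suc 0)) \<Colon> subst T (sh (Suc (Suc 0)))"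
    using wk1_has_type[OF i E refl] by simp
  have [simp]: "?E # Y # \<Gamma> \<turnstile> subst k (sh (Suc (Suc 0)))
      \<Colon> Eq (subst T (sh (Suc (Suc 0)))) (subst x (sh (Suc (Suc 0)))) (subst i (subst c (sh (Suc
        (Suc 0))) .: sh (Suc (Suc 0))))"
    using wk2_has_type[OF k _ E refl] by simp
  have j: "\<Gamma> \<turnstile> pcat T x (sub c i) (sub c i) k (ap Y T i c c (Refl Y c)) \<doteq> k \<Colon> Eq T x (sub c i)"
    apply (rule jeq_trans)
    apply (rule pcat_paths_cong[OF _ _ _ _ jeq_refl[OF k] ap_Refl])
    apply (simp_all)[8]
    using pcat_Refl[of \<Gamma> T x "sub c i" k] apply simp
    done
  have "inh \<Gamma> (sub2 y r C)"
  proof (rule inh_J[where A = Y and a = c])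
    show "inh \<Gamma> (sub2 c (Refl Y c) C)"
      unfolding C_def using pcat_pinv_cancel_right'[of \<Gamma> T x "sub c i" b k "sub c Q"] j
      by (auto simp: k'_def intro!: inh_Eq_conv[OF _ _ jeq_sym[OF j[simplified]] jeq_refl])
  qed (simp_all add: C_def)
  then show ?thesis
    by (simp add: C_def k'_def)
qed

section \<open>Propositions and function extensionality\<close>

lemma isProp_type: "\<Gamma> \<turnstile> A \<Colon> Type \<Longrightarrow> \<Gamma> \<turnstile> isProp A \<Colon> Type"
  by (simp add: isProp_def ty)

lemma subst_isProp[simp]: "subst (isProp A) \<sigma> = isProp (subst A \<sigma>)"
  by (simp add: isProp_def)

lemma isPropD:
  assumes "\<Gamma> \<turnstile> q \<Colon> isProp A" "\<Gamma> \<turnstile> x \<Colon> A" "\<Gamma> \<turnstile> y \<Colon> A"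
  shows "\<Gamma> \<turnstile> App (App q x) y \<Colon> Eq A x y"
proof -
  have "\<Gamma> \<turnstile> App q x \<Colon> Pi A (Eq (wk 1 A) (wk 1 x) (Var 0))"
    using App_elim[OF assms(1)[unfolded isProp_def] assms(2)] by simp
  from App_elim[OF this assms(3)] show ?thesis by simp
qed

text \<open>The right-hand side does not mention \<open>r\<close>, hence any two paths from
  \<open>x\<close> to \<open>y\<close> are equal. Induction on \<open>r\<close> leaves
  \<open>pinv_pcat\<close>.\<close>

lemma isProp_path_eq:
  assumes [simp]: "\<Gamma> \<turnstile> T \<Colon> Type" and q[simp]: "\<Gamma> \<turnstile> q \<Colon> isProp T" and [simp]: "\<Gamma> \<turnstile> x \<Colon> T" "\<Gamma> \<turnstile> y \<Colon>
    T" "\<Gamma> \<turnstile> r \<Colon> Eq T x y"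
  shows "inh \<Gamma> (Eq (Eq T x y) r (pcat T x x y (pinv T x x (App (App q x) x)) (App (App q x) y)))"
proof -
  note [simp] = ty pcat_type pinv_type isPropD
  define C where "C = Eq (Eq (wk 2 T) (wk 2 x) (Var 1)) (Var 0) (pcat (wk 2 T) (wk 2 x) (wk 2 x)
    (Var 1) (wk 2 (pinv T x x (App (App q x) x)))
    (App (App (wk 2 q) (wk 2 x)) (Var 1)))"
  let ?E = "Eq (subst T (sh (Suc 0))) (subst x (sh (Suc 0))) (Var 0)"
  have E[simp]: "T # \<Gamma> \<turnstile> ?E \<Colon> Type" by simp
  have [simp]: "?E # T # \<Gamma> \<turnstile> subst q (sh (Suc (Suc 0))) \<Colon> isProp (subst T (sh (Suc (Suc 0))))"
    using wk2_has_type[OF q _ E refl] by simp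
  have "inh \<Gamma> (sub2 y r C)"
  proof (rule inh_J[where A = T and a = x])
    show "inh \<Gamma> (sub2 x (Refl T x) C)"
      unfolding C_def using pinv_pcat[of \<Gamma> T x x "App (App q x) x"] by simp
  qed (simp_all add: C_def)
  then show ?thesis
    by (simp add: C_def)
qed

lemma isProp_Eq:
  assumes T[simp]: "\<Gamma> \<turnstile> T \<Colon> Type" and q: "inh \<Gamma> (isProp T)" and x: "\<Gamma> \<turnstile> x \<Colon> T" "\<Gamma> \<turnstile> y \<Colon> T"
  shows "inh \<Gamma> (isProp (Eq T x y))"
proof -
  note [simp] = ty pcat_type pinv_type isPropD x
  obtain q where q[simp]: "\<Gamma> \<turnstile> q \<Colon> isProp T" using q by (auto simp: inh_def)
  let ?D = "Eq (wk 1 T) (wk 1 x) (wk 1 y) # Eq T x y # \<Gamma>"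
  have [simp]: "?D \<turnstile> wk 2 q \<Colon> isProp (wk 2 T)"
    using wk2_has_type[OF q _ _ refl] by simp
  note [simp] = this[simplified]
  have 1: "inh ?D (Eq (Eq (wk 2 T) (wk 2 x) (wk 2 y)) r (pcat (wk 2 T) (wk 2 x) (wk 2 x) (wk 2 y)
     (pinv (wk 2 T) (wk 2 x) (wk 2 x) (App (App (wk 2 q) (wk 2 x)) (wk 2 x))) (App (App (wk 2 q)
       (wk 2 x)) (wk 2 y))))"
    if "?D \<turnstile> r \<Colon> Eq (wk 2 T) (wk 2 x) (wk 2 y)" for r
    by (rule isProp_path_eq) (use that in simp_all)
  have "inh ?D (Eq (Eq (wk 2 T) (wk 2 x) (wk 2 y)) (Var 1) (Var 0))"
    by (rule inh_Eq_trans[OF _ _ _ _ 1 inh_Eq_sym[OF _ _ _ 1]]) simp_all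
  then show ?thesis unfolding isProp_def
    by (auto intro!: inh_Lam)
qed

section \<open>Paths between functions from homotopies\<close>

lemma App_wk_Var:
  assumes A: "\<Gamma> \<turnstile> A \<Colon> Type" and f: "\<Gamma> \<turnstile> f \<Colon> Pi A B"
  shows "A # \<Gamma> \<turnstile> App (subst f (sh (Suc 0))) (Var 0) \<Colon> B"
  using App_elim[OF wk1_has_type[OF f A refl, simplified], of "Var 0"] A by (simp add: ty)

lemma Htpy_type:
  assumes A: "\<Gamma> \<turnstile> A \<Colon> Type" and B: "A # \<Gamma> \<turnstile> B \<Colon> Type" and f: "\<Gamma> \<turnstile> f \<Colon> Pi A B" and g: "\<Gamma> \<turnstile> g \<Colon> Pi A
    B"
  shows "\<Gamma> \<turnstile> Htpy A B f g \<Colon> Type"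
  unfolding Htpy_def using App_wk_Var[OF A f] App_wk_Var[OF A g] A B by (simp add: ty)

text \<open>The axiom \<open>FunExt_intro\<close> gives an element of \<open>isEquiv\<close> of this
  map. Projecting out the inverse requires the types in that pair to be well-formed, and the map
  occurs in them.\<close>

lemma happly_type:
  assumes A[simp]: "\<Gamma> \<turnstile> A \<Colon> Type" and B: "A # \<Gamma> \<turnstile> B \<Colon> Type" and f: "\<Gamma> \<turnstile> f \<Colon> Pi A B" and g: "\<Gamma> \<turnstile> g
    \<Colon> Pi A B"
  shows "\<Gamma> \<turnstile> happly A B f g \<Colon> Arr (Eq (Pi A B) f g) (Htpy A B f g)"
proof -
  note [simp] = ty
  let ?E = "Eq (Pi A B) f g"
  let ?F = "Eq (wk 2 (Pi A B)) (wk 2 f) (Var 0)"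
  note [simp] = B f g
  have E[simp]: "\<Gamma> \<turnstile> ?E \<Colon> Type" by simp
  have P[simp]: "?E # \<Gamma> \<turnstile> wk 1 (Pi A B) \<Colon> Type" using wk1_has_type[OF _ E refl, of "Pi A B" Type]
    by simp
  have f1[simp]: "?E # \<Gamma> \<turnstile> wk 1 f \<Colon> wk 1 (Pi A B)" using wk1_has_type[OF f E refl] by simp
  have g1[simp]: "?E # \<Gamma> \<turnstile> wk 1 g \<Colon> wk 1 (Pi A B)" using wk1_has_type[OF g E refl] by simp
  have F[simp]: "wk 1 (Pi A B) # ?E # \<Gamma> \<turnstile> ?F \<Colon> Type"
    using wk2_has_type[OF f E P refl] wk2_has_type[OF _ E P refl, of "Pi A B" Type] P by simp
  have H: "?F # wk 1 (Pi A B) # ?E # \<Gamma> \<turnstile> Htpy (wk 3 A) (shift 3 1 B) (wk 3 f) (Var 1) \<Colon> Type"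
  proof (rule Htpy_type)
    show "?F # wk 1 (Pi A B) # ?E # \<Gamma> \<turnstile> wk 3 A \<Colon> Type"
      using wk3_has_type[OF A E P F refl] by simp
    show "wk 3 A # ?F # wk 1 (Pi A B) # ?E # \<Gamma> \<turnstile> shift 3 1 B \<Colon> Type"
      using lift3_has_type[OF B A P F] by simp
    show "?F # wk 1 (Pi A B) # ?E # \<Gamma> \<turnstile> wk 3 f \<Colon> Pi (wk 3 A) (shift 3 1 B)"
      using wk3_has_type[OF f E P F refl] by simp
    show "?F # wk 1 (Pi A B) # ?E # \<Gamma> \<turnstile> Var 1 \<Colon> Pi (wk 3 A) (shift 3 1 B)"
      using P F by (auto intro!: var_type simp: ctx_cons_iff)
  qed
  have A1[simp]: "?E # \<Gamma> \<turnstile> wk 1 A \<Colon> Type" using wk1_has_type[OF A E refl] by simp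
  have "wk 1 A # ?E # \<Gamma> \<turnstile> shift 1 1 B \<Colon> Type" using lift1_has_type[OF B A E] by simp
  moreover have "wk 1 A # ?E # \<Gamma> \<turnstile> App (wk 2 f) (Var 0) \<Colon> shift 1 1 B"
    using App_wk_Var[of "?E # \<Gamma>" "wk 1 A" "wk 1 f" "shift 1 1 B"] A1 f1 by simp
  ultimately have c: "?E # \<Gamma> \<turnstile> Lam (wk 1 A) (Refl (shift 1 1 B) (App (wk 2 f) (Var 0))) \<Colon>
     Htpy (wk 1 A) (shift 1 1 B) (wk 1 f) (wk 1 f)"
    unfolding Htpy_def using A1 by simp
  have Hg: "?E # \<Gamma> \<turnstile> Htpy (wk 1 A) (shift 1 1 B) (wk 1 f) (wk 1 g) \<Colon> Type"
    using wk1_has_type[OF Htpy_type[OF A B f g] E refl] by (simp add: Htpy_def)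
  have "?E # \<Gamma> \<turnstile> J (wk 1 (Pi A B)) (wk 1 f)
          (Htpy (wk 3 A) (shift 3 1 B) (wk 3 f) (Var 1))
          (Lam (wk 1 A) (Refl (shift 1 1 B) (App (wk 2 f) (Var 0))))
          (wk 1 g) (Var 0) \<Colon> Htpy (wk 1 A) (shift 1 1 B) (wk 1 f) (wk 1 g)"
    using J_elim[OF P f1 _ _ g1, of "Htpy (wk 3 A) (shift 3 1 B) (wk 3 f) (Var 1)"
       "Lam (wk 1 A) (Refl (shift 1 1 B) (App (wk 2 f) (Var 0)))" "Var 0"] H c
    by (simp add: Htpy_def)
  then show ?thesis
    using Hg by (auto simp: happly_def Htpy_def intro!: Lam_intro)
qed

lemma inh_fst:
  assumes [simp]: "\<Gamma> \<turnstile> A \<Colon> Type" and [simp]: "A # \<Gamma> \<turnstile> B \<Colon> Type" and p: "inh \<Gamma> (Sig A B)"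
  shows "inh \<Gamma> A"
proof -
  obtain p where p: "\<Gamma> \<turnstile> p \<Colon> Sig A B" using p by (auto simp: inh_def)
  show ?thesis
    using Sig_elim[of A B \<Gamma> "wk 1 A" "Var 1" p] p by (auto simp: ty intro: inhI)
qed

lemma hasSection_types:
  assumes [simp]: "\<Gamma> \<turnstile> X \<Colon> Type" "\<Gamma> \<turnstile> Y \<Colon> Type" and f: "\<Gamma> \<turnstile> f \<Colon> Arr X Y"
  shows "Arr Y X # \<Gamma> \<turnstile> Pi (wk 1 Y) (Eq (wk 2 Y) (App (wk 2 f) (App (Var 1) (Var 0))) (Var 0)) \<Colon>
    Type"
    and "\<Gamma> \<turnstile> hasSection X Y f \<Colon> Type"
proof -
  note [simp] = ty
  let ?D = "wk 1 Y # Arr Y X # \<Gamma>"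
  have "?D \<turnstile> App (wk 2 f) (App (Var 1) (Var 0)) \<Colon> wk 2 Y"
  proof (rule App_Arr)
    show "?D \<turnstile> wk 2 f \<Colon> Pi (wk 2 X) (subst (wk 2 Y) (sh (Suc 0)))"
      using wk2_has_type[OF f _ _ refl, of "Arr Y X" "wk 1 Y"] by simp
    show "?D \<turnstile> App (Var 1) (Var 0) \<Colon> wk 2 X"
      by (rule App_Arr[where A = "wk 2 Y"]) simp_all
  qed
  then show "Arr Y X # \<Gamma> \<turnstile> Pi (wk 1 Y) (Eq (wk 2 Y) (App (wk 2 f) (App (Var 1) (Var 0))) (Var 0))
    \<Colon> Type"
    by simp
  then show "\<Gamma> \<turnstile> hasSection X Y f \<Colon> Type" by (simp add: hasSection_def)
qed

lemma hasRetraction_types: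
  assumes [simp]: "\<Gamma> \<turnstile> X \<Colon> Type" "\<Gamma> \<turnstile> Y \<Colon> Type" and f: "\<Gamma> \<turnstile> f \<Colon> Arr X Y"
  shows "Arr Y X # \<Gamma> \<turnstile> Pi (wk 1 X) (Eq (wk 2 X) (App (Var 1) (App (wk 2 f) (Var 0))) (Var 0)) \<Colon>
    Type"
    and "\<Gamma> \<turnstile> hasRetraction X Y f \<Colon> Type"
proof -
  note [simp] = ty
  let ?D = "wk 1 X # Arr Y X # \<Gamma>"
  have "?D \<turnstile> App (Var 1) (App (wk 2 f) (Var 0)) \<Colon> wk 2 X"
  proof (rule App_Arr)
    show "?D \<turnstile> Var 1 \<Colon> Pi (wk 2 Y) (subst (wk 2 X) (sh (Suc 0)))"
      by simp
    show "?D \<turnstile> App (wk 2 f) (Var 0) \<Colon> wk 2 Y"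
      using wk2_has_type[OF f _ _ refl, of "Arr Y X" "wk 1 X"]
      by (intro App_Arr[where A = "wk 2 X"]) simp_all
  qed
  then show "Arr Y X # \<Gamma> \<turnstile> Pi (wk 1 X) (Eq (wk 2 X) (App (Var 1) (App (wk 2 f) (Var 0))) (Var 0))
    \<Colon> Type"
    by simp
  then show "\<Gamma> \<turnstile> hasRetraction X Y f \<Colon> Type"
    by (simp add: hasRetraction_def)
qed

text \<open>The map from homotopies to paths is the underlying function of the section of
  \<open>happly\<close>, reached by two first projections from the axiom.\<close>

lemma funext:
  assumes A[simp]: "\<Gamma> \<turnstile> A \<Colon> Type" and B: "A # \<Gamma> \<turnstile> B \<Colon> Type" and f: "\<Gamma> \<turnstile> f \<Colon> Pi A B" and g: "\<Gamma> \<turnstile> g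
    \<Colon> Pi A B"
    and h: "inh \<Gamma> (Htpy A B f g)"
  shows "inh \<Gamma> (Eq (Pi A B) f g)"
proof -
  note h' = Htpy_type[OF A B f g] happly_type[OF A B f g]
  let ?X = "Eq (Pi A B) f g" and ?Y = "Htpy A B f g"
  have X: "\<Gamma> \<turnstile> ?X \<Colon> Type" and Y: "\<Gamma> \<turnstile> ?Y \<Colon> Type" using A B f g h' by (simp_all add: ty)
  have s: "\<Gamma> \<turnstile> hasSection ?X ?Y (happly A B f g) \<Colon> Type"
    and r: "\<Gamma> \<turnstile> hasRetraction ?X ?Y (happly A B f g) \<Colon> Type" using hasSection_types(2)
      hasRetraction_types(2) h' X Y by simp_all
  have "inh \<Gamma> (isEquiv ?X ?Y (happly A B f g))"
    using FunExt_intro[OF A B f g] by (rule inhI)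
  then have *: "inh \<Gamma> (hasSection ?X ?Y (happly A B f g))"
    unfolding isEquiv_def Prod_def
    by (rule inh_fst[rotated 2]) (use s r wk1_has_type[OF r s refl] in simp_all)
  have "\<Gamma> \<turnstile> Arr ?Y ?X \<Colon> Type"
    using X Y wk1_has_type[OF X Y refl] by (simp add: ty)
  with * have "inh \<Gamma> (Arr ?Y ?X)"
    unfolding hasSection_def by (rule inh_fst[rotated 2]) (rule hasSection_types(1)[OF X Y h'(2)])
  then obtain k where k: "\<Gamma> \<turnstile> k \<Colon> Arr ?Y ?X" by (auto simp: inh_def)
  obtain h where h: "\<Gamma> \<turnstile> h \<Colon> ?Y" using h by (auto simp: inh_def)
  show ?thesis using App_Arr[of \<Gamma> k ?Y ?X h] k h by (auto intro: inhI)
qed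

lemma isProp_Pi:
  assumes A[simp]: "\<Gamma> \<turnstile> A \<Colon> Type" and B: "A # \<Gamma> \<turnstile> B \<Colon> Type" and p: "inh (A # \<Gamma>) (isProp B)"
  shows "inh \<Gamma> (isProp (Pi A B))"
proof -
  note [simp] = B
  obtain q where q: "A # \<Gamma> \<turnstile> q \<Colon> isProp B" using p by (auto simp: inh_def)
  have P: "\<Gamma> \<turnstile> Pi A B \<Colon> Type" by (simp add: ty)
  have P1: "Pi A B # \<Gamma> \<turnstile> wk 1 (Pi A B) \<Colon> Type" using wk1_has_type[OF P P refl] by simp
  let ?D = "wk 1 (Pi A B) # Pi A B # \<Gamma>"
  have P2: "?D \<turnstile> wk 2 (Pi A B) \<Colon> Type" using wk2_has_type[OF P P P1 refl] by simp
  have A2: "?D \<turnstile> wk 2 A \<Colon> Type" using wk2_has_type[OF A P P1 refl] by simp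
  have B2: "wk 2 A # ?D \<turnstile> shift 2 1 B \<Colon> Type" using lift2_has_type[OF B A P1] by simp
  have v: "?D \<turnstile> Var 1 \<Colon> Pi (wk 2 A) (shift 2 1 B)" "?D \<turnstile> Var 0 \<Colon> Pi (wk 2 A) (shift 2 1 B)"
    using P P1 by (auto intro!: var_type simp: ctx_cons_iff)
  have q2: "wk 2 A # ?D \<turnstile> shift 2 1 q \<Colon> isProp (shift 2 1 B)"
    using lift2_has_type[OF q A P1] by simp
  have "wk 2 A # ?D \<turnstile> App (App (shift 2 1 q) (App (wk 1 (Var 1)) (Var 0))) (App (wk 1 (Var 0))
    (Var 0))
    \<Colon> Eq (shift 2 1 B) (App (wk 1 (Var 1)) (Var 0)) (App (wk 1 (Var 0)) (Var 0))"
    using App_wk_Var[OF A2 v(1)] App_wk_Var[OF A2 v(2)] by (intro isPropD[OF q2]) simp_all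
  then have "inh ?D (Htpy (wk 2 A) (shift 2 1 B) (Var 1) (Var 0))"
    unfolding Htpy_def
    by (intro inhI[OF Lam_intro[OF A2]])
      (use App_wk_Var[OF A2 v(1)] App_wk_Var[OF A2 v(2)] B2 in \<open>simp_all add: ty\<close>)
  from funext[OF A2 B2 v this] have "inh ?D (Eq (wk 2 (Pi A B)) (Var 1) (Var 0))" by simp
  moreover have "?D \<turnstile> Eq (wk 2 (Pi A B)) (Var 1) (Var 0) \<Colon> Type" using P2 v by (simp add: ty)
  ultimately show ?thesis
    unfolding isProp_def using P P1
    by (intro inh_Lam) (simp_all add: ty)
qed

text \<open>The two proofs to be compared are in the context, and the later one makes the identity
  types of \<open>T\<close> propositions. The iterated product \<open>isProp T\<close> over them is
  then a proposition, which gives the path between the two proofs.\<close>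

lemma isProp_isProp:
  assumes T[simp]: "\<Gamma> \<turnstile> T \<Colon> Type"
  shows "inh \<Gamma> (isProp (isProp T))"
proof -
  note [simp] = isProp_type ty
  let ?D = "isProp (wk 1 T) # isProp T # \<Gamma>"
  have T2: "?D \<turnstile> wk 2 T \<Colon> Type" by simp
  have D: "inh ?D (isProp (wk 2 T))" by (rule inhI[of _ "Var 0"]) simp
  have E: "wk 3 T # wk 2 T # ?D \<turnstile> Eq (wk 4 T) (Var 1) (Var 0) \<Colon> Type"
    using wk2_has_type[OF T2 T2 _ refl, of "wk 3 T"] wk1_has_type[OF T2 T2 refl] by simp
  have T3: "wk 2 T # ?D \<turnstile> wk 3 T \<Colon> Type"  using wk1_has_type[OF T2 T2 refl] by simp
  have T4: "wk 3 T # wk 2 T # ?D \<turnstile> wk 4 T \<Colon> Type"  using wk1_has_type[OF T3 T3 refl] by simp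
  have p4: "inh (wk 3 T # wk 2 T # ?D) (isProp (wk 4 T))"
    by (rule inhI[of _ "Var 2"]) (use T2 T3 T4 in simp)
  have "inh (wk 3 T # wk 2 T # ?D) (isProp (Eq (wk 4 T) (Var 1) (Var 0)))"
    by (rule isProp_Eq[OF T4 p4]) (use T2 T3 T4 in simp_all)
  from isProp_Pi[OF T3 E this] have "inh (wk 2 T # ?D) (isProp (Pi (wk 3 T) (Eq (wk 4 T) (Var 1)
    (Var 0))))" .
  from isProp_Pi[OF T2 _ this] E T3 have "inh ?D (isProp (isProp (wk 2 T)))"
    by (simp add: isProp_def)
  then obtain t where "?D \<turnstile> t \<Colon> isProp (isProp (wk 2 T))" by (auto simp: inh_def)
  from isPropD[OF this, of "Var 1" "Var 0"] have "inh ?D (Eq (isProp (wk 2 T)) (Var 1) (Var 0))"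
    by (auto intro: inhI)
  then show ?thesis
    unfolding isProp_def[of "isProp T"] by (auto intro!: inh_Lam)
qed

section \<open>Stability of the constructions under substitution\<close>

lemma subst_idfun[simp]: "subst (idfun A) \<sigma> = idfun (subst A \<sigma>)"
  by (simp add: idfun_def)

lemma subst_fstMap[simp]: "subst (fstMap P Q) \<sigma> = fstMap (subst P \<sigma>) (subst Q \<sigma>)"
  by (simp add: fstMap_def)

lemma subst_sndMap[simp]: "subst (sndMap P Q) \<sigma> = sndMap (subst P \<sigma>) (subst Q \<sigma>)"
  by (simp add: sndMap_def)

lemma subst_pushSrc[simp]:
  "subst (pushSrc S P Q f) \<sigma> = pushSrc (subst S \<sigma>) (subst P \<sigma>) (subst Q \<sigma>) (subst f \<sigma>)"
  by (simp add: pushSrc_def)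

lemma subst_pushTgt[simp]:
  "subst (pushTgt S P Q f) \<sigma> = pushTgt (subst S \<sigma>) (subst P \<sigma>) (subst Q \<sigma>) (subst f \<sigma>)"
  by (simp add: pushTgt_def)

lemma subst_Join[simp]: "subst (Join P Q) \<sigma> = Join (subst P \<sigma>) (subst Q \<sigma>)"
  by (simp add: Join_def Pushout_def)

lemma subst_joinInr[simp]: "subst (joinInr P Q) \<sigma> = joinInr (subst P \<sigma>) (subst Q \<sigma>)"
  by (simp add: joinInr_def pushInr_def)

lemma subst_joinPow1[simp]: "subst (joinPow1 A n) \<sigma> = joinPow1 (subst A \<sigma>) (subst n \<sigma>)"
  by (simp add: joinPow1_def)

lemma subst_stage[simp]: "subst (stage A n) \<sigma> = stage (subst A \<sigma>) (subst n \<sigma>)"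
  by (simp add: stage_def)

lemma subst_stageMap[simp]: "subst (stageMap A n) \<sigma> = stageMap (subst A \<sigma>) (subst n \<sigma>)"
  by (simp add: stageMap_def)

lemma subst_Trunc[simp]: "subst (Trunc A) \<sigma> = Trunc (subst A \<sigma>)"
  by (simp add: Trunc_def SeqColim_def seqNext_def)

lemma Pi_beta_eq:
  "\<lbrakk>A # \<Gamma> \<turnstile> B \<Colon> Type; A # \<Gamma> \<turnstile> b \<Colon> B; \<Gamma> \<turnstile> a \<Colon> A; t = sub a b; C = sub a B\<rbrakk> \<Longrightarrow> \<Gamma> \<turnstile> App (Lam A b) a \<doteq>
    t \<Colon> C"
  using Pi_beta by simp

section \<open>Joins\<close>

text \<open>The body is typed separately because the beta rule asks for its derivation. The same
  split recurs for the other maps given by abstractions.\<close>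

lemma fstMap_type:
  assumes [simp]: "\<Gamma> \<turnstile> P \<Colon> Type" "\<Gamma> \<turnstile> Q \<Colon> Type"
  shows "Prod P Q # \<Gamma> \<turnstile> SigInd (wk 1 P) (wk 2 Q) (wk 2 P) (Var 1) (Var 0) \<Colon> wk 1 P"
    and "\<Gamma> \<turnstile> fstMap P Q \<Colon> Arr (Prod P Q) P"
proof -
  note [simp] = ty
  show "Prod P Q # \<Gamma> \<turnstile> SigInd (wk 1 P) (wk 2 Q) (wk 2 P) (Var 1) (Var 0) \<Colon> wk 1 P"
    using Sig_elim[of "wk 1 P" "wk 2 Q" "Prod P Q # \<Gamma>" "wk 2 P" "Var 1" "Var 0"] by simp
  then show "\<Gamma> \<turnstile> fstMap P Q \<Colon> Arr (Prod P Q) P"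
    by (simp add: fstMap_def)
qed

lemma sndMap_type:
  assumes [simp]: "\<Gamma> \<turnstile> P \<Colon> Type" "\<Gamma> \<turnstile> Q \<Colon> Type"
  shows "Prod P Q # \<Gamma> \<turnstile> SigInd (wk 1 P) (wk 2 Q) (wk 2 Q) (Var 0) (Var 0) \<Colon> wk 1 Q"
    and "\<Gamma> \<turnstile> sndMap P Q \<Colon> Arr (Prod P Q) Q"
proof -
  note [simp] = ty
  show "Prod P Q # \<Gamma> \<turnstile> SigInd (wk 1 P) (wk 2 Q) (wk 2 Q) (Var 0) (Var 0) \<Colon> wk 1 Q"
    using Sig_elim[of "wk 1 P" "wk 2 Q" "Prod P Q # \<Gamma>" "wk 2 Q" "Var 0" "Var 0"] by simp
  then show "\<Gamma> \<turnstile> sndMap P Q \<Colon> Arr (Prod P Q) Q"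
    by (simp add: sndMap_def)
qed

lemma fstMap_beta:
  assumes [simp]: "\<Gamma> \<turnstile> P \<Colon> Type" "\<Gamma> \<turnstile> Q \<Colon> Type" "\<Gamma> \<turnstile> a \<Colon> P" "\<Gamma> \<turnstile> b \<Colon> Q"
  shows "\<Gamma> \<turnstile> App (fstMap P Q) (Pair P (wk 1 Q) a b) \<doteq> a \<Colon> P"
proof -
  note [simp] = ty
  have "\<Gamma> \<turnstile> App (fstMap P Q) (Pair P (wk 1 Q) a b) \<doteq> SigInd P (wk 1 Q) (wk 1 P) (Var 1) (Pair P
    (wk 1 Q) a b) \<Colon> P"
    unfolding fstMap_def by (rule Pi_beta_eq[OF _ fstMap_type(1)]) simp_all
  moreover have "\<Gamma> \<turnstile> SigInd P (wk 1 Q) (wk 1 P) (Var 1) (Pair P (wk 1 Q) a b) \<doteq> a \<Colon> P"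
    using Sig_beta[of P "wk 1 Q" \<Gamma> "wk 1 P" "Var 1" a b] by simp
  ultimately show ?thesis by (rule jeq_trans)
qed

lemma sndMap_beta:
  assumes [simp]: "\<Gamma> \<turnstile> P \<Colon> Type" "\<Gamma> \<turnstile> Q \<Colon> Type" "\<Gamma> \<turnstile> a \<Colon> P" "\<Gamma> \<turnstile> b \<Colon> Q"
  shows "\<Gamma> \<turnstile> App (sndMap P Q) (Pair P (wk 1 Q) a b) \<doteq> b \<Colon> Q"
proof -
  note [simp] = ty
  have "\<Gamma> \<turnstile> App (sndMap P Q) (Pair P (wk 1 Q) a b) \<doteq> SigInd P (wk 1 Q) (wk 1 Q) (Var 0) (Pair P
    (wk 1 Q) a b) \<Colon> Q"
    unfolding sndMap_def by (rule Pi_beta_eq[OF _ sndMap_type(1)]) simp_all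
  moreover have "\<Gamma> \<turnstile> SigInd P (wk 1 Q) (wk 1 Q) (Var 0) (Pair P (wk 1 Q) a b) \<doteq> b \<Colon> Q"
    using Sig_beta[of P "wk 1 Q" \<Gamma> "wk 1 Q" "Var 0" a b] by simp
  ultimately show ?thesis by (rule jeq_trans)
qed

abbreviation "joinSrc P Q \<equiv> pushSrc (Prod P Q) P Q (fstMap P Q)"
abbreviation "joinTgt P Q \<equiv> pushTgt (Prod P Q) P Q (sndMap P Q)"
definition "joinPt P Q v = CPt (Prod P Q) (Sum P Q) (joinSrc P Q) (joinTgt P Q) v"

lemma subst_joinPt[simp]: "subst (joinPt P Q v) \<sigma> = joinPt (subst P \<sigma>) (subst Q \<sigma>) (subst v \<sigma>)"
  by (simp add: joinPt_def)

lemma joinSrc_type: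
  assumes [simp]: "\<Gamma> \<turnstile> P \<Colon> Type" "\<Gamma> \<turnstile> Q \<Colon> Type"
  shows "Prod P Q # \<Gamma> \<turnstile> InL (wk 1 P) (wk 1 Q) (App (wk 1 (fstMap P Q)) (Var 0)) \<Colon> wk 1 (Sum P Q)"
    and "\<Gamma> \<turnstile> joinSrc P Q \<Colon> Arr (Prod P Q) (Sum P Q)"
proof -
  note [simp] = ty
  have "Prod P Q # \<Gamma> \<turnstile> App (wk 1 (fstMap P Q)) (Var 0) \<Colon> wk 1 P"
    using App_wk_Var[of \<Gamma> "Prod P Q" "fstMap P Q" "wk 1 P"] fstMap_type(2)[of \<Gamma> P Q] by simp
  then show "Prod P Q # \<Gamma> \<turnstile> InL (wk 1 P) (wk 1 Q) (App (wk 1 (fstMap P Q)) (Var 0)) \<Colon> wk 1 (Sum P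
    Q)" by simp
  then show "\<Gamma> \<turnstile> joinSrc P Q \<Colon> Arr (Prod P Q) (Sum P Q)" by (simp add: pushSrc_def)
qed

lemma joinTgt_type:
  assumes [simp]: "\<Gamma> \<turnstile> P \<Colon> Type" "\<Gamma> \<turnstile> Q \<Colon> Type"
  shows "Prod P Q # \<Gamma> \<turnstile> InR (wk 1 P) (wk 1 Q) (App (wk 1 (sndMap P Q)) (Var 0)) \<Colon> wk 1 (Sum P Q)"
    and "\<Gamma> \<turnstile> joinTgt P Q \<Colon> Arr (Prod P Q) (Sum P Q)"
proof -
  note [simp] = ty
  have "Prod P Q # \<Gamma> \<turnstile> App (wk 1 (sndMap P Q)) (Var 0) \<Colon> wk 1 Q"
    using App_wk_Var[of \<Gamma> "Prod P Q" "sndMap P Q" "wk 1 Q"] sndMap_type(2)[of \<Gamma> P Q] by simp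
  then show "Prod P Q # \<Gamma> \<turnstile> InR (wk 1 P) (wk 1 Q) (App (wk 1 (sndMap P Q)) (Var 0)) \<Colon> wk 1 (Sum P
    Q)" by simp
  then show "\<Gamma> \<turnstile> joinTgt P Q \<Colon> Arr (Prod P Q) (Sum P Q)" by (simp add: pushTgt_def)
qed

lemma Join_type:
  assumes "\<Gamma> \<turnstile> P \<Colon> U" "\<Gamma> \<turnstile> Q \<Colon> U"
  shows "\<Gamma> \<turnstile> Join P Q \<Colon> U"
  unfolding Join_def Pushout_def
  by (rule Coeq_form) (use assms joinSrc_type[of \<Gamma> P Q] joinTgt_type[of \<Gamma> P Q] U_El[OF assms(1)]
    U_El[OF assms(2)] in \<open>simp_all add: ty\<close>)

lemma joinPt_type:
  assumes "\<Gamma> \<turnstile> P \<Colon> U" "\<Gamma> \<turnstile> Q \<Colon> U" "\<Gamma> \<turnstile> v \<Colon> Sum P Q"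
  shows "\<Gamma> \<turnstile> joinPt P Q v \<Colon> Join P Q"
  using CPt_intro[OF Join_type[OF assms(1,2), unfolded Join_def Pushout_def] assms(3)]
  by (simp add: joinPt_def Join_def Pushout_def)

lemma joinPt_cong:
  assumes "\<Gamma> \<turnstile> P \<Colon> U" "\<Gamma> \<turnstile> Q \<Colon> U" "\<Gamma> \<turnstile> v \<doteq> v' \<Colon> Sum P Q"
  shows "\<Gamma> \<turnstile> joinPt P Q v \<doteq> joinPt P Q v' \<Colon> Join P Q"
  unfolding joinPt_def Join_def Pushout_def using assms joinSrc_type[of \<Gamma> P Q] joinTgt_type[of \<Gamma> P
    Q] U_El[OF assms(1)] U_El[OF assms(2)]
  by (intro CPt_cong jeq_refl) (simp_all add: ty)

lemma joinInr_type:
  assumes [simp]: "\<Gamma> \<turnstile> P \<Colon> U" "\<Gamma> \<turnstile> Q \<Colon> U"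
  shows "\<Gamma> \<turnstile> joinInr P Q \<Colon> Arr Q (Join P Q)"
    and "\<Gamma> \<turnstile> b \<Colon> Q \<Longrightarrow> \<Gamma> \<turnstile> App (joinInr P Q) b \<doteq> joinPt P Q (InR P Q b) \<Colon> Join P Q"
proof -
  note [simp] = ty Join_type joinPt_type U_El[OF Join_type] U_El[OF assms(1)] U_El[OF assms(2)]
  have *: "Q # \<Gamma> \<turnstile> joinPt (wk 1 P) (wk 1 Q) (InR (wk 1 P) (wk 1 Q) (Var 0)) \<Colon> wk 1 (Join P Q)" by
    simp
  show "\<Gamma> \<turnstile> joinInr P Q \<Colon> Arr Q (Join P Q)"
    using * unfolding joinInr_def pushInr_def joinPt_def by (simp add: Lam_intro)
  assume b: "\<Gamma> \<turnstile> b \<Colon> Q"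
  show "\<Gamma> \<turnstile> App (joinInr P Q) b \<doteq> joinPt P Q (InR P Q b) \<Colon> Join P Q"
    using Pi_beta[OF _ * b] unfolding joinInr_def pushInr_def joinPt_def by simp
qed

text \<open>The generating path at the pair of \<open>a\<close> and \<open>b\<close>, with endpoints
  reduced by the beta rules of the projections. The right endpoint is kept as a value of
  \<open>joinInr\<close>, the map to which \<open>stageMap\<close> reduces at successors.\<close>

lemma join_glue:
  assumes [simp]: "\<Gamma> \<turnstile> P \<Colon> U" "\<Gamma> \<turnstile> Q \<Colon> U" "\<Gamma> \<turnstile> a \<Colon> P" "\<Gamma> \<turnstile> b \<Colon> Q"
  shows "inh \<Gamma> (Eq (Join P Q) (joinPt P Q (InL P Q a)) (App (joinInr P Q) b))"
proof -
  note [simp] = ty Join_type joinPt_type U_El[OF Join_type] U_El[OF assms(1)] U_El[OF assms(2)]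
  let ?p = "Pair P (wk 1 Q) a b"
  have p[simp]: "\<Gamma> \<turnstile> ?p \<Colon> Prod P Q" by simp
  have s: "\<Gamma> \<turnstile> App (joinSrc P Q) ?p \<doteq> InL P Q (App (fstMap P Q) ?p) \<Colon> Sum P Q"
    unfolding pushSrc_def by (rule Pi_beta_eq[OF _ joinSrc_type(1)]) simp_all
  have s': "\<Gamma> \<turnstile> InL P Q (App (fstMap P Q) ?p) \<doteq> InL P Q a \<Colon> Sum P Q"
    by (intro InL_cong jeq_refl fstMap_beta) simp_all
  have t: "\<Gamma> \<turnstile> App (joinTgt P Q) ?p \<doteq> InR P Q (App (sndMap P Q) ?p) \<Colon> Sum P Q"
    unfolding pushTgt_def by (rule Pi_beta_eq[OF _ joinTgt_type(1)]) simp_all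
  have t': "\<Gamma> \<turnstile> InR P Q (App (sndMap P Q) ?p) \<doteq> InR P Q b \<Colon> Sum P Q"
    by (intro InR_cong jeq_refl sndMap_beta) simp_all
  have g: "\<Gamma> \<turnstile> CGlue (Prod P Q) (Sum P Q) (joinSrc P Q) (joinTgt P Q) ?p
    \<Colon> Eq (Join P Q) (joinPt P Q (App (joinSrc P Q) ?p)) (joinPt P Q (App (joinTgt P Q) ?p))"
    using CGlue_intro[OF Join_type[of \<Gamma> P Q, unfolded Join_def Pushout_def] p]
    by (simp add: joinPt_def Join_def Pushout_def)
  show ?thesis
    by (rule inhI, rule Eq_conv[OF _ g joinPt_cong[OF _ _ jeq_trans[OF s s']]
        jeq_trans[OF joinPt_cong[OF _ _ jeq_trans[OF t t']] jeq_sym[OF joinInr_type(2)]]]) simp_all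
qed

section \<open>Join powers\<close>

text \<open>Recursion with constant motive \<open>U\<close>, possible because joins stay in the
  universe.\<close>

lemma joinPow1_type: "\<lbrakk>\<Gamma> \<turnstile> A \<Colon> U; \<Gamma> \<turnstile> n \<Colon> Nat\<rbrakk> \<Longrightarrow> \<Gamma> \<turnstile> joinPow1 A n \<Colon> U"
  unfolding joinPow1_def using Nat_elim[of \<Gamma> U A "Join (wk 2 A) (Var 0)" n]
  by (simp add: ty Join_type ctx_if_has_type)

lemma joinPow1_Zero: "\<Gamma> \<turnstile> A \<Colon> U \<Longrightarrow> \<Gamma> \<turnstile> joinPow1 A Zero \<doteq> A \<Colon> U"
  unfolding joinPow1_def using Nat_beta_Zero[of \<Gamma> U A "Join (wk 2 A) (Var 0)"]
  by (simp add: ty Join_type ctx_if_has_type)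

lemma joinPow1_Succ: "\<lbrakk>\<Gamma> \<turnstile> A \<Colon> U; \<Gamma> \<turnstile> n \<Colon> Nat\<rbrakk> \<Longrightarrow> \<Gamma> \<turnstile> joinPow1 A (Succ n) \<doteq> Join A (joinPow1 A n) \<Colon>
    U"
  unfolding joinPow1_def using Nat_beta_Succ[of \<Gamma> U A "Join (wk 2 A) (Var 0)" n]
  by (simp add: ty Join_type ctx_if_has_type)

lemma stage_type: "\<lbrakk>\<Gamma> \<turnstile> A \<Colon> U; \<Gamma> \<turnstile> n \<Colon> Nat\<rbrakk> \<Longrightarrow> \<Gamma> \<turnstile> stage A n \<Colon> U"
  unfolding stage_def using Nat_elim[of \<Gamma> U Empty "joinPow1 (wk 2 A) (Var 1)" n]
  by (simp add: ty joinPow1_type ctx_if_has_type)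

lemma stage_Zero: "\<Gamma> \<turnstile> A \<Colon> U \<Longrightarrow> \<Gamma> \<turnstile> stage A Zero \<doteq> Empty \<Colon> U"
  unfolding stage_def using Nat_beta_Zero[of \<Gamma> U Empty "joinPow1 (wk 2 A) (Var 1)"]
  by (simp add: ty joinPow1_type ctx_if_has_type)

lemma stage_Succ: "\<lbrakk>\<Gamma> \<turnstile> A \<Colon> U; \<Gamma> \<turnstile> n \<Colon> Nat\<rbrakk> \<Longrightarrow> \<Gamma> \<turnstile> stage A (Succ n) \<doteq> joinPow1 A n \<Colon> U"
  unfolding stage_def using Nat_beta_Succ[of \<Gamma> U Empty "joinPow1 (wk 2 A) (Var 1)" n]
  by (simp add: ty joinPow1_type ctx_if_has_type)

lemma stage_one: "\<Gamma> \<turnstile> A \<Colon> U \<Longrightarrow> \<Gamma> \<turnstile> stage A (Succ Zero) \<doteq> A \<Colon> U"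
  by (rule jeq_trans[OF stage_Succ joinPow1_Zero]) (simp_all add: ty)

lemma stage_Succ_Succ:
  "\<lbrakk>\<Gamma> \<turnstile> A \<Colon> U; \<Gamma> \<turnstile> n \<Colon> Nat\<rbrakk> \<Longrightarrow> \<Gamma> \<turnstile> stage A (Succ (Succ n)) \<doteq> Join A (joinPow1 A n) \<Colon> U"
  by (rule jeq_trans[OF stage_Succ joinPow1_Succ]) (simp_all add: ty)

lemma Arr_cong:
  assumes "\<Gamma> \<turnstile> A \<doteq> A' \<Colon> Type" "\<Gamma> \<turnstile> A \<Colon> Type" "\<Gamma> \<turnstile> B \<doteq> B' \<Colon> Type"
  shows "\<Gamma> \<turnstile> Arr A B \<doteq> Arr A' B' \<Colon> Type"
  using jeq_wk1[OF assms(3), of A] assms(1,2) by (auto intro!: Pi_cong simp: ctx_cons_iff)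

text \<open>The two cases naturally have domain and codomain given by \<open>Empty\<close>,
  \<open>A\<close> and joins. Conversion along the computation rules of \<open>stage\<close> brings
  them to the types that recursion demands. Typing and computation of \<open>stageMap\<close> share
  these premises.\<close>

lemma stageMap_types:
  assumes [simp]: "\<Gamma> \<turnstile> A \<Colon> U"
  shows "Nat # \<Gamma> \<turnstile> Arr (stage (wk 1 A) (Var 0)) (stage (wk 1 A) (Succ (Var 0))) \<Colon> Type"
    "\<Gamma> \<turnstile> Lam Empty (EmptyInd (wk 2 A) (Var 0)) \<Colon> Arr (stage A Zero) (stage A (Succ Zero))"
    "Arr (stage (wk 1 A) (Var 0)) (stage (wk 1 A) (Succ (Var 0))) # Nat # \<Gamma> \<turnstile>
      joinInr (wk 2 A) (joinPow1 (wk 2 A) (Var 1)) \<Colon> Arr (stage (wk 2 A) (Succ (Var 1))) (stage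
        (wk 2 A) (Succ (Succ (Var 1))))"
proof -
  note [simp] = ty ctx_if_has_type[OF assms] joinPow1_type stage_type U_El[OF assms] U_El[OF
    joinPow1_type] U_El[OF stage_type]
  show 1: "Nat # \<Gamma> \<turnstile> Arr (stage (wk 1 A) (Var 0)) (stage (wk 1 A) (Succ (Var 0))) \<Colon> Type" by simp
  have "\<Gamma> \<turnstile> Lam Empty (EmptyInd (wk 2 A) (Var 0)) \<Colon> Arr Empty A"
    using Empty_elim[of "Empty # \<Gamma>" "wk 2 A" "Var 0"] by simp
  then show "\<Gamma> \<turnstile> Lam Empty (EmptyInd (wk 2 A) (Var 0)) \<Colon> Arr (stage A Zero) (stage A (Succ Zero))"
    by (rule conv) (intro Arr_cong U_El_cong jeq_sym[OF stage_Zero] jeq_sym[OF stage_one]; simp)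
  show "Arr (stage (wk 1 A) (Var 0)) (stage (wk 1 A) (Succ (Var 0))) # Nat # \<Gamma> \<turnstile>
      joinInr (wk 2 A) (joinPow1 (wk 2 A) (Var 1)) \<Colon> Arr (stage (wk 2 A) (Succ (Var 1))) (stage
        (wk 2 A) (Succ (Succ (Var 1))))"
    \<comment> \<open>The arrow types must stay folded here for \<open>Arr_cong\<close> to
      apply.\<close>
    by (rule conv[OF joinInr_type(1)])
     (use 1 in \<open>simp_all del: Arr_def add: Arr_cong U_El_cong jeq_sym[OF stage_Succ] jeq_sym[OF
       stage_Succ_Succ]\<close>)
qed

lemma stageMap_type:
  assumes [simp]: "\<Gamma> \<turnstile> A \<Colon> U" "\<Gamma> \<turnstile> n \<Colon> Nat"
  shows "\<Gamma> \<turnstile> stageMap A n \<Colon> Arr (stage A n) (stage A (Succ n))"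
  unfolding stageMap_def using Nat_elim[OF stageMap_types(1)[of \<Gamma> A] _ _ assms(2), of "Lam Empty
    (EmptyInd (wk 2 A) (Var 0))" "joinInr (wk 2 A) (joinPow1 (wk 2 A) (Var 1))"]
      stageMap_types(2,3)[of \<Gamma> A] by simp

lemma stageMap_Succ:
  assumes [simp]: "\<Gamma> \<turnstile> A \<Colon> U" "\<Gamma> \<turnstile> n \<Colon> Nat"
  shows "\<Gamma> \<turnstile> stageMap A (Succ n) \<doteq> joinInr A (joinPow1 A n) \<Colon> Arr (stage A (Succ n)) (stage A
    (Succ (Succ n)))"
  unfolding stageMap_def using Nat_beta_Succ[OF stageMap_types(1)[of \<Gamma> A] _ _ assms(2), of "Lam
    Empty (EmptyInd (wk 2 A) (Var 0))" "joinInr (wk 2 A) (joinPow1 (wk 2 A) (Var 1))"]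
      stageMap_types(2,3)[of \<Gamma> A] by simp

lemma jeq_App_Arr: "\<lbrakk>\<Gamma> \<turnstile> f \<doteq> f' \<Colon> Arr A B; \<Gamma> \<turnstile> a \<doteq> a' \<Colon> A\<rbrakk> \<Longrightarrow> \<Gamma> \<turnstile> App f a \<doteq> App f' a' \<Colon> B"
  using App_cong[of \<Gamma> f f' A "wk 1 B" a a'] by simp

lemma stageMap_App: "\<lbrakk>\<Gamma> \<turnstile> A \<Colon> U; \<Gamma> \<turnstile> n \<Colon> Nat; \<Gamma> \<turnstile> x \<Colon> stage A n\<rbrakk> \<Longrightarrow> \<Gamma> \<turnstile> App (stageMap A n) x \<Colon>
    stage A (Succ n)"
  using stageMap_type[of \<Gamma> A n] by (auto intro: App_Arr)

section \<open>Base points of the stages and null-homotopies of the transition maps\<close>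

lemma inh_Nat:
  assumes "Nat # \<Gamma> \<turnstile> C \<Colon> Type" "inh \<Gamma> (sub Zero C)" "inh (C # Nat # \<Gamma>) (inst 2 (Succ (Var 1)) C)"
    "\<Gamma> \<turnstile> n \<Colon> Nat"
  shows "inh \<Gamma> (sub n C)"
  using Nat_elim[OF assms(1) _ _ assms(4)] assms(2,3) unfolding inh_def by blast

lemma inh_Empty:
  assumes "\<Gamma> \<turnstile> C \<Colon> Type" "\<Gamma> \<turnstile> e \<Colon> Empty"
  shows "inh \<Gamma> C"
  using Empty_elim[of \<Gamma> "wk 1 C" e] assms ctx_if_has_type[OF assms(1)] by (auto simp: ty intro:
    inhI)

text \<open>A recursion is needed because the point has a different shape at the first index:
  \<open>a\<close> in \<open>A\<close>, and the left inclusion of \<open>a\<close> in every later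
  join.\<close>

definition basePt :: "tm \<Rightarrow> tm \<Rightarrow> tm \<Rightarrow> tm" where
  "basePt A a n = NatInd (stage (wk 1 A) (Succ (Var 0))) a
     (joinPt (wk 2 A) (joinPow1 (wk 2 A) (Var 1)) (InL (wk 2 A) (joinPow1 (wk 2 A) (Var 1)) (wk 2
       a))) n"

lemma subst_basePt[simp]: "subst (basePt A a n) \<sigma> = basePt (subst A \<sigma>) (subst a \<sigma>) (subst n \<sigma>)"
  by (simp add: basePt_def)

lemma basePt_types:
  assumes A[simp]: "\<Gamma> \<turnstile> A \<Colon> U" and a[simp]: "\<Gamma> \<turnstile> a \<Colon> A"
  shows "Nat # \<Gamma> \<turnstile> stage (wk 1 A) (Succ (Var 0)) \<Colon> Type"
    "\<Gamma> \<turnstile> a \<Colon> stage A (Succ Zero)"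
    "stage (wk 1 A) (Succ (Var 0)) # Nat # \<Gamma> \<turnstile>
      joinPt (wk 2 A) (joinPow1 (wk 2 A) (Var 1)) (InL (wk 2 A) (joinPow1 (wk 2 A) (Var 1)) (wk 2
        a))
      \<Colon> stage (wk 2 A) (Succ (Succ (Var 1)))"
proof -
  note [simp] = ty ctx_if_has_type[OF A] U_El[OF A] joinPow1_type stage_type U_El[OF
    joinPow1_type] U_El[OF stage_type] joinPt_type
  show 1: "Nat # \<Gamma> \<turnstile> stage (wk 1 A) (Succ (Var 0)) \<Colon> Type" by simp
  show "\<Gamma> \<turnstile> a \<Colon> stage A (Succ Zero)"
    by (rule conv[OF a U_El_cong[OF jeq_sym[OF stage_one[OF A]]]])
  show "stage (wk 1 A) (Succ (Var 0)) # Nat # \<Gamma> \<turnstile>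
      joinPt (wk 2 A) (joinPow1 (wk 2 A) (Var 1)) (InL (wk 2 A) (joinPow1 (wk 2 A) (Var 1)) (wk 2
        a))
      \<Colon> stage (wk 2 A) (Succ (Succ (Var 1)))"
    by (rule conv[OF _ U_El_cong[OF jeq_sym[OF stage_Succ_Succ]]]) (use 1 in simp_all)
qed

lemma basePt_type:
  assumes A[simp]: "\<Gamma> \<turnstile> A \<Colon> U" and a[simp]: "\<Gamma> \<turnstile> a \<Colon> A" and n[simp]: "\<Gamma> \<turnstile> n \<Colon> Nat"
  shows "\<Gamma> \<turnstile> basePt A a n \<Colon> stage A (Succ n)"
  unfolding basePt_def
  using Nat_elim[OF basePt_types(1)[OF A a] _ _ n, of a "joinPt (wk 2 A) (joinPow1 (wk 2 A) (Var
    1)) (InL (wk 2 A) (joinPow1 (wk 2 A) (Var 1)) (wk 2 a))"]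
    basePt_types(2,3)[OF A a] by simp

lemma basePt_Succ:
  assumes A[simp]: "\<Gamma> \<turnstile> A \<Colon> U" and a[simp]: "\<Gamma> \<turnstile> a \<Colon> A" and n[simp]: "\<Gamma> \<turnstile> n \<Colon> Nat"
  shows "\<Gamma> \<turnstile> basePt A a (Succ n) \<doteq> joinPt A (joinPow1 A n) (InL A (joinPow1 A n) a) \<Colon> stage A
    (Succ (Succ n))"
  unfolding basePt_def
  using Nat_beta_Succ[OF basePt_types(1)[OF A a] _ _ n, of a "joinPt (wk 2 A) (joinPow1 (wk 2 A)
    (Var 1)) (InL (wk 2 A) (joinPow1 (wk 2 A) (Var 1)) (wk 2 a))"]
    basePt_types(2,3)[OF A a] by simp

lemma stageMap_null_type:
  assumes A: "\<Gamma> \<turnstile> A \<Colon> U" and a: "\<Gamma> \<turnstile> a \<Colon> A" and n: "\<Gamma> \<turnstile> n \<Colon> Nat" and x: "\<Gamma> \<turnstile> x \<Colon> stage A n"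
  shows "\<Gamma> \<turnstile> Eq (stage A (Succ n)) (basePt A a n) (App (stageMap A n) x) \<Colon> Type"
  using assms U_El[OF stage_type[of \<Gamma> A "Succ n"]] basePt_type[OF A a n] stageMap_App[OF A n x]
  by (simp add: ty)

text \<open>Vacuous, since \<open>x\<close> converts to an element of the empty type.\<close>

lemma stageMap_null_Zero:
  assumes A: "\<Gamma> \<turnstile> A \<Colon> U" and a: "\<Gamma> \<turnstile> a \<Colon> A" and x: "\<Gamma> \<turnstile> x \<Colon> stage A Zero"
  shows "inh \<Gamma> (Eq (stage A (Succ Zero)) (basePt A a Zero) (App (stageMap A Zero) x))"
  by (rule inh_Empty[OF stageMap_null_type conv[OF x U_El_cong[OF stage_Zero]]])
    (use assms ctx_if_has_type[OF A] in \<open>simp_all add: ty\<close>)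

text \<open>By the computation rules of \<open>stage\<close>, \<open>basePt\<close> and
  \<open>stageMap\<close>, the type converts to that of the join glue at \<open>a\<close> and
  \<open>x\<close>.\<close>

lemma stageMap_null_Succ:
  assumes A[simp]: "\<Gamma> \<turnstile> A \<Colon> U" and a[simp]: "\<Gamma> \<turnstile> a \<Colon> A" and n[simp]: "\<Gamma> \<turnstile> n \<Colon> Nat" and x: "\<Gamma> \<turnstile> x \<Colon>
    stage A (Succ n)"
  shows "inh \<Gamma> (Eq (stage A (Succ (Succ n))) (basePt A a (Succ n)) (App (stageMap A (Succ n)) x))"
proof -
  let ?J = "Join A (joinPow1 A n)"
  have x': "\<Gamma> \<turnstile> x \<Colon> joinPow1 A n" by (rule conv[OF x U_El_cong[OF stage_Succ]]) simp_all
  have J: "\<Gamma> \<turnstile> stage A (Succ (Succ n)) \<doteq> ?J \<Colon> Type"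
    by (rule U_El_cong[OF stage_Succ_Succ]) simp_all
  have 1: "\<Gamma> \<turnstile> joinPt A (joinPow1 A n) (InL A (joinPow1 A n) a) \<doteq> basePt A a (Succ n) \<Colon> ?J"
    by (rule jeq_conv[OF jeq_sym[OF basePt_Succ] J]) simp_all
  have 2: "\<Gamma> \<turnstile> App (joinInr A (joinPow1 A n)) x \<doteq> App (stageMap A (Succ n)) x \<Colon> ?J"
    by (rule jeq_conv[OF jeq_App_Arr[OF jeq_sym[OF stageMap_Succ] jeq_refl[OF x]] J]) simp_all
  have "\<Gamma> \<turnstile> Eq ?J (joinPt A (joinPow1 A n) (InL A (joinPow1 A n) a)) (App (joinInr A (joinPow1 A
    n)) x)
    \<doteq> Eq (stage A (Succ (Succ n))) (basePt A a (Succ n)) (App (stageMap A (Succ n)) x) \<Colon> Type"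
    by (rule Eq_cong[OF _ jeq_sym[OF J] 1 2]) simp
  with join_glue[OF A joinPow1_type[OF A n] a x'] show ?thesis
    by (rule inh_conv)
qed

lemma stageMap_null:
  assumes A[simp]: "\<Gamma> \<turnstile> A \<Colon> U" and a[simp]: "\<Gamma> \<turnstile> a \<Colon> A" and n[simp]: "\<Gamma> \<turnstile> n \<Colon> Nat"
  shows "inh \<Gamma> (Pi (stage A n) (Eq (stage (wk 1 A) (Succ (wk 1 n))) (basePt (wk 1 A) (wk 1 a) (wk
    1 n))
    (App (stageMap (wk 1 A) (wk 1 n)) (Var 0))))"
proof -
  note [simp] = ty ctx_if_has_type[OF A] U_El[OF A] stage_type U_El[OF stage_type] basePt_type
    stageMap_App
  \<comment> \<open>The point of the stage is quantified inside the motive, as its type depends on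
    the index.\<close>
  define C where "C = Pi (stage (wk 1 A) (Var 0)) (Eq (stage (wk 2 A) (Succ (Var 1))) (basePt (wk
    2 A) (wk 2 a) (Var 1))
    (App (stageMap (wk 2 A) (Var 1)) (Var 0)))"
  have C[simp]: "Nat # \<Gamma> \<turnstile> C \<Colon> Type" by (simp add: C_def)
  have "inh \<Gamma> (sub n C)"
  proof (rule inh_Nat[OF C _ _ n])
    show "inh \<Gamma> (sub Zero C)"
      using stageMap_null_Zero[of "stage A Zero # \<Gamma>" "wk 1 A" "wk 1 a" "Var 0"]
      by (auto simp: C_def intro!: inh_Lam)
    let ?D = "stage (wk 2 A) (Succ (Var 1)) # C # Nat # \<Gamma>"
    have 1: "C # Nat # \<Gamma> \<turnstile> stage (wk 2 A) (Succ (Var 1)) \<Colon> Type" by simp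
    have "?D \<turnstile> wk 3 A \<Colon> U" "?D \<turnstile> wk 3 a \<Colon> wk 3 A" "?D \<turnstile> Var 2 \<Colon> Nat" "?D \<turnstile> Var 0 \<Colon> stage (wk 3 A)
      (Succ (Var 2))"
      using 1 by simp_all
    note * = this
    have "?D \<turnstile> Eq (stage (wk 3 A) (Succ (Succ (Var 2)))) (basePt (wk 3 A) (wk 3 a) (Succ (Var 2)))
      (App (stageMap (wk 3 A) (Succ (Var 2))) (Var 0)) \<Colon> Type"
      by (rule stageMap_null_type) (use * in \<open>simp_all\<close>)
    then show "inh (C # Nat # \<Gamma>) (inst 2 (Succ (Var 1)) C)"
      using stageMap_null_Succ[OF *] 1
      by (auto simp: C_def intro!: inh_Lam)
  qed
  then show ?thesis by (simp add: C_def)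
qed

section \<open>The sequential colimit\<close>

abbreviation "stageTotal A \<equiv> Sig Nat (stage (wk 1 A) (Var 0))"
abbreviation "stagePair A n x \<equiv> Pair Nat (stage (wk 1 A) (Var 0)) n x"
abbreviation "stageNext A \<equiv> seqNext (stage (wk 1 A) (Var 0)) (stageMap (wk 1 A) (Var 0))"

definition "truncPt A v = CPt (stageTotal A) (stageTotal A) (idfun (stageTotal A)) (stageNext A) v"

lemma subst_seqNext[simp]: "subst (seqNext X f) \<sigma> = seqNext (subst X (ups \<sigma>)) (subst f (ups \<sigma>))"
  by (simp add: seqNext_def)

lemma subst_truncPt[simp]: "subst (truncPt A v) \<sigma> = truncPt (subst A \<sigma>) (subst v \<sigma>)"
  by (simp add: truncPt_def)

lemma stageTotal_type: "\<Gamma> \<turnstile> A \<Colon> U \<Longrightarrow> \<Gamma> \<turnstile> stageTotal A \<Colon> U"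
  using ctx_if_has_type[of \<Gamma> A U] by (simp add: ty stage_type)

lemma stageNext_types:
  assumes A[simp]: "\<Gamma> \<turnstile> A \<Colon> U"
  shows "stageTotal A # \<Gamma> \<turnstile> SigInd Nat (stage (wk 2 A) (Var 0)) (wk 2 (stageTotal A))
     (Pair Nat (stage (wk 4 A) (Var 0)) (Succ (Var 1)) (App (stageMap (wk 3 A) (Var 1)) (Var 0)))
       (Var 0) \<Colon> wk 1 (stageTotal A)"
    and "\<Gamma> \<turnstile> stageNext A \<Colon> Arr (stageTotal A) (stageTotal A)"
proof -
  note [simp] = ty ctx_if_has_type[OF A] U_El[OF A] stage_type U_El[OF stage_type] stageTotal_type
    U_El[OF stageTotal_type] stageMap_App
  have 1[simp]: "\<Gamma> \<turnstile> Sig Nat (stage (subst A (sh (Suc 0))) (Var 0)) \<Colon> Type" using U_El[OF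
    stageTotal_type[OF A]] by simp
  have A1[simp]: "stageTotal A # \<Gamma> \<turnstile> wk 1 A \<Colon> U" by simp
  have A3[simp]: "stage (wk 2 A) (Var 0) # Nat # stageTotal A # \<Gamma> \<turnstile> wk 3 A \<Colon> U" by simp
  have A4[simp]: "Nat # stage (wk 2 A) (Var 0) # Nat # stageTotal A # \<Gamma> \<turnstile> wk 4 A \<Colon> U" using
    wk1_has_type[OF A3, of Nat U] by simp
  note [simp] = A4[simplified]
  have "stage (wk 2 A) (Var 0) # Nat # stageTotal A # \<Gamma> \<turnstile> Pair Nat (stage (wk 4 A) (Var 0)) (Succ
    (Var 1)) (App (stageMap (wk 3 A) (Var 1)) (Var 0)) \<Colon> wk 3 (stageTotal A)"
    by simp
  then show *: "stageTotal A # \<Gamma> \<turnstile> SigInd Nat (stage (wk 2 A) (Var 0)) (wk 2 (stageTotal A))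
     (Pair Nat (stage (wk 4 A) (Var 0)) (Succ (Var 1)) (App (stageMap (wk 3 A) (Var 1)) (Var 0)))
       (Var 0) \<Colon> wk 1 (stageTotal A)"
    using Sig_elim[of Nat "stage (wk 2 A) (Var 0)" "stageTotal A # \<Gamma>" "wk 2 (stageTotal A)" _ "Var
      0"]
    by simp
  show "\<Gamma> \<turnstile> stageNext A \<Colon> Arr (stageTotal A) (stageTotal A)"
    using * by (simp add: seqNext_def)
qed

lemma stagePair_type:
  assumes A: "\<Gamma> \<turnstile> A \<Colon> U" and n: "\<Gamma> \<turnstile> n \<Colon> Nat" and x: "\<Gamma> \<turnstile> x \<Colon> stage A n"
  shows "\<Gamma> \<turnstile> stagePair A n x \<Colon> stageTotal A"
proof -
  have "Nat # \<Gamma> \<turnstile> wk 1 A \<Colon> U" using A ctx_if_has_type[OF A] by (simp add: ty)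
  then show ?thesis using assms ctx_if_has_type[OF A] U_El[OF stage_type[of "Nat # \<Gamma>" "wk 1 A"
    "Var 0"]]
    by (auto intro!: Pair_intro simp: ty)
qed

lemma idfun_type:
  assumes [simp]: "\<Gamma> \<turnstile> A \<Colon> Type"
  shows "\<Gamma> \<turnstile> idfun A \<Colon> Arr A A"
    and "\<Gamma> \<turnstile> a \<Colon> A \<Longrightarrow> \<Gamma> \<turnstile> App (idfun A) a \<doteq> a \<Colon> A"
  using Pi_beta[of A \<Gamma> "wk 1 A" "Var 0" a] by (simp_all add: idfun_def ty)

lemma Trunc_eq: "Trunc A = Coeq (stageTotal A) (stageTotal A) (idfun (stageTotal A)) (stageNext A)"
  by (simp add: Trunc_def SeqColim_def)

lemma Trunc_type:
  assumes A: "\<Gamma> \<turnstile> A \<Colon> U"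
  shows "\<Gamma> \<turnstile> Trunc A \<Colon> U"
  unfolding Trunc_eq
  by (rule Coeq_form[OF stageTotal_type[OF A] stageTotal_type[OF A] idfun_type(1)[OF U_El[OF
    stageTotal_type[OF A]]]
        stageNext_types(2)[OF A]])

lemma truncPt_type:
  assumes A: "\<Gamma> \<turnstile> A \<Colon> U" and v: "\<Gamma> \<turnstile> v \<Colon> stageTotal A"
  shows "\<Gamma> \<turnstile> truncPt A v \<Colon> Trunc A"
  unfolding truncPt_def Trunc_eq by (rule CPt_intro[OF Trunc_type[OF A, unfolded Trunc_eq] v])

lemma truncPt_cong:
  assumes A: "\<Gamma> \<turnstile> A \<Colon> U" and v: "\<Gamma> \<turnstile> v \<doteq> v' \<Colon> stageTotal A"
  shows "\<Gamma> \<turnstile> truncPt A v \<doteq> truncPt A v' \<Colon> Trunc A"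
  unfolding truncPt_def Trunc_eq
  by (rule CPt_cong[OF jeq_refl jeq_refl jeq_refl jeq_refl v])
    (intro stageTotal_type idfun_type U_El A stageNext_types)+

definition "truncGlue A v = CGlue (stageTotal A) (stageTotal A) (idfun (stageTotal A)) (stageNext
  A) v"

lemma subst_truncGlue[simp]: "subst (truncGlue A v) \<sigma> = truncGlue (subst A \<sigma>) (subst v \<sigma>)"
  by (simp add: truncGlue_def)

lemma truncGlue_type:
  assumes A: "\<Gamma> \<turnstile> A \<Colon> U" and v: "\<Gamma> \<turnstile> v \<Colon> stageTotal A"
  shows "\<Gamma> \<turnstile> truncGlue A v \<Colon> Eq (Trunc A) (truncPt A (App (idfun (stageTotal A)) v)) (truncPt A
    (App (stageNext A) v))"
  unfolding truncPt_def truncGlue_def Trunc_eq by (rule CGlue_intro[OF Trunc_type[OF A, unfolded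
    Trunc_eq] v])

lemma stageNext_beta:
  assumes A: "\<Gamma> \<turnstile> A \<Colon> U" and n: "\<Gamma> \<turnstile> n \<Colon> Nat" and x: "\<Gamma> \<turnstile> x \<Colon> stage A n"
  shows "\<Gamma> \<turnstile> App (stageNext A) (stagePair A n x) \<doteq> stagePair A (Succ n) (App (stageMap A n) x) \<Colon>
    stageTotal A"
proof -
  note [simp] = ty ctx_if_has_type[OF A] A U_El[OF A] stage_type U_El[OF stage_type] stageMap_App
  have T[simp]: "\<Gamma> \<turnstile> Sig Nat (stage (subst A (sh (Suc 0))) (Var 0)) \<Colon> Type" using U_El[OF
    stageTotal_type[OF A]] by simp
  let ?X = "stage (wk 1 A) (Var 0)" and ?p = "stagePair A n x"
  let ?g = "Pair Nat (stage (wk 3 A) (Var 0)) (Succ (Var 1)) (App (stageMap (wk 2 A) (Var 1)) (Var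
    0))"
  have A2[simp]: "?X # Nat # \<Gamma> \<turnstile> wk 2 A \<Colon> U" by simp
  have A3[simp]: "Nat # ?X # Nat # \<Gamma> \<turnstile> wk 3 A \<Colon> U" using wk1_has_type[OF A2, of Nat U] by simp
  note [simp] = A2[simplified] A3[simplified]
  have "\<Gamma> \<turnstile> App (stageNext A) ?p \<doteq> SigInd Nat ?X (wk 1 (stageTotal A)) ?g ?p \<Colon> stageTotal A"
    using Pi_beta[OF _ stageNext_types(1)[OF A] stagePair_type[OF assms]] by (simp add: seqNext_def)
  moreover have "\<Gamma> \<turnstile> SigInd Nat ?X (wk 1 (stageTotal A)) ?g ?p \<doteq> stagePair A (Succ n) (App
    (stageMap A n) x) \<Colon> stageTotal A"
    using Sig_beta[of Nat ?X \<Gamma> "wk 1 (stageTotal A)" ?g n x] n x by simp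
  ultimately show ?thesis by (rule jeq_trans)
qed

text \<open>Two layers are kept: \<open>incl\<close> and \<open>glue\<close> have reduced endpoints
  and serve the path algebra, while \<open>truncPt\<close> and \<open>truncGlue\<close> retain the
  applied graph maps that coequalizer induction produces. Translating between them is the task of
  \<open>contrPathCase_Pair\<close>.\<close>

definition "incl A n x = truncPt A (stagePair A n x)"
definition "glue A n x = truncGlue A (stagePair A n x)"

lemma subst_incl[simp]: "subst (incl A n x) \<sigma> = incl (subst A \<sigma>) (subst n \<sigma>) (subst x \<sigma>)"
  by (simp add: incl_def)

lemma subst_glue[simp]: "subst (glue A n x) \<sigma> = glue (subst A \<sigma>) (subst n \<sigma>) (subst x \<sigma>)"
  by (simp add: glue_def)

lemma incl_type: "\<lbrakk>\<Gamma> \<turnstile> A \<Colon> U; \<Gamma> \<turnstile> n \<Colon> Nat; \<Gamma> \<turnstile> x \<Colon> stage A n\<rbrakk> \<Longrightarrow> \<Gamma> \<turnstile> incl A n x \<Colon> Trunc A"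
  unfolding incl_def by (intro truncPt_type stagePair_type)

lemma truncPt_stageNext:
  "\<lbrakk>\<Gamma> \<turnstile> A \<Colon> U; \<Gamma> \<turnstile> n \<Colon> Nat; \<Gamma> \<turnstile> x \<Colon> stage A n\<rbrakk>
   \<Longrightarrow> \<Gamma> \<turnstile> truncPt A (App (stageNext A) (stagePair A n x)) \<doteq> incl A (Succ n) (App (stageMap A n) x)
     \<Colon> Trunc A"
  unfolding incl_def by (intro truncPt_cong stageNext_beta)

lemma glue_type:
  assumes "\<Gamma> \<turnstile> A \<Colon> U" "\<Gamma> \<turnstile> n \<Colon> Nat" "\<Gamma> \<turnstile> x \<Colon> stage A n"
  shows "\<Gamma> \<turnstile> glue A n x \<Colon> Eq (Trunc A) (incl A n x) (incl A (Succ n) (App (stageMap A n) x))"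
  unfolding glue_def
  by (rule Eq_conv[OF U_El[OF Trunc_type] truncGlue_type[OF _ stagePair_type]
        truncPt_cong[OF _ idfun_type(2)[OF U_El[OF stageTotal_type] stagePair_type], folded
          incl_def]
        truncPt_stageNext]) (fact assms)+

text \<open>By its definition the map has domain \<open>stage A (Succ Zero)\<close>, which is
  \<open>A\<close> only up to conversion.\<close>

lemma truncIn_type:
  assumes A: "\<Gamma> \<turnstile> A \<Colon> U"
  shows "\<Gamma> \<turnstile> truncIn A \<Colon> Arr A (Trunc A)"
proof -
  let ?n = "Succ Zero"
  note [simp] = ctx_if_has_type[OF A] ty stage_type incl_type Trunc_type U_El[OF stage_type]
    U_El[OF Trunc_type] A
  have "\<Gamma> \<turnstile> Lam (stage A ?n) (incl (wk 1 A) ?n (Var 0)) \<Colon> Arr (stage A ?n) (Trunc A)"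
    by simp
  moreover have "Lam (stage A ?n) (incl (wk 1 A) ?n (Var 0)) = truncIn A"
    by (simp add: truncIn_def seqIn_def incl_def truncPt_def)
  moreover have "\<Gamma> \<turnstile> Arr (stage A ?n) (Trunc A) \<doteq> Arr A (Trunc A) \<Colon> Type"
    by (rule Arr_cong[OF U_El_cong[OF stage_one] _ jeq_refl]) simp_all
  ultimately show ?thesis using conv by fastforce
qed

section \<open>Contraction\<close>

text \<open>
  \<open>nullHtpy A a\<close> is the type of null-homotopies of all transition maps; below, \<open>baseIn A a n\<close> is
  \<open>b n\<close>, \<open>fromBase A a h n x\<close> is \<open>q n x\<close>, \<open>basePath A a h n\<close> is \<open>k n\<close>, and \<open>contr A a h n x\<close> is
  \<open>k n . q n x\<close>, in the notation of the opening paragraph.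
\<close>

definition nullHtpy :: "tm \<Rightarrow> tm \<Rightarrow> tm" where
  "nullHtpy A a = Pi Nat (Pi (stage (wk 1 A) (Var 0)) (Eq (stage (wk 2 A) (Succ (Var 1))) (basePt
    (wk 2 A) (wk 2 a) (Var 1))
    (App (stageMap (wk 2 A) (Var 1)) (Var 0))))"

lemma subst_nullHtpy[simp]: "subst (nullHtpy A a) \<sigma> = nullHtpy (subst A \<sigma>) (subst a \<sigma>)"
  by (simp add: nullHtpy_def)

lemma nullHtpy_type:
  assumes A[simp]: "\<Gamma> \<turnstile> A \<Colon> U" and a[simp]: "\<Gamma> \<turnstile> a \<Colon> A"
  shows "\<Gamma> \<turnstile> nullHtpy A a \<Colon> Type" "inh \<Gamma> (nullHtpy A a)"
proof -
  note [simp] = ty ctx_if_has_type[OF A] U_El[OF A] stage_type U_El[OF stage_type] basePt_type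
    stageMap_App
  show "\<Gamma> \<turnstile> nullHtpy A a \<Colon> Type" by (simp add: nullHtpy_def)
  show "inh \<Gamma> (nullHtpy A a)"
    unfolding nullHtpy_def using stageMap_null[of "Nat # \<Gamma>" "wk 1 A" "wk 1 a" "Var 0"]
    by (auto intro!: inh_Lam)
qed

lemma nullHtpy_App:
  assumes "\<Gamma> \<turnstile> h \<Colon> nullHtpy A a" "\<Gamma> \<turnstile> n \<Colon> Nat" "\<Gamma> \<turnstile> x \<Colon> stage A n"
  shows "\<Gamma> \<turnstile> App (App h n) x \<Colon> Eq (stage A (Succ n)) (basePt A a n) (App (stageMap A n) x)"
proof -
  have "\<Gamma> \<turnstile> App h n \<Colon> Pi (stage A n) (Eq (stage (wk 1 A) (Succ (wk 1 n))) (basePt (wk 1 A) (wk 1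
    a) (wk 1 n))
    (App (stageMap (wk 1 A) (wk 1 n)) (Var 0)))"
    using App_elim[OF assms(1)[unfolded nullHtpy_def] assms(2)] by simp
  from App_elim[OF this assms(3)] show ?thesis by simp
qed

definition baseIn :: "tm \<Rightarrow> tm \<Rightarrow> tm \<Rightarrow> tm" where
  "baseIn A a n = incl A (Succ n) (basePt A a n)"

lemma subst_baseIn[simp]: "subst (baseIn A a n) \<sigma> = baseIn (subst A \<sigma>) (subst a \<sigma>) (subst n \<sigma>)"
  by (simp add: baseIn_def)

lemma baseIn_type: "\<lbrakk>\<Gamma> \<turnstile> A \<Colon> U; \<Gamma> \<turnstile> a \<Colon> A; \<Gamma> \<turnstile> n \<Colon> Nat\<rbrakk> \<Longrightarrow> \<Gamma> \<turnstile> baseIn A a n \<Colon> Trunc A"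
  unfolding baseIn_def by (intro incl_type Succ_intro basePt_type)

text \<open>The image of the null-homotopy in the colimit. It is separate from
  \<open>fromBase\<close> because it is the factor left over in \<open>contr_coherent\<close> once
  the glue has cancelled.\<close>

definition inclAp :: "tm \<Rightarrow> tm \<Rightarrow> tm \<Rightarrow> tm \<Rightarrow> tm \<Rightarrow> tm" where
  "inclAp A a h n x = ap (stage A (Succ n)) (Trunc A) (incl (wk 1 A) (Succ (wk 1 n)) (Var 0))
     (basePt A a n) (App (stageMap A n) x) (App (App h n) x)"

definition fromBase :: "tm \<Rightarrow> tm \<Rightarrow> tm \<Rightarrow> tm \<Rightarrow> tm \<Rightarrow> tm" where
  "fromBase A a h n x = pcat (Trunc A) (baseIn A a n) (incl A (Succ n) (App (stageMap A n) x))
    (incl A n x)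
     (inclAp A a h n x)
     (pinv (Trunc A) (incl A n x) (incl A (Succ n) (App (stageMap A n) x)) (glue A n x))"

definition basePath :: "tm \<Rightarrow> tm \<Rightarrow> tm \<Rightarrow> tm \<Rightarrow> tm" where
  "basePath A a h n =
     NatInd (Eq (Trunc (wk 1 A)) (baseIn (wk 1 A) (wk 1 a) Zero) (baseIn (wk 1 A) (wk 1 a) (Var 0)))
       (Refl (Trunc A) (baseIn A a Zero))
       (pcat (Trunc (wk 2 A)) (baseIn (wk 2 A) (wk 2 a) Zero) (baseIn (wk 2 A) (wk 2 a) (Var 1))
          (baseIn (wk 2 A) (wk 2 a) (Succ (Var 1))) (Var 0)
          (pinv (Trunc (wk 2 A)) (baseIn (wk 2 A) (wk 2 a) (Succ (Var 1))) (baseIn (wk 2 A) (wk 2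
            a) (Var 1))
             (fromBase (wk 2 A) (wk 2 a) (wk 2 h) (Succ (Var 1)) (basePt (wk 2 A) (wk 2 a) (Var
               1)))))
       n"

definition contr :: "tm \<Rightarrow> tm \<Rightarrow> tm \<Rightarrow> tm \<Rightarrow> tm \<Rightarrow> tm" where
  "contr A a h n x = pcat (Trunc A) (baseIn A a Zero) (baseIn A a n) (incl A n x) (basePath A a h
    n) (fromBase A a h n x)"

lemma subst_inclAp[simp]: "subst (inclAp A a h n x) \<sigma> = inclAp (subst A \<sigma>) (subst a \<sigma>) (subst h \<sigma>)
    (subst n \<sigma>) (subst x \<sigma>)"
  by (simp add: inclAp_def)

lemma subst_fromBase[simp]: "subst (fromBase A a h n x) \<sigma> = fromBase (subst A \<sigma>) (subst a \<sigma>)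
    (subst h \<sigma>) (subst n \<sigma>) (subst x \<sigma>)"
  by (simp add: fromBase_def)

lemma subst_basePath[simp]: "subst (basePath A a h n) \<sigma> = basePath (subst A \<sigma>) (subst a \<sigma>) (subst
    h \<sigma>) (subst n \<sigma>)"
  by (simp add: basePath_def)

lemma subst_contr[simp]: "subst (contr A a h n x) \<sigma> = contr (subst A \<sigma>) (subst a \<sigma>) (subst h \<sigma>)
    (subst n \<sigma>) (subst x \<sigma>)"
  by (simp add: contr_def)

text \<open>The null-homotopy is known by inhabitation of its type, so the constructions take it as
  a parameter \<open>h\<close>, and the bundle can be weakened as a whole.\<close>

definition nullData :: "tm list \<Rightarrow> tm \<Rightarrow> tm \<Rightarrow> tm \<Rightarrow> bool" where
  "nullData \<Gamma> A a h \<longleftrightarrow> \<Gamma> \<turnstile> A \<Colon> U \<and> \<Gamma> \<turnstile> a \<Colon> A \<and> \<Gamma> \<turnstile> h \<Colon> nullHtpy A a"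

lemma nullData_wk:
  assumes "nullData \<Gamma> A a h" "\<Gamma> \<turnstile> B \<Colon> Type"
  shows "nullData (B # \<Gamma>) (wk 1 A) (wk 1 a) (wk 1 h)"
  using assms wk1_has_type[of \<Gamma> h "nullHtpy A a" B] unfolding nullData_def by (simp add: ty)

lemma nullData_wk2:
  assumes "nullData \<Gamma> A a h" "\<Gamma> \<turnstile> B \<Colon> Type" "B # \<Gamma> \<turnstile> C \<Colon> Type"
  shows "nullData (C # B # \<Gamma>) (wk 2 A) (wk 2 a) (wk 2 h)"
  using nullData_wk[OF nullData_wk[OF assms(1,2)] assms(3)] by simp

lemma inclAp_type:
  assumes D: "nullData \<Gamma> A a h" and n[simp]: "\<Gamma> \<turnstile> n \<Colon> Nat" and x[simp]: "\<Gamma> \<turnstile> x \<Colon> stage A n"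
  shows "\<Gamma> \<turnstile> inclAp A a h n x \<Colon> Eq (Trunc A) (baseIn A a n) (incl A (Succ n) (App (stageMap A n)
    x))"
    and "stage A (Succ n) # \<Gamma> \<turnstile> incl (wk 1 A) (Succ (wk 1 n)) (Var 0) \<Colon> wk 1 (Trunc A)"
proof -
  have [simp]: "\<Gamma> \<turnstile> A \<Colon> U" "\<Gamma> \<turnstile> a \<Colon> A" "\<Gamma> \<turnstile> h \<Colon> nullHtpy A a" using D by (auto simp: nullData_def)
  note [simp] = ty ctx_if_has_type[OF n] U_El[of \<Gamma> A] stage_type U_El[OF stage_type] basePt_type
    stageMap_App
    Trunc_type U_El[OF Trunc_type] incl_type nullHtpy_App
  show *: "stage A (Succ n) # \<Gamma> \<turnstile> incl (wk 1 A) (Succ (wk 1 n)) (Var 0) \<Colon> wk 1 (Trunc A)" by simp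
  show "\<Gamma> \<turnstile> inclAp A a h n x \<Colon> Eq (Trunc A) (baseIn A a n) (incl A (Succ n) (App (stageMap A n) x))"
    unfolding inclAp_def baseIn_def
    using ap_type[OF _ _ *, of "basePt A a n" "App (stageMap A n) x" "App (App h n) x"] by simp
qed

lemma fromBase_type:
  assumes D: "nullData \<Gamma> A a h" and n[simp]: "\<Gamma> \<turnstile> n \<Colon> Nat" and x[simp]: "\<Gamma> \<turnstile> x \<Colon> stage A n"
  shows "\<Gamma> \<turnstile> fromBase A a h n x \<Colon> Eq (Trunc A) (baseIn A a n) (incl A n x)"
proof -
  have [simp]: "\<Gamma> \<turnstile> A \<Colon> U" "\<Gamma> \<turnstile> a \<Colon> A" using D by (auto simp: nullData_def)
  show ?thesis
    unfolding fromBase_def using inclAp_type[OF D n x]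
    by (intro pcat_type pinv_type glue_type U_El[OF Trunc_type] baseIn_type incl_type stageMap_App
      Succ_intro) simp_all
qed

lemma basePath_types:
  assumes D: "nullData \<Gamma> A a h"
  shows "Nat # \<Gamma> \<turnstile> Eq (Trunc (wk 1 A)) (baseIn (wk 1 A) (wk 1 a) Zero) (baseIn (wk 1 A) (wk 1 a)
    (Var 0)) \<Colon> Type"
     "\<Gamma> \<turnstile> Refl (Trunc A) (baseIn A a Zero) \<Colon> Eq (Trunc A) (baseIn A a Zero) (baseIn A a Zero)"
     "Eq (Trunc (wk 1 A)) (baseIn (wk 1 A) (wk 1 a) Zero) (baseIn (wk 1 A) (wk 1 a) (Var 0)) # Nat
       # \<Gamma> \<turnstile>
       pcat (Trunc (wk 2 A)) (baseIn (wk 2 A) (wk 2 a) Zero) (baseIn (wk 2 A) (wk 2 a) (Var 1))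
          (baseIn (wk 2 A) (wk 2 a) (Succ (Var 1))) (Var 0)
          (pinv (Trunc (wk 2 A)) (baseIn (wk 2 A) (wk 2 a) (Succ (Var 1))) (baseIn (wk 2 A) (wk 2
            a) (Var 1))
             (fromBase (wk 2 A) (wk 2 a) (wk 2 h) (Succ (Var 1)) (basePt (wk 2 A) (wk 2 a) (Var
               1))))
       \<Colon> Eq (Trunc (wk 2 A)) (baseIn (wk 2 A) (wk 2 a) Zero) (baseIn (wk 2 A) (wk 2 a) (Succ (Var
         1)))"
proof -
  have A[simp]: "\<Gamma> \<turnstile> A \<Colon> U" and [simp]: "\<Gamma> \<turnstile> a \<Colon> A" using D by (auto simp: nullData_def)
  note [simp] = ty ctx_if_has_type[OF A] Trunc_type U_El[OF A] U_El[OF Trunc_type] baseIn_type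
    basePt_type
  let ?E = "Eq (Trunc (wk 1 A)) (baseIn (wk 1 A) (wk 1 a) Zero) (baseIn (wk 1 A) (wk 1 a) (Var 0))"
  show E: "Nat # \<Gamma> \<turnstile> ?E \<Colon> Type" by simp
  show "\<Gamma> \<turnstile> Refl (Trunc A) (baseIn A a Zero) \<Colon> Eq (Trunc A) (baseIn A a Zero) (baseIn A a Zero)"
    by simp
  have "nullData (?E # Nat # \<Gamma>) (wk 2 A) (wk 2 a) (wk 2 h)" by (rule nullData_wk2[OF D]) (use E in
    simp_all)
  \<comment> \<open>The path \<open>q (n + 1)\<close> is taken at the base point of index
    \<open>n\<close>, which lies in stage \<open>n + 1\<close>. Its end is \<open>baseIn\<close> at
    \<open>n\<close> by definition, so consecutive steps compose.\<close>
  from fromBase_type[OF this, of "Succ (Var 1)" "basePt (wk 2 A) (wk 2 a) (Var 1)"] E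
  show "?E # Nat # \<Gamma> \<turnstile>
       pcat (Trunc (wk 2 A)) (baseIn (wk 2 A) (wk 2 a) Zero) (baseIn (wk 2 A) (wk 2 a) (Var 1))
          (baseIn (wk 2 A) (wk 2 a) (Succ (Var 1))) (Var 0)
          (pinv (Trunc (wk 2 A)) (baseIn (wk 2 A) (wk 2 a) (Succ (Var 1))) (baseIn (wk 2 A) (wk 2
            a) (Var 1))
             (fromBase (wk 2 A) (wk 2 a) (wk 2 h) (Succ (Var 1)) (basePt (wk 2 A) (wk 2 a) (Var
               1))))
       \<Colon> Eq (Trunc (wk 2 A)) (baseIn (wk 2 A) (wk 2 a) Zero) (baseIn (wk 2 A) (wk 2 a) (Succ (Var
         1)))"
    by (intro pcat_type pinv_type) (simp_all flip: baseIn_def)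
qed

lemma basePath_type:
  assumes D: "nullData \<Gamma> A a h" and n: "\<Gamma> \<turnstile> n \<Colon> Nat"
  shows "\<Gamma> \<turnstile> basePath A a h n \<Colon> Eq (Trunc A) (baseIn A a Zero) (baseIn A a n)"
  unfolding basePath_def using Nat_elim[OF basePath_types(1)[OF D] _ _ n] basePath_types(2,3)[OF
    D] by simp

lemma basePath_Succ:
  assumes D: "nullData \<Gamma> A a h" and n: "\<Gamma> \<turnstile> n \<Colon> Nat"
  shows "\<Gamma> \<turnstile> basePath A a h (Succ n) \<doteq> pcat (Trunc A) (baseIn A a Zero) (baseIn A a n) (baseIn A a
    (Succ n)) (basePath A a h n)
     (pinv (Trunc A) (baseIn A a (Succ n)) (baseIn A a n) (fromBase A a h (Succ n) (basePt A a n)))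
    \<Colon> Eq (Trunc A) (baseIn A a Zero) (baseIn A a (Succ n))"
  unfolding basePath_def
  using Nat_beta_Succ[OF basePath_types(1)[OF D], of "Refl (Trunc A) (baseIn A a Zero)"
      "pcat (Trunc (wk 2 A)) (baseIn (wk 2 A) (wk 2 a) Zero) (baseIn (wk 2 A) (wk 2 a) (Var 1))
          (baseIn (wk 2 A) (wk 2 a) (Succ (Var 1))) (Var 0)
          (pinv (Trunc (wk 2 A)) (baseIn (wk 2 A) (wk 2 a) (Succ (Var 1))) (baseIn (wk 2 A) (wk 2
            a) (Var 1))
             (fromBase (wk 2 A) (wk 2 a) (wk 2 h) (Succ (Var 1)) (basePt (wk 2 A) (wk 2 a) (Var
               1))))"
       n] n basePath_types(2,3)[OF D] by simp

lemma contr_type: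
  assumes D: "nullData \<Gamma> A a h" and n[simp]: "\<Gamma> \<turnstile> n \<Colon> Nat" and x[simp]: "\<Gamma> \<turnstile> x \<Colon> stage A n"
  shows "\<Gamma> \<turnstile> contr A a h n x \<Colon> Eq (Trunc A) (baseIn A a Zero) (incl A n x)"
proof -
  have A[simp]: "\<Gamma> \<turnstile> A \<Colon> U" and [simp]: "\<Gamma> \<turnstile> a \<Colon> A" using D by (auto simp: nullData_def)
  show ?thesis
    unfolding contr_def using fromBase_type[OF D n x] basePath_type[OF D n] ctx_if_has_type[OF A]
    by (intro pcat_type U_El[OF Trunc_type] baseIn_type incl_type) (simp_all add: ty)
qed

text \<open>With \<open>f\<close> the transition map, \<open>u\<close> the path
  \<open>inclAp\<close> at \<open>x\<close>, \<open>g\<close> the glue at \<open>x\<close> and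
  \<open>c\<close> the base point of index \<open>n\<close>, the chain is \<open>(k n . (u . g^-1))
  . g = k n . u = (k n . (q (n + 1) c)^-1) . q (n + 1) (f x) = k (n + 1) . q (n + 1) (f x)\<close>.
  The steps are cancellation, naturality by \<open>pcat_ap\<close>, and the recursion of
  \<open>basePath\<close>, the last one judgemental.\<close>

lemma contr_coherent:
  assumes D: "nullData \<Gamma> A a h" and n[simp]: "\<Gamma> \<turnstile> n \<Colon> Nat" and x[simp]: "\<Gamma> \<turnstile> x \<Colon> stage A n"
  shows "inh \<Gamma> (Eq (Eq (Trunc A) (baseIn A a Zero) (incl A (Succ n) (App (stageMap A n) x)))
    (pcat (Trunc A) (baseIn A a Zero) (incl A n x) (incl A (Succ n) (App (stageMap A n) x)) (contr
      A a h n x) (glue A n x))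
    (contr A a h (Succ n) (App (stageMap A n) x)))"
proof -
  have A[simp]: "\<Gamma> \<turnstile> A \<Colon> U" and a[simp]: "\<Gamma> \<turnstile> a \<Colon> A" and h: "\<Gamma> \<turnstile> h \<Colon> nullHtpy A a" using D by
    (auto simp: nullData_def)
  note [simp] = ctx_if_has_type[OF A] baseIn_type incl_type stageMap_App Zero_intro Succ_intro
    Trunc_type U_El[OF Trunc_type]
    glue_type basePath_type[OF D] inclAp_type[OF D] contr_type[OF D] fromBase_type[OF D] pcat_type
      pinv_type
    stage_type U_El[OF stage_type] basePt_type nullHtpy_App[OF h]
  let ?T = "Trunc A" and ?p = "baseIn A a Zero" and ?y = "App (stageMap A n) x"
  let ?z = "incl A (Succ n) ?y" and ?K = "basePath A a h n" and ?u = "inclAp A a h n x"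
  let ?l = "pcat ?T ?p (incl A n x) ?z (contr A a h n x) (glue A n x)"
  let ?m = "pcat ?T ?p (baseIn A a n) ?z ?K ?u"
  let ?K' = "pcat ?T ?p (baseIn A a n) (baseIn A a (Succ n)) ?K
     (pinv ?T (baseIn A a (Succ n)) (baseIn A a n) (fromBase A a h (Succ n) (basePt A a n)))"
  let ?r = "pcat ?T ?p (baseIn A a (Succ n)) ?z ?K' (fromBase A a h (Succ n) ?y)"
  let ?c = "contr A a h (Succ n) ?y"
  have fb[simp]: "\<Gamma> \<turnstile> fromBase A a h (Succ n) (basePt A a n) \<Colon> Eq ?T (baseIn A a (Succ n)) (baseIn
    A a n)"
    using fromBase_type[OF D, of "Succ n" "basePt A a n"] by (simp add: baseIn_def)
  have 1: "inh \<Gamma> (Eq (Eq ?T ?p ?z) ?l ?m)"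
    unfolding contr_def fromBase_def
    by (rule pcat_pinv_cancel_right) simp_all
  have S: "\<Gamma> \<turnstile> stage A (Succ n) \<Colon> Type" by simp
  \<comment> \<open>For naturality the paths \<open>q (n + 1)\<close> are needed as an open term
    over stage \<open>n + 1\<close>, so the data are weakened by one point of that stage.\<close>
  have "nullData (stage A (Succ n) # \<Gamma>) (wk 1 A) (wk 1 a) (wk 1 h)" by (rule nullData_wk[OF D S])
  from fromBase_type[OF this, of "Succ (wk 1 n)" "Var 0"] S
  have Q: "stage A (Succ n) # \<Gamma> \<turnstile> fromBase (wk 1 A) (wk 1 a) (wk 1 h) (Succ (wk 1 n)) (Var 0)
     \<Colon> Eq (wk 1 ?T) (wk 1 (baseIn A a (Succ n))) (incl (wk 1 A) (Succ (wk 1 n)) (Var 0))"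
    by (simp add: ty)
  have 2: "inh \<Gamma> (Eq (Eq ?T ?p ?z) ?m ?r)"
    using pcat_ap[OF S _ inclAp_type(2)[OF D n x] _ Q, of "basePt A a n" ?y "App (App h n) x" ?p ?K]
    by (simp add: inclAp_def flip: baseIn_def)
  have 3: "\<Gamma> \<turnstile> ?r \<doteq> ?c \<Colon> Eq ?T ?p ?z"
    unfolding contr_def by (rule pcat_paths_cong) (simp_all add: jeq_refl jeq_sym[OF
      basePath_Succ[OF D n]])
  have [simp]: "\<Gamma> \<turnstile> ?r \<Colon> Eq ?T ?p ?z" "\<Gamma> \<turnstile> ?c \<Colon> Eq ?T ?p ?z" by simp_all
  have "inh \<Gamma> (Eq (Eq ?T ?p ?z) ?r ?c)"
    by (rule inh_Eq_if_jeq[OF _ _ 3]) (simp_all add: ty)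
  show ?thesis
    by (rule inh_Eq_trans[OF _ _ _ _ 1 inh_Eq_trans[OF _ _ _ _ 2 \<open>inh \<Gamma> (Eq _ ?r ?c)\<close>]]) (simp_all
      add: ty)
qed

text \<open>The point case of coequalizer induction ranges over arbitrary elements of the total
  space, so \<open>contr\<close> is extended from a stage and a point to these by induction on
  pairs.\<close>

definition contrAt :: "tm \<Rightarrow> tm \<Rightarrow> tm \<Rightarrow> tm \<Rightarrow> tm" where
  "contrAt A a h v = SigInd Nat (stage (wk 1 A) (Var 0))
     (Eq (Trunc (wk 1 A)) (baseIn (wk 1 A) (wk 1 a) Zero) (truncPt (wk 1 A) (Var 0)))
     (contr (wk 2 A) (wk 2 a) (wk 2 h) (Var 1) (Var 0)) v"

lemma subst_contrAt[simp]: "subst (contrAt A a h v) \<sigma> = contrAt (subst A \<sigma>) (subst a \<sigma>) (subst h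
    \<sigma>) (subst v \<sigma>)"
  by (simp add: contrAt_def)

lemma stageTotal_ext:
  assumes A[simp]: "\<Gamma> \<turnstile> A \<Colon> U"
  shows "Nat # \<Gamma> \<turnstile> stage (wk 1 A) (Var 0) \<Colon> Type" "\<Gamma> \<turnstile> Nat \<Colon> Type"
  using ctx_if_has_type[OF A] by (simp_all add: ty U_El[OF stage_type])

lemma contrAt_types:
  assumes D: "nullData \<Gamma> A a h"
  shows "stageTotal A # \<Gamma> \<turnstile> Eq (Trunc (wk 1 A)) (baseIn (wk 1 A) (wk 1 a) Zero) (truncPt (wk 1 A)
    (Var 0)) \<Colon> Type"
    "stage (wk 1 A) (Var 0) # Nat # \<Gamma> \<turnstile> contr (wk 2 A) (wk 2 a) (wk 2 h) (Var 1) (Var 0)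
      \<Colon> Eq (Trunc (wk 2 A)) (baseIn (wk 2 A) (wk 2 a) Zero) (incl (wk 2 A) (Var 1) (Var 0))"
proof -
  have A[simp]: "\<Gamma> \<turnstile> A \<Colon> U" and a[simp]: "\<Gamma> \<turnstile> a \<Colon> A" using D by (auto simp: nullData_def)
  note [simp] = ctx_if_has_type[OF A] stageTotal_ext[OF A, simplified] ty baseIn_type Trunc_type
    U_El[OF Trunc_type]
    U_El[OF A]
  have "stageTotal A # \<Gamma> \<turnstile> truncPt (wk 1 A) (Var 0) \<Colon> Trunc (wk 1 A)"
    by (rule truncPt_type) simp_all
  then show "stageTotal A # \<Gamma> \<turnstile> Eq (Trunc (wk 1 A)) (baseIn (wk 1 A) (wk 1 a) Zero) (truncPt (wk 1
    A) (Var 0)) \<Colon> Type"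
    by simp
  show "stage (wk 1 A) (Var 0) # Nat # \<Gamma> \<turnstile> contr (wk 2 A) (wk 2 a) (wk 2 h) (Var 1) (Var 0)
      \<Colon> Eq (Trunc (wk 2 A)) (baseIn (wk 2 A) (wk 2 a) Zero) (incl (wk 2 A) (Var 1) (Var 0))"
    by (rule contr_type[OF nullData_wk2[OF D]]) simp_all
qed

lemma contrAt_type:
  assumes D: "nullData \<Gamma> A a h" and v: "\<Gamma> \<turnstile> v \<Colon> stageTotal A"
  shows "\<Gamma> \<turnstile> contrAt A a h v \<Colon> Eq (Trunc A) (baseIn A a Zero) (truncPt A v)"
  unfolding contrAt_def using Sig_elim[OF contrAt_types(1)[OF D] _ v] contrAt_types(2)[OF D] by
    (simp add: incl_def)

lemma contrAt_beta:
  assumes D: "nullData \<Gamma> A a h" and n: "\<Gamma> \<turnstile> n \<Colon> Nat" and x: "\<Gamma> \<turnstile> x \<Colon> stage A n"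
  shows "\<Gamma> \<turnstile> contrAt A a h (stagePair A n x) \<doteq> contr A a h n x \<Colon> Eq (Trunc A) (baseIn A a Zero)
    (incl A n x)"
  unfolding contrAt_def using Sig_beta[OF contrAt_types(1)[OF D] _ n, of "contr (wk 2 A) (wk 2 a)
    (wk 2 h) (Var 1) (Var 0)" x] x contrAt_types(2)[OF D] by (simp add: incl_def)

lemma contrAt_cong:
  assumes D: "nullData \<Gamma> A a h" and v: "\<Gamma> \<turnstile> v \<doteq> v' \<Colon> stageTotal A"
  shows "\<Gamma> \<turnstile> contrAt A a h v \<doteq> contrAt A a h v' \<Colon> Eq (Trunc A) (baseIn A a Zero) (truncPt A v)"
proof -
  have A[simp]: "\<Gamma> \<turnstile> A \<Colon> U" using D by (auto simp: nullData_def)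
  show ?thesis
    unfolding contrAt_def using SigInd_cong[OF jeq_refl jeq_refl jeq_refl[OF contrAt_types(1)[OF
      D]] jeq_refl v]
     contrAt_types(2)[OF D] stageTotal_ext[OF A] by (simp add: incl_def)
qed

text \<open>This is \<open>coeqPathCase\<close> for the family of paths from the centre and the
  point case \<open>contrAt\<close>: transport in that family is \<open>pcat\<close> by definition.
  The applications of the graph maps are left unreduced to match it.\<close>

definition contrPathCase :: "tm \<Rightarrow> tm \<Rightarrow> tm \<Rightarrow> tm \<Rightarrow> tm" where
  "contrPathCase A a h v =
    Eq (Eq (Trunc A) (baseIn A a Zero) (truncPt A (App (stageNext A) v)))
      (pcat (Trunc A) (baseIn A a Zero) (truncPt A (App (idfun (stageTotal A)) v)) (truncPt A (App
        (stageNext A) v))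
         (contrAt A a h (App (idfun (stageTotal A)) v)) (truncGlue A v))
      (contrAt A a h (App (stageNext A) v))"

lemma subst_contrPathCase[simp]:
  "subst (contrPathCase A a h v) \<sigma> = contrPathCase (subst A \<sigma>) (subst a \<sigma>) (subst h \<sigma>) (subst v \<sigma>)"
  by (simp add: contrPathCase_def)

lemma contrPathCase_type:
  assumes D: "nullData \<Gamma> A a h" and v[simp]: "\<Gamma> \<turnstile> v \<Colon> stageTotal A"
  shows "\<Gamma> \<turnstile> contrPathCase A a h v \<Colon> Type"
proof -
  have A[simp]: "\<Gamma> \<turnstile> A \<Colon> U" and [simp]: "\<Gamma> \<turnstile> a \<Colon> A" using D by (auto simp: nullData_def)
  have iv: "\<Gamma> \<turnstile> App (idfun (stageTotal A)) v \<Colon> stageTotal A" "\<Gamma> \<turnstile> App (stageNext A) v \<Colon> stageTotal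
    A"
    using idfun_type(1)[OF U_El[OF stageTotal_type[OF A]]] stageNext_types(2)[OF A] v by (auto
      intro: App_Arr)
  show ?thesis unfolding contrPathCase_def
    by (intro Eq_form[where S = Type] pcat_type truncGlue_type contrAt_type[OF D] truncPt_type
      U_El[OF Trunc_type] baseIn_type)
     (use iv v in \<open>simp_all add: ctx_if_has_type[OF A] Zero_intro\<close>)
qed

text \<open>On an actual pair the two graph maps and \<open>contrAt\<close> compute, which converts
  the type into that of \<open>contr_coherent\<close>. The types of the \<open>contrAt\<close> terms
  depend on their arguments, so these equations themselves need conversion along \<open>ty_i\<close>
  and \<open>ty_s\<close>.\<close>

lemma contrPathCase_Pair:
  assumes D: "nullData \<Gamma> A a h" and n: "\<Gamma> \<turnstile> n \<Colon> Nat" and x: "\<Gamma> \<turnstile> x \<Colon> stage A n"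
  shows "inh \<Gamma> (contrPathCase A a h (stagePair A n x))"
proof -
  have A[simp]: "\<Gamma> \<turnstile> A \<Colon> U" and [simp]: "\<Gamma> \<turnstile> a \<Colon> A" using D by (auto simp: nullData_def)
  let ?v = "stagePair A n x" and ?T = "Trunc A" and ?p = "baseIn A a Zero" and ?y = "App (stageMap
    A n) x"
  have v: "\<Gamma> \<turnstile> ?v \<Colon> stageTotal A" by (rule stagePair_type[OF A n x])
  have y: "\<Gamma> \<turnstile> ?y \<Colon> stage A (Succ n)" by (rule stageMap_App[OF A n x])
  have T: "\<Gamma> \<turnstile> ?T \<Colon> Type" by (rule U_El[OF Trunc_type[OF A]])
  have p: "\<Gamma> \<turnstile> ?p \<Colon> ?T" by (rule baseIn_type) (simp_all add: Zero_intro ctx_if_has_type[OF A])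
  have iv: "\<Gamma> \<turnstile> App (idfun (stageTotal A)) ?v \<doteq> ?v \<Colon> stageTotal A"
    by (rule idfun_type(2)[OF U_El[OF stageTotal_type[OF A]] v])
  have nv: "\<Gamma> \<turnstile> App (stageNext A) ?v \<doteq> stagePair A (Succ n) ?y \<Colon> stageTotal A"
    by (rule stageNext_beta[OF A n x])
  have iv_type: "\<Gamma> \<turnstile> App (idfun (stageTotal A)) ?v \<Colon> stageTotal A"
    using idfun_type(1)[OF U_El[OF stageTotal_type[OF A]]] v by (auto intro: App_Arr)
  have i: "\<Gamma> \<turnstile> truncPt A (App (idfun (stageTotal A)) ?v) \<doteq> incl A n x \<Colon> ?T"
    unfolding incl_def by (rule truncPt_cong[OF A iv])
  have s: "\<Gamma> \<turnstile> truncPt A (App (stageNext A) ?v) \<doteq> incl A (Succ n) ?y \<Colon> ?T"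
    unfolding incl_def by (rule truncPt_cong[OF A nv])
  have ty_i: "\<Gamma> \<turnstile> Eq ?T ?p (incl A n x) \<doteq> Eq ?T ?p (truncPt A (App (idfun (stageTotal A)) ?v)) \<Colon>
    Type"
    by (rule Eq_cong[OF _ jeq_refl[OF T] jeq_refl[OF p] jeq_sym[OF i]]) simp
  have ty_s: "\<Gamma> \<turnstile> Eq ?T ?p (truncPt A (App (stageNext A) ?v)) \<doteq> Eq ?T ?p (incl A (Succ n) ?y) \<Colon>
    Type"
    by (rule Eq_cong[OF _ jeq_refl[OF T] jeq_refl[OF p] s]) simp
  have ci: "\<Gamma> \<turnstile> contrAt A a h (App (idfun (stageTotal A)) ?v) \<doteq> contr A a h n x
      \<Colon> Eq ?T ?p (truncPt A (App (idfun (stageTotal A)) ?v))"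
    by (rule jeq_trans[OF contrAt_cong[OF D iv] jeq_conv[OF contrAt_beta[OF D n x] ty_i]])
  have cs: "\<Gamma> \<turnstile> contrAt A a h (App (stageNext A) ?v) \<doteq> contr A a h (Succ n) ?y
      \<Colon> Eq ?T ?p (truncPt A (App (stageNext A) ?v))"
    by (rule jeq_trans[OF contrAt_cong[OF D nv] jeq_conv[OF contrAt_beta[OF D Succ_intro[OF n] y]
      jeq_sym[OF ty_s]]])
  have "\<Gamma> \<turnstile> contrPathCase A a h ?v \<doteq>
     Eq (Eq ?T ?p (incl A (Succ n) ?y)) (pcat ?T ?p (incl A n x) (incl A (Succ n) ?y) (contr A a h
       n x) (glue A n x))
       (contr A a h (Succ n) ?y) \<Colon> Type"
    unfolding contrPathCase_def
  proof (rule Eq_cong[OF _ ty_s _ cs])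
    show "\<Gamma> \<turnstile> pcat ?T ?p (truncPt A (App (idfun (stageTotal A)) ?v)) (truncPt A (App (stageNext A)
      ?v))
         (contrAt A a h (App (idfun (stageTotal A)) ?v)) (truncGlue A ?v) \<doteq>
      pcat ?T ?p (incl A n x) (incl A (Succ n) ?y) (contr A a h n x) (glue A n x)
      \<Colon> Eq ?T ?p (truncPt A (App (stageNext A) ?v))"
      unfolding glue_def
      by (rule pcat_cong[OF T p i truncPt_type[OF A iv_type] s ci jeq_refl[OF truncGlue_type[OF A
        v]]])
  qed simp
  from inh_conv[OF contr_coherent[OF D n x] jeq_sym[OF this]] show ?thesis .
qed

section \<open>From the contraction on the stages to the whole colimit\<close>

lemma inh_SigInd:
  assumes "Sig A B # \<Gamma> \<turnstile> C \<Colon> Type" "inh (B # A # \<Gamma>) (inst 2 (Pair (wk 2 A) (shift 2 1 B) (Var 1)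
    (Var 0)) C)"
   "\<Gamma> \<turnstile> p \<Colon> Sig A B"
  shows "inh \<Gamma> (sub p C)"
  using Sig_elim[OF assms(1) _ assms(3)] assms(2) unfolding inh_def by blast

lemma inh_CInd:
  assumes "Coeq E V s t # \<Gamma> \<turnstile> P \<Colon> Type"
      "V # \<Gamma> \<turnstile> d \<Colon> inst 1 (CPt (wk 1 E) (wk 1 V) (wk 1 s) (wk 1 t) (Var 0)) P"
      "inh (E # \<Gamma>) (coeqPathCase (wk 1 E) (wk 1 V) (wk 1 s) (wk 1 t) (shift 1 1 P) (shift 1 1 d)
        (Var 0))"
      "\<Gamma> \<turnstile> x \<Colon> Coeq E V s t"
  shows "inh \<Gamma> (sub x P)"
  using Coeq_elim[OF assms(1,2) _ assms(4)] assms(3) unfolding inh_def by blast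

text \<open>Pairs have no judgemental eta rule, so the passage from pairs to arbitrary elements of
  the total space is another induction.\<close>

lemma contrPathCase_inh:
  assumes D: "nullData \<Gamma> A a h" and v: "\<Gamma> \<turnstile> v \<Colon> stageTotal A"
  shows "inh \<Gamma> (contrPathCase A a h v)"
proof -
  have A: "\<Gamma> \<turnstile> A \<Colon> U" and a: "\<Gamma> \<turnstile> a \<Colon> A" using D by (auto simp: nullData_def)
  note [simp] = ctx_if_has_type[OF A] ty A a
  have V: "\<Gamma> \<turnstile> stageTotal A \<Colon> Type" by (rule U_El[OF stageTotal_type[OF A]])
  have v0: "stageTotal A # \<Gamma> \<turnstile> Var 0 \<Colon> stageTotal (wk 1 A)" using V by simp
  note V2 = stageTotal_ext(2)[OF A] stageTotal_ext(1)[OF A]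
  have "inh (stage (wk 1 A) (Var 0) # Nat # \<Gamma>) (contrPathCase (wk 2 A) (wk 2 a) (wk 2 h)
    (stagePair (wk 2 A) (Var 1) (Var 0)))"
    by (rule contrPathCase_Pair[OF nullData_wk2[OF D V2]]) (use V2 in simp_all)
  then show ?thesis
    using inh_SigInd[OF contrPathCase_type[OF nullData_wk[OF D V] v0] _ v] by simp
qed

lemma Trunc_contr:
  assumes D: "nullData \<Gamma> A a h" and y: "\<Gamma> \<turnstile> y \<Colon> Trunc A"
  shows "inh \<Gamma> (Eq (Trunc A) (baseIn A a Zero) y)"
proof -
  have A[simp]: "\<Gamma> \<turnstile> A \<Colon> U" and [simp]: "\<Gamma> \<turnstile> a \<Colon> A" using D by (auto simp: nullData_def)
  note [simp] = ctx_if_has_type[OF A] ty baseIn_type Trunc_type U_El[OF Trunc_type] U_El[OF A]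
  have V: "\<Gamma> \<turnstile> stageTotal A \<Colon> Type" by (rule U_El[OF stageTotal_type[OF A]])
  define P where "P = Eq (Trunc (wk 1 A)) (baseIn (wk 1 A) (wk 1 a) Zero) (Var 0)"
  define d where "d = contrAt (wk 1 A) (wk 1 a) (wk 1 h) (Var 0)"
  have P: "Trunc A # \<Gamma> \<turnstile> P \<Colon> Type" by (simp add: P_def)
  note DV = nullData_wk[OF D V]
  have v: "stageTotal A # \<Gamma> \<turnstile> Var 0 \<Colon> stageTotal (wk 1 A)" using V by simp
  have d: "stageTotal A # \<Gamma> \<turnstile> d \<Colon> inst 1 (truncPt (wk 1 A) (Var 0)) P"
    unfolding d_def P_def using contrAt_type[OF DV v] by simp
  have "inh \<Gamma> (sub y P)"
  proof (rule inh_CInd[OF P[unfolded Trunc_eq] _ _ y[unfolded Trunc_eq]])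
    show "stageTotal A # \<Gamma> \<turnstile> d \<Colon> inst 1 (CPt (wk 1 (stageTotal A)) (wk 1 (stageTotal A))
      (wk 1 (idfun (stageTotal A))) (wk 1 (stageNext A)) (Var 0)) P"
      using d by (simp add: truncPt_def)
    show "inh (stageTotal A # \<Gamma>) (coeqPathCase (wk 1 (stageTotal A)) (wk 1 (stageTotal A))
      (wk 1 (idfun (stageTotal A))) (wk 1 (stageNext A)) (shift 1 1 P) (shift 1 1 d) (Var 0))"
      using contrPathCase_inh[OF DV v]
      by (simp add: coeqPathCase_def contrPathCase_def P_def d_def pcat_def truncPt_def
        truncGlue_def Trunc_eq)
  qed
  then show ?thesis by (simp add: P_def)
qed

lemma isProp_Trunc_if_point:
  assumes A[simp]: "\<Gamma> \<turnstile> A \<Colon> U" and a[simp]: "\<Gamma> \<turnstile> a \<Colon> A"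
  shows "inh \<Gamma> (isProp (Trunc A))"
proof -
  note [simp] = ctx_if_has_type[OF A] ty baseIn_type Trunc_type U_El[OF Trunc_type] U_El[OF A]
  let ?D = "Trunc (wk 1 A) # Trunc A # \<Gamma>"
  have A2: "?D \<turnstile> wk 2 A \<Colon> U" and a2: "?D \<turnstile> wk 2 a \<Colon> wk 2 A" by simp_all
  obtain h where "?D \<turnstile> h \<Colon> nullHtpy (wk 2 A) (wk 2 a)"
    using nullHtpy_type(2)[OF A2 a2] by (auto simp: inh_def)
  then have D: "nullData ?D (wk 2 A) (wk 2 a) h" using A2 a2 by (simp add: nullData_def)
  have "inh ?D (Eq (Trunc (wk 2 A)) (baseIn (wk 2 A) (wk 2 a) Zero) v)" if "?D \<turnstile> v \<Colon> Trunc (wk 2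
    A)" for v
    by (rule Trunc_contr[OF D that])
  note * = this
  have "inh ?D (Eq (Trunc (wk 2 A)) (Var 1) (Var 0))"
    by (rule inh_Eq_trans[OF _ _ _ _ inh_Eq_sym[OF _ _ _ *] *]) simp_all
  then show ?thesis unfolding isProp_def by (auto intro!: inh_Lam)
qed

section \<open>Recursion into propositions\<close>

text \<open>The path case is supplied by the proof that \<open>B\<close> is a proposition. It is
  applied to the transported value as it stands, so transport in a constant family never has to be
  computed.\<close>

lemma coeq_rec_prop:
  assumes E: "\<Gamma> \<turnstile> E \<Colon> U" and V: "\<Gamma> \<turnstile> V \<Colon> U" and s: "\<Gamma> \<turnstile> s \<Colon> Arr E V" and t: "\<Gamma> \<turnstile> t \<Colon> Arr E V"
    and B: "\<Gamma> \<turnstile> B \<Colon> Type" and q: "inh \<Gamma> (isProp B)" and d: "inh (V # \<Gamma>) (wk 1 B)" and x: "\<Gamma> \<turnstile> x \<Colon>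
      Coeq E V s t"
  shows "inh \<Gamma> B"
proof -
  have E': "\<Gamma> \<turnstile> E \<Colon> Type" and V': "\<Gamma> \<turnstile> V \<Colon> Type" using E V by (auto intro: U_El)
  note [simp] = ctx_if_has_type[OF E] B E' V' E V
  have C: "\<Gamma> \<turnstile> Coeq E V s t \<Colon> U" by (rule Coeq_form[OF E V s t])
  have C': "\<Gamma> \<turnstile> Coeq E V s t \<Colon> Type" by (rule U_El[OF C])
  obtain d where d: "V # \<Gamma> \<turnstile> d \<Colon> wk 1 B" using d by (auto simp: inh_def)
  obtain q where q: "\<Gamma> \<turnstile> q \<Colon> isProp B" using q by (auto simp: inh_def)
  let ?C = "Coeq (wk 1 E) (wk 1 V) (wk 1 s) (wk 1 t)"
  let ?l = "CPt (wk 1 E) (wk 1 V) (wk 1 s) (wk 1 t) (App (wk 1 s) (Var 0))"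
  let ?r = "CPt (wk 1 E) (wk 1 V) (wk 1 s) (wk 1 t) (App (wk 1 t) (Var 0))"
  let ?g = "CGlue (wk 1 E) (wk 1 V) (wk 1 s) (wk 1 t) (Var 0)"
  let ?u = "subst d (App (wk 1 s) (Var 0) .: sh (Suc 0))"
  let ?w = "subst d (App (wk 1 t) (Var 0) .: sh (Suc 0))"
  have C1: "E # \<Gamma> \<turnstile> ?C \<Colon> U" using wk1_has_type[OF C E' refl] by simp
  have e: "E # \<Gamma> \<turnstile> Var 0 \<Colon> wk 1 E" by (simp add: ty)
  have sv: "E # \<Gamma> \<turnstile> App (wk 1 s) (Var 0) \<Colon> wk 1 V" and tv: "E # \<Gamma> \<turnstile> App (wk 1 t) (Var 0) \<Colon> wk 1 V"
    using App_wk_Var[OF E', of s "wk 1 V"] App_wk_Var[OF E', of t "wk 1 V"] s t by simp_all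
  have d1: "wk 1 V # E # \<Gamma> \<turnstile> shift 1 1 d \<Colon> wk 2 B" using lift1_has_type[OF d V' E'] by simp
  have u: "E # \<Gamma> \<turnstile> ?u \<Colon> wk 1 B" using type_sub[OF d1 sv] by simp
  have w: "E # \<Gamma> \<turnstile> ?w \<Colon> wk 1 B" using type_sub[OF d1 tv] by simp
  have l: "E # \<Gamma> \<turnstile> ?l \<Colon> ?C" by (rule CPt_intro[OF C1 sv])
  have r: "E # \<Gamma> \<turnstile> ?r \<Colon> ?C" by (rule CPt_intro[OF C1 tv])
  have g: "E # \<Gamma> \<turnstile> ?g \<Colon> Eq ?C ?l ?r" by (rule CGlue_intro[OF C1 e])
  have B1: "E # \<Gamma> \<turnstile> wk 1 B \<Colon> Type" by (simp add: ty)
  have "Eq (wk 1 ?C) (wk 1 ?l) (Var 0) # ?C # E # \<Gamma> \<turnstile> wk 2 (wk 1 B) \<Colon> Type"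
    using wk2_has_type[OF B1 U_El[OF C1] _ refl, of "Eq (wk 1 ?C) (wk 1 ?l) (Var 0)"]
      wk1_has_type[OF U_El[OF C1] U_El[OF C1] refl] wk1_has_type[OF l U_El[OF C1] refl] U_El[OF
        C1] by (simp add: ty)
  then have tr: "E # \<Gamma> \<turnstile> transport ?C (wk 2 B) ?l ?r ?g ?u \<Colon> wk 1 B"
    unfolding transport_def using J_elim[OF U_El[OF C1] l _ _ r g, of "wk 2 (wk 1 B)" ?u] u by simp
  have q1: "E # \<Gamma> \<turnstile> wk 1 q \<Colon> isProp (wk 1 B)" using wk1_has_type[OF q E' refl] by simp
  have "inh \<Gamma> (sub x (wk 1 B))"
  proof (rule inh_CInd[OF _ _ _ x])
    show "Coeq E V s t # \<Gamma> \<turnstile> wk 1 B \<Colon> Type" using C' by (simp add: ty)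
    show "V # \<Gamma> \<turnstile> d \<Colon> inst 1 (CPt (wk 1 E) (wk 1 V) (wk 1 s) (wk 1 t) (Var 0)) (wk 1 B)" using d
      by simp
    show "inh (E # \<Gamma>) (coeqPathCase (wk 1 E) (wk 1 V) (wk 1 s) (wk 1 t) (shift 1 1 (wk 1 B))
      (shift 1 1 d) (Var 0))"
      using isPropD[OF q1 tr w] by (auto simp: coeqPathCase_def intro: inhI)
  qed
  then show ?thesis by simp
qed

lemma inh_Sum:
  assumes P: "\<Gamma> \<turnstile> P \<Colon> Type" and Q: "\<Gamma> \<turnstile> Q \<Colon> Type" and B: "\<Gamma> \<turnstile> B \<Colon> Type"
    and "inh (P # \<Gamma>) (wk 1 B)" "inh (Q # \<Gamma>) (wk 1 B)" "\<Gamma> \<turnstile> e \<Colon> Sum P Q"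
  shows "inh \<Gamma> B"
proof -
  have "Sum P Q # \<Gamma> \<turnstile> wk 1 B \<Colon> Type" using P Q B by (simp add: ty)
  from Sum_elim[OF this _ _ assms(6)] assms(4,5) show ?thesis by (auto simp: inh_def)
qed

lemma inh_Arr:
  "\<lbrakk>inh \<Gamma> (Arr A B); \<Gamma> \<turnstile> a \<Colon> A\<rbrakk> \<Longrightarrow> inh \<Gamma> B"
  using App_Arr by (fastforce simp: inh_def)

lemma inh_wk1_Arr:
  "\<lbrakk>inh \<Gamma> (Arr A B); \<Gamma> \<turnstile> C \<Colon> Type\<rbrakk> \<Longrightarrow> inh (C # \<Gamma>) (Arr (wk 1 A) (wk 1 B))"
  using inh_wk1[of \<Gamma> "Arr A B" C] by simp

lemma Join_rec_prop:
  assumes P: "\<Gamma> \<turnstile> P \<Colon> U" and Q: "\<Gamma> \<turnstile> Q \<Colon> U" and B: "\<Gamma> \<turnstile> B \<Colon> Type" and q: "inh \<Gamma> (isProp B)"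
    and f: "inh \<Gamma> (Arr P B)" and g: "inh \<Gamma> (Arr Q B)" and x: "\<Gamma> \<turnstile> x \<Colon> Join P Q"
  shows "inh \<Gamma> B"
proof -
  note t = U_El[OF P] U_El[OF Q] B P Q
  have S: "\<Gamma> \<turnstile> Sum P Q \<Colon> Type" using t by (simp add: ty)
  let ?D = "Sum P Q # \<Gamma>"
  have P1: "?D \<turnstile> wk 1 P \<Colon> Type" and Q1: "?D \<turnstile> wk 1 Q \<Colon> Type" and B1: "?D \<turnstile> wk 1 B \<Colon> Type"
    using t by (simp_all add: ty)
  have "inh (wk 1 P # ?D) (wk 1 (wk 1 B))"
    by (rule inh_Arr[OF inh_wk1_Arr[OF inh_wk1_Arr[OF f S] P1], of "Var 0"]) (use P1 in \<open>simp add: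
      ty\<close>)
  moreover have "inh (wk 1 Q # ?D) (wk 1 (wk 1 B))"
    by (rule inh_Arr[OF inh_wk1_Arr[OF inh_wk1_Arr[OF g S] Q1], of "Var 0"]) (use Q1 in \<open>simp add:
      ty\<close>)
  ultimately have "inh ?D (wk 1 B)"
    by (rule inh_Sum[OF P1 Q1 B1, of "Var 0"]) (use P1 Q1 S in \<open>simp add: ty\<close>)
  then show ?thesis
    by (rule coeq_rec_prop[OF _ _ joinSrc_type(2) joinTgt_type(2) B q, rotated 6])
      (use t x in \<open>simp_all add: Join_def Pushout_def ty\<close>)
qed

text \<open>Here \<open>B\<close> ranges over all types and not only over elements of
  \<open>U\<close>, as the universal property requires.\<close>

definition recData :: "tm list \<Rightarrow> tm \<Rightarrow> tm \<Rightarrow> bool" where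
  "recData \<Gamma> A B \<longleftrightarrow> \<Gamma> \<turnstile> A \<Colon> U \<and> \<Gamma> \<turnstile> B \<Colon> Type \<and> inh \<Gamma> (isProp B) \<and> inh \<Gamma> (Arr A B)"

lemma recData_wk: "\<lbrakk>recData \<Gamma> A B; \<Gamma> \<turnstile> C \<Colon> Type\<rbrakk> \<Longrightarrow> recData (C # \<Gamma>) (wk 1 A) (wk 1 B)"
  unfolding recData_def using inh_wk1[of \<Gamma> "isProp B" C] inh_wk1_Arr[of \<Gamma> A B C] by (auto simp: ty)

text \<open>Induction on the exponent: a join maps into a proposition as soon as both factors do,
  and the induction hypothesis provides the map on the second factor.\<close>

lemma joinPow1_rec_prop:
  assumes D: "recData \<Gamma> A B" and n: "\<Gamma> \<turnstile> n \<Colon> Nat"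
  shows "inh \<Gamma> (Arr (joinPow1 A n) B)"
proof -
  have A: "\<Gamma> \<turnstile> A \<Colon> U" and B: "\<Gamma> \<turnstile> B \<Colon> Type" and f: "inh \<Gamma> (Arr A B)" using D by (auto simp:
    recData_def)
  define C where "C = Arr (joinPow1 (wk 1 A) (Var 0)) (wk 1 B)"
  note [simp] = ctx_if_has_type[OF A] A B U_El[OF A] ty joinPow1_type U_El[OF joinPow1_type]
  have N: "\<Gamma> \<turnstile> Nat \<Colon> Type" by simp
  have C: "Nat # \<Gamma> \<turnstile> C \<Colon> Type" by (simp add: C_def)
  have "inh \<Gamma> (sub n C)"
  proof (rule inh_Nat[OF C _ _ n])
    show "inh \<Gamma> (sub Zero C)"
      using inh_conv[OF f Arr_cong[OF U_El_cong[OF jeq_sym[OF joinPow1_Zero]] _ jeq_refl]]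
      by (simp add: C_def)
    let ?D = "C # Nat # \<Gamma>"
    note D2 = recData_wk[OF recData_wk[OF D N] C]
    \<comment> \<open>Opaque names keep the simplifier from merging this weakening with the later
      ones.\<close>
    define A' where "A' = wk 2 A"
    define B' where "B' = wk 2 B"
    let ?n = "Var 1"
    have D2: "recData ?D A' B'" using D2 by (simp add: A'_def B'_def)
    have n': "?D \<turnstile> ?n \<Colon> Nat" using C by simp
    have A': "?D \<turnstile> A' \<Colon> U" and B': "?D \<turnstile> B' \<Colon> Type" and f': "inh ?D (Arr A' B')" using D2 by (auto
      simp: recData_def)
    have Ih: "inh ?D (Arr (joinPow1 A' ?n) B')"
      by (rule inhI[of _ "Var 0"]) (use C in \<open>simp add: C_def A'_def B'_def\<close>)
    have J: "?D \<turnstile> Join A' (joinPow1 A' ?n) \<Colon> Type" by (rule U_El[OF Join_type[OF A'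
      joinPow1_type[OF A' n']]])
    let ?D' = "Join A' (joinPow1 A' ?n) # ?D"
    have "inh ?D' (wk 1 B')"
    proof (rule Join_rec_prop)
      note D3 = recData_wk[OF D2 J]
      show "?D' \<turnstile> wk 1 A' \<Colon> U" "?D' \<turnstile> wk 1 B' \<Colon> Type" "inh ?D' (isProp (wk 1 B'))" "inh ?D' (Arr
        (wk 1 A') (wk 1 B'))"
        using D3 by (auto simp: recData_def)
      show "?D' \<turnstile> wk 1 (joinPow1 A' ?n) \<Colon> U" using wk1_has_type[OF joinPow1_type[OF A' n'] J refl]
        by simp
      show "inh ?D' (Arr (wk 1 (joinPow1 A' ?n)) (wk 1 B'))" by (rule inh_wk1_Arr[OF Ih J])
      show "?D' \<turnstile> Var 0 \<Colon> Join (wk 1 A') (wk 1 (joinPow1 A' ?n))" using J by simp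
    qed
    moreover have "?D' \<turnstile> wk 1 B' \<Colon> Type" using wk1_has_type[OF B' J refl] by simp
    ultimately have "inh ?D (Arr (Join A' (joinPow1 A' ?n)) B')"
      unfolding Arr_def by (intro inh_Lam J)
    from inh_conv[OF this Arr_cong[OF U_El_cong[OF jeq_sym[OF joinPow1_Succ[OF A' n']]] J
      jeq_refl[OF B']]]
    show "inh ?D (inst 2 (Succ (Var 1)) C)" by (simp add: C_def A'_def B'_def)
  qed
  then show ?thesis by (simp add: C_def)
qed

lemma stage_rec_prop:
  assumes D: "recData \<Gamma> A B" and n: "\<Gamma> \<turnstile> n \<Colon> Nat"
  shows "inh \<Gamma> (Arr (stage A n) B)"
proof -
  have A: "\<Gamma> \<turnstile> A \<Colon> U" and B: "\<Gamma> \<turnstile> B \<Colon> Type" using D by (auto simp: recData_def)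
  define C where "C = Arr (stage (wk 1 A) (Var 0)) (wk 1 B)"
  note [simp] = ctx_if_has_type[OF A] A B U_El[OF A] ty stage_type U_El[OF stage_type]
  have N: "\<Gamma> \<turnstile> Nat \<Colon> Type" by simp
  have C: "Nat # \<Gamma> \<turnstile> C \<Colon> Type" by (simp add: C_def)
  have "inh \<Gamma> (sub n C)"
  proof (rule inh_Nat[OF C _ _ n])
    have "inh (Empty # \<Gamma>) (wk 1 B)" by (rule inh_Empty[of _ _ "Var 0"]) simp_all
    then have "inh \<Gamma> (Arr Empty B)" unfolding Arr_def by (intro inh_Lam) simp_all
    from inh_conv[OF this Arr_cong[OF U_El_cong[OF jeq_sym[OF stage_Zero]] _ jeq_refl]]
    show "inh \<Gamma> (sub Zero C)" by (simp add: C_def)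
    let ?D = "C # Nat # \<Gamma>"
    note D2 = recData_wk[OF recData_wk[OF D N] C]
    have n': "?D \<turnstile> Var 1 \<Colon> Nat" using C by simp
    have A': "?D \<turnstile> wk 2 A \<Colon> U" and B': "?D \<turnstile> wk 2 B \<Colon> Type" using D2 by (auto simp: recData_def)
    have "inh ?D (Arr (joinPow1 (wk 2 A) (Var 1)) (wk 2 B))"
      using joinPow1_rec_prop[OF D2 n'] by simp
    from inh_conv[OF this Arr_cong[OF U_El_cong[OF jeq_sym[OF stage_Succ[OF A' n']]] U_El[OF
      joinPow1_type[OF A' n']] jeq_refl[OF B']]]
    show "inh ?D (inst 2 (Succ (Var 1)) C)" by (simp add: C_def)
  qed
  then show ?thesis by (simp add: C_def)
qed

lemma Trunc_rec_prop:
  assumes D: "recData \<Gamma> A B"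
  shows "inh \<Gamma> (Arr (Trunc A) B)"
proof -
  \<comment> \<open>The claim is made for every context because it is applied with a generic point
    of the colimit added as a variable.\<close>
  have *: "inh \<Gamma> B" if D: "recData \<Gamma> A B" and x: "\<Gamma> \<turnstile> x \<Colon> Trunc A" for \<Gamma> A B x
  proof -
    have A: "\<Gamma> \<turnstile> A \<Colon> U" and B: "\<Gamma> \<turnstile> B \<Colon> Type" and q: "inh \<Gamma> (isProp B)" using D by (auto simp:
      recData_def)
    have V: "\<Gamma> \<turnstile> stageTotal A \<Colon> Type" by (rule U_El[OF stageTotal_type[OF A]])
    let ?D = "stageTotal A # \<Gamma>"
    have A1: "?D \<turnstile> wk 1 A \<Colon> U" and B1: "?D \<turnstile> wk 1 B \<Colon> Type" using A B V by (simp_all add: ty)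
    note S = stageTotal_ext[OF A1]
    note D3 = recData_wk[OF recData_wk[OF recData_wk[OF D V] S(2)] S(1)]
    let ?D2 = "stage (wk 2 A) (Var 0) # Nat # ?D"
    have "inh ?D2 (Arr (stage (wk 3 A) (Var 1)) (wk 3 B))"
      using stage_rec_prop[OF D3, of "Var 1"] S V by (simp add: ty)
    then have "inh ?D2 (wk 3 B)" by (rule inh_Arr[of _ _ _ "Var 0"]) (use S V in \<open>simp add: ty\<close>)
    then have "inh ?D (wk 1 B)"
      using inh_SigInd[of Nat "stage (wk 2 A) (Var 0)" ?D "wk 2 B" "Var 0"] V B wk1_has_type[OF
        B1, of "stageTotal (wk 1 A)"]
        U_El[OF stageTotal_type[OF A1]]
      by (simp add: ty)
    then show ?thesis
      by (rule coeq_rec_prop[OF stageTotal_type[OF A] stageTotal_type[OF A] idfun_type(1)[OF V]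
        stageNext_types(2)[OF A] B q _ x[unfolded Trunc_eq]])
  qed
  have A: "\<Gamma> \<turnstile> A \<Colon> U" and B: "\<Gamma> \<turnstile> B \<Colon> Type" using D by (auto simp: recData_def)
  have T: "\<Gamma> \<turnstile> Trunc A \<Colon> Type" by (rule U_El[OF Trunc_type[OF A]])
  have "inh (Trunc A # \<Gamma>) (wk 1 B)"
    by (rule *[OF recData_wk[OF D T], of "Var 0"]) (use T in \<open>simp add: ty\<close>)
  then show ?thesis using T B unfolding Arr_def by (intro inh_Lam) (simp_all add: ty)
qed

lemma isProp_Trunc:
  assumes A: "\<Gamma> \<turnstile> A \<Colon> U"
  shows "inh \<Gamma> (isProp (Trunc A))"
proof -
  have T: "\<Gamma> \<turnstile> Trunc A \<Colon> Type" by (rule U_El[OF Trunc_type[OF A]])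
  have A': "\<Gamma> \<turnstile> A \<Colon> Type" by (rule U_El[OF A])
  have P: "\<Gamma> \<turnstile> isProp (Trunc A) \<Colon> Type" by (rule isProp_type[OF T])
  have "inh (A # \<Gamma>) (isProp (Trunc (wk 1 A)))"
    by (rule isProp_Trunc_if_point[of _ _ "Var 0"]) (use A A' in \<open>simp_all add: ty\<close>)
  moreover have "A # \<Gamma> \<turnstile> isProp (Trunc (wk 1 A)) \<Colon> Type" using wk1_has_type[OF P A' refl] by simp
  ultimately have "inh \<Gamma> (Arr A (isProp (Trunc A)))"
    using A' by (auto intro!: inh_Lam)
  then have "recData \<Gamma> A (isProp (Trunc A))"
    using A P isProp_isProp[OF T] by (simp add: recData_def)
  from Trunc_rec_prop[OF this] have r: "inh \<Gamma> (Arr (Trunc A) (isProp (Trunc A)))" .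
  let ?D = "Trunc (wk 1 A) # Trunc A # \<Gamma>"
  have T1: "Trunc A # \<Gamma> \<turnstile> Trunc (wk 1 A) \<Colon> Type" using wk1_has_type[OF T T refl] by simp
  have T2: "?D \<turnstile> Trunc (wk 2 A) \<Colon> Type" using wk2_has_type[OF T T T1 refl] by simp
  \<comment> \<open>One of the two points to be compared supplies the proof that they are
    equal.\<close>
  have "inh ?D (isProp (Trunc (wk 2 A)))"
    using inh_Arr[OF inh_wk1_Arr[OF inh_wk1_Arr[OF r T] T1], of "Var 0"] T1 T by (simp add: ty)
  then obtain q where "?D \<turnstile> q \<Colon> isProp (Trunc (wk 2 A))" by (auto simp: inh_def)
  from isPropD[OF this, of "Var 1" "Var 0"] have "inh ?D (Eq (Trunc (wk 2 A)) (Var 1) (Var 0))"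
    using T T1 by (auto simp: ty intro!: inhI)
  then show ?thesis
    unfolding isProp_def using T T1 T2 by (auto intro!: inh_Lam simp: ty)
qed

section \<open>Equivalences between propositions\<close>

lemma inh_Pair:
  assumes "\<Gamma> \<turnstile> A \<Colon> Type" "A # \<Gamma> \<turnstile> B \<Colon> Type" "\<Gamma> \<turnstile> a \<Colon> A" "inh \<Gamma> (sub a B)"
  shows "inh \<Gamma> (Sig A B)"
  using Pair_intro assms unfolding inh_def by blast

text \<open>A single backward map serves as right and as left inverse. The two homotopies come from
  the proofs that \<open>Y\<close> and \<open>X\<close> are propositions.\<close>

lemma isEquiv_if_isProp:
  assumes X: "\<Gamma> \<turnstile> X \<Colon> Type" and Y: "\<Gamma> \<turnstile> Y \<Colon> Type" and f: "\<Gamma> \<turnstile> f \<Colon> Arr X Y"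
    and p: "inh \<Gamma> (isProp X)" and q: "inh \<Gamma> (isProp Y)" and g: "inh \<Gamma> (Arr Y X)"
  shows "inh \<Gamma> (isEquiv X Y f)"
proof -
  obtain p where p: "\<Gamma> \<turnstile> p \<Colon> isProp X" using p by (auto simp: inh_def)
  obtain q where q: "\<Gamma> \<turnstile> q \<Colon> isProp Y" using q by (auto simp: inh_def)
  obtain g where g: "\<Gamma> \<turnstile> g \<Colon> Arr Y X" using g by (auto simp: inh_def)
  have YX: "\<Gamma> \<turnstile> Arr Y X \<Colon> Type" using X Y by (simp add: ty)
  have f1: "X # \<Gamma> \<turnstile> App (wk 1 f) (Var 0) \<Colon> wk 1 Y" and g1: "Y # \<Gamma> \<turnstile> App (wk 1 g) (Var 0) \<Colon> wk 1 X"
    using App_wk_Var[OF X, of f "wk 1 Y"] App_wk_Var[OF Y, of g "wk 1 X"] f g by simp_all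
  have fg: "Y # \<Gamma> \<turnstile> App (wk 1 f) (App (wk 1 g) (Var 0)) \<Colon> wk 1 Y"
    using App_Arr[OF _ g1, of "wk 1 f" "wk 1 Y"] wk1_has_type[OF f Y refl] by simp
  have gf: "X # \<Gamma> \<turnstile> App (wk 1 g) (App (wk 1 f) (Var 0)) \<Colon> wk 1 X"
    using App_Arr[OF _ f1, of "wk 1 g" "wk 1 X"] wk1_has_type[OF g X refl] by simp
  have p1: "X # \<Gamma> \<turnstile> wk 1 p \<Colon> isProp (wk 1 X)" and q1: "Y # \<Gamma> \<turnstile> wk 1 q \<Colon> isProp (wk 1 Y)"
    using wk1_has_type[OF p X refl] wk1_has_type[OF q Y refl] by simp_all
  have "inh (Y # \<Gamma>) (Eq (wk 1 Y) (App (wk 1 f) (App (wk 1 g) (Var 0))) (Var 0))"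
    by (rule inhI[OF isPropD[OF q1 fg]]) (use Y in \<open>simp add: ty\<close>)
  then have "inh \<Gamma> (Pi Y (Eq (wk 1 Y) (App (wk 1 f) (App (wk 1 g) (Var 0))) (Var 0)))"
    using Y fg by (intro inh_Lam) (simp_all add: ty)
  then have "inh \<Gamma> (hasSection X Y f)"
    unfolding hasSection_def by (intro inh_Pair[OF YX hasSection_types(1)[OF X Y f] g]) simp
  moreover have "inh (X # \<Gamma>) (Eq (wk 1 X) (App (wk 1 g) (App (wk 1 f) (Var 0))) (Var 0))"
    by (rule inhI[OF isPropD[OF p1 gf]]) (use X in \<open>simp add: ty\<close>)
  then have "inh \<Gamma> (Pi X (Eq (wk 1 X) (App (wk 1 g) (App (wk 1 f) (Var 0))) (Var 0)))"
    using X gf by (intro inh_Lam) (simp_all add: ty)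
  then have "inh \<Gamma> (hasRetraction X Y f)"
    unfolding hasRetraction_def by (intro inh_Pair[OF YX hasRetraction_types(1)[OF X Y f] g]) simp
  ultimately obtain s r where "\<Gamma> \<turnstile> s \<Colon> hasSection X Y f" "\<Gamma> \<turnstile> r \<Colon> hasRetraction X Y f"
    by (auto simp: inh_def)
  with hasSection_types(2)[OF X Y f] wk1_has_type[OF hasRetraction_types(2)[OF X Y f]
    hasSection_types(2)[OF X Y f] refl]
  show ?thesis unfolding isEquiv_def Prod_def by (intro inhI[OF Pair_intro]) simp_all
qed

section \<open>Precomposition and the universal property\<close>

lemma precomp_type:
  assumes X: "\<Gamma> \<turnstile> X \<Colon> Type" and Y: "\<Gamma> \<turnstile> Y \<Colon> Type" and B: "\<Gamma> \<turnstile> B \<Colon> Type" and h: "\<Gamma> \<turnstile> h \<Colon> Arr X Y"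
  shows "\<Gamma> \<turnstile> precomp X Y B h \<Colon> Arr (Arr Y B) (Arr X B)"
proof -
  note [simp] = X Y B ty
  let ?D = "wk 1 X # Arr Y B # \<Gamma>"
  have "?D \<turnstile> App (wk 2 h) (Var 0) \<Colon> wk 2 Y"
    by (rule App_Arr[of _ _ "wk 2 X"]) (use wk2_has_type[OF h _ _ refl, of "Arr Y B" "wk 1 X"] in
      simp_all)
  then have "?D \<turnstile> App (Var 1) (App (wk 2 h) (Var 0)) \<Colon> wk 2 B"
    by (rule App_Arr[rotated]) simp
  then show ?thesis by (simp add: precomp_def)
qed

theorem corollary3p5:
  fixes \<Gamma> :: "tm list" and A :: tm
  assumes "\<Gamma> \<turnstile> A \<Colon> U"
  shows "(\<exists>t. \<Gamma> \<turnstile> t \<Colon> isProp (Trunc A)) \<and>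
    (\<forall>B q. \<Gamma> \<turnstile> B \<Colon> Type \<longrightarrow> \<Gamma> \<turnstile> q \<Colon> isProp B \<longrightarrow>
      (\<exists>e. \<Gamma> \<turnstile> e \<Colon> isEquiv (Arr (Trunc A) B) (Arr A B) (precomp A (Trunc A) B (truncIn A))))"
proof (intro conjI allI impI)
  show "\<exists>t. \<Gamma> \<turnstile> t \<Colon> isProp (Trunc A)"
    using isProp_Trunc[OF assms] by (simp add: inh_def)
  fix B q assume B: "\<Gamma> \<turnstile> B \<Colon> Type" and q: "\<Gamma> \<turnstile> q \<Colon> isProp B"
  have A: "\<Gamma> \<turnstile> A \<Colon> Type" by (rule U_El[OF assms])
  have T: "\<Gamma> \<turnstile> Trunc A \<Colon> Type" by (rule U_El[OF Trunc_type[OF assms]])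
  have AB: "\<Gamma> \<turnstile> Arr A B \<Colon> Type" and TB: "\<Gamma> \<turnstile> Arr (Trunc A) B \<Colon> Type"
    using A T B by (simp_all add: ty)
  \<comment> \<open>Both sides of the universal property have this form, with \<open>X\<close> the
    colimit and \<open>A\<close> respectively.\<close>
  have p: "inh \<Gamma> (isProp (Arr X B))" if X: "\<Gamma> \<turnstile> X \<Colon> Type" for X
    unfolding Arr_def using inh_wk1[OF inhI[OF q] X] X B by (intro isProp_Pi) (simp_all add: ty)
  \<comment> \<open>The backward map is built for a generic map from \<open>A\<close> to
    \<open>B\<close>, the new variable of the context, and then abstracted over it.\<close>
  have "recData (Arr A B # \<Gamma>) (wk 1 A) (wk 1 B)"
    using assms AB B inh_wk1[OF inhI[OF q] AB]
    by (auto simp: recData_def ty intro!: inhI[of _ "Var 0"])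
  from Trunc_rec_prop[OF this] have "inh (Arr A B # \<Gamma>) (wk 1 (Arr (Trunc A) B))" by simp
  moreover have "Arr A B # \<Gamma> \<turnstile> wk 1 (Arr (Trunc A) B) \<Colon> Type" using wk1_has_type[OF TB AB refl] by
    simp
  ultimately have "inh \<Gamma> (Arr (Arr A B) (Arr (Trunc A) B))"
    unfolding Arr_def[of "Arr A B"] by (intro inh_Lam[OF AB])
  from isEquiv_if_isProp[OF TB AB precomp_type[OF A T B truncIn_type[OF assms]] p[OF T] p[OF A]
    this]
  show "\<exists>e. \<Gamma> \<turnstile> e \<Colon> isEquiv (Arr (Trunc A) B) (Arr A B) (precomp A (Trunc A) B (truncIn A))"
    by (simp add: inh_def)
qed

end
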